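(* Let $\beta$ be an algebraic number of degree $n \ge 5$, let $\beta_{1}, \ldots, \beta_{n}$ be its conjugates and assume that $\mathrm{Gal}(\mathbb{Q}(\beta_{1}, \ldots, \beta_{n})/\mathbb{Q}) = \mathfrak{A}_{n}$. Let $\alpha= \beta_{1}^{a_{1}} \cdots \beta_{n}^{a_{n}}$ where $a_{1}, \ldots, a_{n} \in \mathbb{Z}$. Then: (1) $\alpha$ is a generator of $\mathbb{Q}(\beta_{1}, \ldots, \beta_{n})/\mathbb{Q}$ (i.e. $\mathbb{Q}(\alpha)=\mathbb{Q}(\beta_1,\dots,\beta_n)$) if and only if there is at most one pair of indices $i<j$ with $a_{i} = a_{j}$, i.e. $|\{a_1,\dots,a_n\}|\geq n-1$. (2) There is a function $g$ of $n$ alone with $g(n)\to 0$ as $n\to\infty$ such that: if $\alpha$ is a generator of $\mathbb{Q}(\beta_{1}, \ldots, \beta_{n})/\mathbb{Q}$ and $\beta$ is a unit, then $$h(\alpha) \ge (1+g(n)) \sqrt{\frac{n}{200\pi}}\left(\frac{\log(\log(n))}{\log(n)}\right)^{3}.$$ In particular, $h(\alpha)$ tends to infinity with $n$.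
   Context: The hypothesis $\mathrm{Gal}(\mathbb{Q}(\beta_{1}, \ldots, \beta_{n})/\mathbb{Q}) = \mathfrak{A}_{n}$ means that, identifying a permutation $\sigma$ of $\{1,\dots,n\}$ with the automorphism sending $\beta_i\mapsto\beta_{\sigma(i)}$, the Galois group is exactly the alternating group $\mathfrak{A}_n$. For $\alpha\in\overline{\mathbb{Q}}$ of degree $d$ with conjugates $\alpha_1,\dots,\alpha_d$, $M(\alpha)=|a|\prod_{i=1}^d\max(1,|\alpha_i|)$ with $a$ the leading coefficient of the minimal polynomial of $\alpha$ over $\mathbb{Z}$, and $h(\alpha)=\log(M(\alpha))/d$. *)

theory Defs
  imports Complex_Main "HOL-Algebra.Algebraic_Closure_Type"
    "HOL-Algebra.Generated_Fields" "HOL-Algebra.Sym_Groups"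
begin

text \<open>For algebraic \<open>x\<close> the polynomial below exists and is unique: being non-constant and
  irreducible in \<open>\<int>[X]\<close>, it is primitive, hence also irreducible over \<open>\<rat>\<close>.\<close>

definition min_int_poly :: "complex \<Rightarrow> int poly" where
  "min_int_poly x =
     (THE p. Factorial_Ring.irreducible p \<and> lead_coeff p > 0 \<and> poly (map_poly of_int p) x = 0)"

definition alg_degree :: "complex \<Rightarrow> nat" where
  "alg_degree x = Polynomial.degree (min_int_poly x)"

definition alg_conjugates :: "complex \<Rightarrow> complex set" where
  "alg_conjugates x = {z. poly (map_poly of_int (min_int_poly x)) z = 0}"

text \<open>The roots of an irreducible polynomial in characteristic 0 are simple, so the product may
  range over the set of conjugates.\<close>

definition alg_mahler :: "complex \<Rightarrow> real" where
  "alg_mahler x =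
     \<bar>of_int (lead_coeff (min_int_poly x))\<bar> * (\<Prod>z\<in>alg_conjugates x. max 1 (cmod z))"

definition weil_height :: "complex \<Rightarrow> real" where
  "weil_height x = ln (alg_mahler x) / real (alg_degree x)"

definition algebraic_unit :: "complex \<Rightarrow> bool" where
  "algebraic_unit x \<longleftrightarrow> x \<noteq> 0 \<and> algebraic_int x \<and> algebraic_int (inverse x)"

text \<open>Every subfield of the complex numbers contains the rationals, so this is \<open>\<rat>(S)\<close>.\<close>

definition rat_adjoin :: "complex set \<Rightarrow> complex set" where
  "rat_adjoin S = generate_field (ring_of_type_algebra :: complex ring) S"

text \<open>Automorphisms are normalised to be undefined outside \<open>K\<close>, so that each one is represented by
  exactly one function.\<close>

definition galois_group :: "complex set \<Rightarrow> (complex \<Rightarrow> complex) set" where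
  "galois_group K =
     {\<sigma> \<in> ring_iso ((ring_of_type_algebra :: complex ring)\<lparr>carrier := K\<rparr>)
                   ((ring_of_type_algebra :: complex ring)\<lparr>carrier := K\<rparr>).
        \<sigma> \<in> extensional K \<and> (\<forall>q\<in>\<rat>. \<sigma> q = q)}"

text \<open>The Galois group of \<open>\<rat>(b\<^sub>1, \<dots>, b\<^sub>n)/\<rat>\<close> as a set of permutations of the indices.\<close>

definition galois_perms :: "nat \<Rightarrow> (nat \<Rightarrow> complex) \<Rightarrow> (nat \<Rightarrow> nat) set" where
  "galois_perms n b =
     {\<pi>. \<pi> permutes {1..n} \<and>
          (\<exists>\<sigma>\<in>galois_group (rat_adjoin (b ` {1..n})). \<forall>i\<in>{1..n}. \<sigma> (b i) = b (\<pi> i))}"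

definition alternating_conjugates :: "nat \<Rightarrow> complex \<Rightarrow> (nat \<Rightarrow> complex) \<Rightarrow> bool" where
  "alternating_conjugates n \<beta> b \<longleftrightarrow>
     algebraic \<beta> \<and> alg_degree \<beta> = n \<and> bij_betw b {1..n} (alg_conjugates \<beta>) \<and>
     galois_perms n b = carrier (alt_group n)"

end

theory Submission
  imports Defs "Jordan_Normal_Form.Char_Poly" "HOL-Real_Asymp.Real_Asymp"
    "HOL-Analysis.L2_Norm" "HOL-Analysis.Complex_Transcendental"
begin

text \<open>A multiplicative relation \<open>\<Prod>b\<^sub>i\<^bsup>c\<^sub>i\<^esup> = 1\<close> is preserved by even permutations of the exponents.  If \<open>c\<close> is not
  constant, differences under 3-cycles make some \<open>b\<^sub>i / b\<^sub>j\<close> a root of unity, and this is impossible since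
  automorphisms commute on roots of unity but 3-cycles sharing one point do not commute.  Hence the stabiliser of \<open>\<alpha>\<close> is the stabiliser of the exponent vector, which gives (1).

  For (2) put \<open>x\<^sub>i = log \<bar>b\<^sub>i\<bar>\<close>, so that \<open>\<Sum>x\<^sub>i = 0\<close>, \<open>\<Sum>\<bar>x\<^sub>i\<bar> = 2 log M(\<beta>)\<close> and \<open>h(\<alpha>)\<close> is half the mean of
  \<open>\<bar>\<Sum>a\<^sub>i x\<^bsub>\<pi>(i)\<^esub>\<bar>\<close> over \<open>\<pi> \<in> A\<^sub>n\<close>.  Pairing large with small exponents and applying Khinchine's inequality to the
  signs coming from the exchanges of the pairs, this mean is at least of the order \<open>\<surd>n log M(\<beta>)\<close>.  Finally
  \<open>log M(\<beta>)\<close> is bounded below by Dobrowolski's method: a nonzero integer polynomial of small height which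
  vanishes to high order at the \<open>b\<^sub>i\<close>, found by the pigeonhole principle, would vanish at all \<open>b\<^sub>i\<^sup>p\<close> for more primes
  \<open>p\<close> than its degree allows.\<close>

section \<open>Subfields of the complex numbers and their homomorphisms\<close>

text \<open>Averaging the exponents over a 3-cycle on u, v, w makes the linear form invariant under
  the transposition of u and v, and the sum over A_n becomes half the sum over all permutations.
  This costs three indices; with the one coincidence allowed among the exponents, n - 4 distinct
  integers remain, whence \<open>s = n - 4\<close>. Extremal pairing and the constant 1 / sqrt 3 in
  Khinchine's inequality give h(\<alpha>) >= (1 + o(1)) sqrt (n / 72) log M(\<beta>). Since sqrt (72
  / (200 pi)) = 0.3385..., it suffices that log M(\<beta>) >= 0.34 (log log n / log n)^3 for large
  n. Dobrowolski's argument with Chebyshev's estimate for the primes reaches any constant below (log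
  2) / 2 = 0.3466..., so the numerical parameters have little room. The points b_i^p are distinct
  because multiplicative relations have constant exponents. As all leading-order inequalities are
  strict, the bound holds with g(n) = 0 for large n.\<close>

definition complex_subfield :: "complex set \<Rightarrow> bool" where
  "complex_subfield F \<longleftrightarrow> 1 \<in> F \<and> (\<forall>x\<in>F. \<forall>y\<in>F. x - y \<in> F \<and> x * y \<in> F) \<and> (\<forall>x\<in>F. inverse x \<in> F)"

text \<open>No codomain is fixed, because an embedding is extended root by root and its image is
  known only at the end; \<open>\<phi> 1 = 1\<close> excludes the zero map.\<close>

definition field_hom_on :: "complex set \<Rightarrow> (complex \<Rightarrow> complex) \<Rightarrow> bool" where
  "field_hom_on F \<phi> \<longleftrightarrow>
     \<phi> 1 = 1 \<and> (\<forall>x\<in>F. \<forall>y\<in>F. \<phi> (x + y) = \<phi> x + \<phi> y \<and> \<phi> (x * y) = \<phi> x * \<phi> y)"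

definition poly_over :: "complex set \<Rightarrow> complex poly \<Rightarrow> bool" where
  "poly_over F g \<longleftrightarrow> (\<forall>i. poly.coeff g i \<in> F)"

context
  fixes F assumes F: "complex_subfield F"
begin

lemma subfield_1: "1 \<in> F"
  and subfield_diff: "x \<in> F \<Longrightarrow> y \<in> F \<Longrightarrow> x - y \<in> F"
  and subfield_mult: "x \<in> F \<Longrightarrow> y \<in> F \<Longrightarrow> x * y \<in> F"
  and subfield_inverse: "x \<in> F \<Longrightarrow> inverse x \<in> F"
  using F unfolding complex_subfield_def by auto

lemma subfield_0: "0 \<in> F"
  using subfield_diff[OF subfield_1 subfield_1] by simp

lemma subfield_uminus: "x \<in> F \<Longrightarrow> - x \<in> F"
  using subfield_diff[OF subfield_0, of x] by simp

lemma subfield_add: "x \<in> F \<Longrightarrow> y \<in> F \<Longrightarrow> x + y \<in> F"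
  using subfield_diff[of x "- y"] subfield_uminus[of y] by simp

lemma subfield_sum: "(\<And>i. i \<in> I \<Longrightarrow> f i \<in> F) \<Longrightarrow> sum f I \<in> F"
  by (induction I rule: infinite_finite_induct) (auto simp: subfield_0 subfield_add)

lemma subfield_prod: "(\<And>i. i \<in> I \<Longrightarrow> f i \<in> F) \<Longrightarrow> prod f I \<in> F"
  by (induction I rule: infinite_finite_induct) (auto simp: subfield_1 subfield_mult)

lemma subfield_power: "x \<in> F \<Longrightarrow> x ^ k \<in> F"
  by (induction k) (auto simp: subfield_1 subfield_mult)

lemma subfield_powi: "x \<in> F \<Longrightarrow> x powi k \<in> F"
  by (auto simp: power_int_def subfield_power subfield_inverse)

lemma subfield_of_nat: "of_nat k \<in> F"
  by (induction k) (auto simp: subfield_0 subfield_1 subfield_add)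

lemma subfield_of_int: "of_int k \<in> F"
  by (cases k) (auto simp: subfield_of_nat subfield_uminus simp del: of_nat_Suc)

lemma subfield_divide: "x \<in> F \<Longrightarrow> y \<in> F \<Longrightarrow> x / y \<in> F"
  by (simp add: divide_inverse subfield_mult subfield_inverse)

lemma Rats_subset_subfield: "\<rat> \<subseteq> F"
  by (auto elim!: Rats_cases' simp: subfield_divide subfield_of_int)

lemma poly_over_0: "poly_over F 0"
  by (simp add: poly_over_def subfield_0)

lemma poly_over_add: "poly_over F g \<Longrightarrow> poly_over F h \<Longrightarrow> poly_over F (g + h)"
  by (simp add: poly_over_def subfield_add)

lemma poly_over_diff: "poly_over F g \<Longrightarrow> poly_over F h \<Longrightarrow> poly_over F (g - h)"
  by (simp add: poly_over_def subfield_diff)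

lemma poly_over_uminus: "poly_over F g \<Longrightarrow> poly_over F (- g)"
  by (simp add: poly_over_def subfield_uminus)

lemma poly_over_mult: "poly_over F g \<Longrightarrow> poly_over F h \<Longrightarrow> poly_over F (g * h)"
  by (simp add: poly_over_def coeff_mult subfield_sum subfield_mult)

lemma poly_over_monom: "c \<in> F \<Longrightarrow> poly_over F (monom c k)"
  by (simp add: poly_over_def subfield_0)

lemma poly_over_const: "c \<in> F \<Longrightarrow> poly_over F [:c:]"
  using poly_over_monom[of c 0] by (simp add: monom_0)

lemma poly_over_pderiv: "poly_over F g \<Longrightarrow> poly_over F (pderiv g)"
  by (simp add: poly_over_def coeff_pderiv subfield_mult subfield_of_nat del: of_nat_Suc)

lemma poly_over_map_of_int: "poly_over F (map_poly of_int p)"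
  by (simp add: poly_over_def coeff_map_poly subfield_of_int)

text \<open>Long division, keeping track that quotient and remainder have coefficients in F, which
  is a subset of the complex numbers and not a type.\<close>

lemma poly_over_division:
  assumes g: "poly_over F g" and m: "poly_over F m" "m \<noteq> 0"
  shows "\<exists>q r. poly_over F q \<and> poly_over F r \<and> g = q * m + r \<and> (r = 0 \<or> degree r < degree m)"
  using g
proof (induction "degree g" arbitrary: g rule: less_induct)
  case less
  show ?case
  proof (cases "degree g < degree m")
    case True
    then show ?thesis
      by (intro exI[of _ 0] exI[of _ g]) (simp add: less.prems poly_over_0)
  next
    case False
    define c where "c = lead_coeff g / lead_coeff m"
    define t where "t = monom c (degree g - degree m)"
    have c: "c \<in> F" using less.prems m by (simp add: c_def poly_over_def subfield_divide)
    then have t: "poly_over F t" by (simp add: t_def poly_over_monom)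
    define g' where "g' = g - t * m"
    have g': "poly_over F g'" by (simp add: g'_def poly_over_diff less.prems poly_over_mult t m)
    have "\<exists>q r. poly_over F q \<and> poly_over F r \<and> g' = q * m + r \<and> (r = 0 \<or> degree r < degree m)"
    \<comment> \<open>Cancelling the leading term lowers the degree only if the degree is positive;
      for two constants the difference \<open>g'\<close> is 0.\<close>
    proof (cases "degree g = 0")
      case True
      then have "degree m = 0" using False by simp
      then have "g' = 0" using True m
        by (auto simp: g'_def t_def c_def monom_0 elim!: degree_eq_zeroE)
      then show ?thesis by (intro exI[of _ 0]) (simp add: poly_over_0)
    next
      case gpos: False
      show ?thesis
      proof (cases "g' = 0")
        case True
        then show ?thesis by (intro exI[of _ 0]) (simp add: poly_over_0)
      next
        case g'0: False
        have "degree (t * m) \<le> degree g"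
          using False degree_mult_le[of t m] degree_monom_le[of c "degree g - degree m"]
          unfolding t_def by linarith
        then have "degree g' \<le> degree g" by (simp add: g'_def degree_diff_le)
        moreover have "poly.coeff (t * m) (degree g) = c * lead_coeff m"
          using False by (simp add: t_def coeff_monom_mult)
        then have "poly.coeff g' (degree g) = 0"
          using m by (simp add: g'_def c_def)
        ultimately have "degree g' < degree g"
          using g'0 by (metis le_neq_implies_less leading_coeff_0_iff)
        then show ?thesis using less.hyps g' by blast
      qed
    qed
    then obtain q r where "poly_over F q" "poly_over F r" "g' = q * m + r" "r = 0 \<or> degree r < degree m"
      by blast
    then show ?thesis
      by (intro exI[of _ "q + t"] exI[of _ r]) (auto simp: g'_def algebra_simps poly_over_add t)
  qed
qed

lemma minimal_poly_exists:
  assumes "poly_over F g" "g \<noteq> 0" "poly g z = 0"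
  shows "\<exists>m. poly_over F m \<and> m \<noteq> 0 \<and> poly m z = 0 \<and> degree m > 0 \<and>
    (\<forall>h. poly_over F h \<longrightarrow> poly h z = 0 \<longrightarrow> (\<exists>q. poly_over F q \<and> h = q * m)) \<and>
    (\<forall>h. poly_over F h \<longrightarrow> poly h z = 0 \<longrightarrow> h \<noteq> 0 \<longrightarrow> degree m \<le> degree h)"
proof -
  let ?Q = "\<lambda>m. poly_over F m \<and> m \<noteq> 0 \<and> poly m z = 0"
  obtain m where m: "?Q m" and min: "\<And>h. ?Q h \<Longrightarrow> degree m \<le> degree h"
    using assms ex_has_least_nat[of ?Q g degree] by blast
  have "\<exists>q. poly_over F q \<and> h = q * m" if h: "poly_over F h" "poly h z = 0" for h
  proof -
    obtain q r where qr: "poly_over F q" "poly_over F r" "h = q * m + r" "r = 0 \<or> degree r < degree m"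
      using poly_over_division[of h m] h m by blast
    have "poly r z = 0" using qr h m by auto
    then have "r = 0" using qr min[of r] by force
    then show ?thesis using qr by auto
  qed
  moreover have "degree m > 0"
    using m by (auto elim!: degree_eq_zeroE intro!: Nat.gr0I)
  ultimately show ?thesis using m min by blast
qed

end

text \<open>Only a ring in general; it is the field F(z) when z is algebraic over F, which avoids
  the quotient construction F[X]/(m).\<close>

definition adjoin_root :: "complex set \<Rightarrow> complex \<Rightarrow> complex set" where
  "adjoin_root F z = {poly g z | g. poly_over F g}"

lemma
  assumes F: "complex_subfield F"
  shows adjoin_root_base: "F \<subseteq> adjoin_root F z" and adjoin_root_elem: "z \<in> adjoin_root F z"
proof -
  show "F \<subseteq> adjoin_root F z"
  proof
    fix x assume "x \<in> F"
    then have "poly_over F [:x:]" "x = poly [:x:] z" using poly_over_const[OF F] by auto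
    then show "x \<in> adjoin_root F z" unfolding adjoin_root_def by blast
  qed
  have "poly_over F (monom 1 1)" "z = poly (monom 1 1) z"
    using poly_over_monom[OF F] subfield_1[OF F] by (auto simp: poly_monom)
  then show "z \<in> adjoin_root F z" unfolding adjoin_root_def by blast
qed

lemma subfield_adjoin_root:
  assumes F: "complex_subfield F" and g: "poly_over F g" "g \<noteq> 0" "poly g z = 0"
  shows "complex_subfield (adjoin_root F z)"
proof -
  from minimal_poly_exists[OF F g] obtain m where
    m: "poly_over F m" "m \<noteq> 0" "poly m z = 0" "degree m > 0" and
    min': "\<forall>h. poly_over F h \<longrightarrow> poly h z = 0 \<longrightarrow> h \<noteq> 0 \<longrightarrow> degree m \<le> degree h"
    by (elim exE conjE)
  have min: "degree m \<le> degree h" if "poly_over F h" "poly h z = 0" "h \<noteq> 0" for h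
    using min' that by blast
  \<comment> \<open>Euclid's algorithm at z: m = q h + r gives q(z) h(z) = - r(z), so an inverse of
    r(z) yields one of h(z). If r(z) were 0, then r = 0 and q would annihilate z in degree smaller
    than that of m.\<close>
  have inv: "\<exists>k. poly_over F k \<and> poly k z * poly h z = 1"
    if "poly_over F h" "poly h z \<noteq> 0" "degree h < degree m" for h
    using that
  proof (induction "degree h" arbitrary: h rule: less_induct)
    case less
    show ?case
    proof (cases "degree h = 0")
      case True
      then obtain c where c: "h = [:c:]" by (auto elim: degree_eq_zeroE)
      then have "c \<in> F" "c \<noteq> 0" using less.prems by (auto simp: poly_over_def coeff_pCons split: nat.splits)
      then show ?thesis
        using c by (intro exI[of _ "[:inverse c:]"]) (auto intro!: poly_over_const[OF F] subfield_inverse[OF F])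
    next
      case False
      have "h \<noteq> 0" using less.prems by auto
      then obtain q r where qr: "poly_over F q" "poly_over F r" "m = q * h + r" "r = 0 \<or> degree r < degree h"
        using poly_over_division[OF F m(1) less.prems(1)] by blast
      have e: "poly q z * poly h z = - poly r z"
        using m(3) by (simp add: qr(3) add_eq_0_iff2)
      have "poly r z \<noteq> 0"
      proof
        assume r0: "poly r z = 0"
        then have "r = 0" using qr(4) min[OF qr(2) r0] less.prems by force
        then have "m = q * h" using qr by simp
        moreover have "poly q z = 0" using r0 e less.prems by simp
        moreover have "q \<noteq> 0" using m(2) calculation by auto
        ultimately have "degree m \<le> degree q" "degree m = degree q + degree h"
          using min[OF qr(1)] \<open>h \<noteq> 0\<close> by (auto simp: degree_mult_eq)
        then show False using False by simp
      qed
      then obtain k where k: "poly_over F k" "poly k z * poly r z = 1"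
        using less.hyps[of r] qr less.prems by fastforce
      have "poly (- (k * q)) z * poly h z = - (poly k z * (poly q z * poly h z))" by simp
      also have "\<dots> = 1" using e k by simp
      finally show ?thesis using k qr F
        by (intro exI[of _ "- (k * q)"]) (auto intro!: poly_over_uminus poly_over_mult)
    qed
  qed
  have "inverse x \<in> adjoin_root F z" if x: "x \<in> adjoin_root F z" for x
  proof (cases "x = 0")
    case True
    then show ?thesis using x by simp
  next
    case False
    obtain h where h: "poly_over F h" "x = poly h z" using x by (auto simp: adjoin_root_def)
    obtain q r where qr: "poly_over F q" "poly_over F r" "h = q * m + r" "r = 0 \<or> degree r < degree m"
      using poly_over_division[OF F h(1) m(1,2)] by blast
    have "poly r z = x" using qr(3) m(3) h by simp
    moreover have "degree r < degree m" using qr(4) m(4) by auto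
    ultimately obtain k where "poly_over F k" "poly k z * x = 1" using inv[of r] qr(2) False by auto
    moreover from this have "inverse x = poly k z" using False by (simp add: field_simps)
    ultimately show ?thesis by (auto simp: adjoin_root_def)
  qed
  moreover have "x - y \<in> adjoin_root F z" "x * y \<in> adjoin_root F z"
    if xy: "x \<in> adjoin_root F z" "y \<in> adjoin_root F z" for x y
  proof -
    obtain g h where "poly_over F g" "x = poly g z" "poly_over F h" "y = poly h z"
      using xy by (auto simp: adjoin_root_def)
    then have "poly_over F (g - h)" "poly_over F (g * h)" "x - y = poly (g - h) z" "x * y = poly (g * h) z"
      using F by (auto intro: poly_over_diff poly_over_mult)
    then show "x - y \<in> adjoin_root F z" "x * y \<in> adjoin_root F z"
      unfolding adjoin_root_def by blast+
  qed
  ultimately show ?thesis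
    using adjoin_root_base[OF F, of z] subfield_1[OF F] by (auto simp: complex_subfield_def)
qed

section \<open>Homomorphisms of subfields and their extension to a root\<close>

context
  fixes F \<phi> assumes F: "complex_subfield F" and hom: "field_hom_on F \<phi>"
begin

lemma field_hom_1: "\<phi> 1 = 1"
  and field_hom_add: "x \<in> F \<Longrightarrow> y \<in> F \<Longrightarrow> \<phi> (x + y) = \<phi> x + \<phi> y"
  and field_hom_mult: "x \<in> F \<Longrightarrow> y \<in> F \<Longrightarrow> \<phi> (x * y) = \<phi> x * \<phi> y"
  using hom by (auto simp: field_hom_on_def)

lemma field_hom_0: "\<phi> 0 = 0"
  using field_hom_add[of 0 0] subfield_0[OF F] by simp

lemma field_hom_uminus: "x \<in> F \<Longrightarrow> \<phi> (- x) = - \<phi> x"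
  using field_hom_add[of x "- x"] subfield_uminus[OF F] field_hom_0 by (simp add: add_eq_0_iff2)

lemma field_hom_diff: "x \<in> F \<Longrightarrow> y \<in> F \<Longrightarrow> \<phi> (x - y) = \<phi> x - \<phi> y"
  using field_hom_add[of x "- y"] field_hom_uminus subfield_uminus[OF F] by simp

lemma field_hom_inverse: "x \<in> F \<Longrightarrow> \<phi> (inverse x) = inverse (\<phi> x)"
proof (cases "x = 0")
  case False
  assume x: "x \<in> F"
  have "\<phi> x * \<phi> (inverse x) = 1"
    using field_hom_mult[OF x subfield_inverse[OF F x]] False field_hom_1 by simp
  then show ?thesis by (metis inverse_unique)
qed (simp add: field_hom_0)

lemma field_hom_eq_0: "x \<in> F \<Longrightarrow> \<phi> x = 0 \<longleftrightarrow> x = 0"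
proof
  assume x: "x \<in> F" "\<phi> x = 0"
  show "x = 0"
  proof (rule ccontr)
    assume "x \<noteq> 0"
    then have "\<phi> x * \<phi> (inverse x) = 1"
      using field_hom_mult[OF x(1) subfield_inverse[OF F x(1)]] field_hom_1 by simp
    then show False using x by simp
  qed
qed (simp add: field_hom_0)

lemma field_hom_inj: "inj_on \<phi> F"
  by (rule inj_onI) (metis field_hom_diff field_hom_eq_0 subfield_diff[OF F] eq_iff_diff_eq_0)

lemma field_hom_sum: "(\<And>i. i \<in> I \<Longrightarrow> f i \<in> F) \<Longrightarrow> \<phi> (sum f I) = (\<Sum>i\<in>I. \<phi> (f i))"
  by (induction I rule: infinite_finite_induct)
     (auto simp: field_hom_0 field_hom_add subfield_sum[OF F])

lemma field_hom_prod: "(\<And>i. i \<in> I \<Longrightarrow> f i \<in> F) \<Longrightarrow> \<phi> (prod f I) = (\<Prod>i\<in>I. \<phi> (f i))"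
  by (induction I rule: infinite_finite_induct)
     (auto simp: field_hom_1 field_hom_mult subfield_prod[OF F])

lemma field_hom_power: "x \<in> F \<Longrightarrow> \<phi> (x ^ k) = \<phi> x ^ k"
  by (induction k) (auto simp: field_hom_1 field_hom_mult subfield_power[OF F])

lemma field_hom_powi: "x \<in> F \<Longrightarrow> \<phi> (x powi k) = \<phi> x powi k"
  by (auto simp: power_int_def field_hom_power field_hom_inverse subfield_inverse[OF F])

lemma field_hom_of_nat: "\<phi> (of_nat k) = of_nat k"
  by (induction k) (auto simp: field_hom_0 field_hom_1 field_hom_add subfield_1[OF F] subfield_of_nat[OF F])

lemma field_hom_of_int: "\<phi> (of_int k) = of_int k"
  by (cases k) (auto simp: field_hom_of_nat field_hom_uminus subfield_of_nat[OF F] simp del: of_nat_Suc)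

lemma field_hom_Rats: "q \<in> \<rat> \<Longrightarrow> \<phi> q = q"
  by (auto elim!: Rats_cases' simp: divide_inverse field_hom_mult field_hom_inverse field_hom_of_int
        subfield_of_int[OF F] subfield_inverse[OF F])

lemma field_hom_map_poly_of_int: "map_poly \<phi> (map_poly of_int p) = map_poly of_int p"
  by (rule poly_eqI) (simp add: coeff_map_poly field_hom_0 field_hom_of_int)

lemma field_hom_poly:
  assumes "poly_over F g" "x \<in> F" shows "\<phi> (poly g x) = poly (map_poly \<phi> g) (\<phi> x)"
proof -
  have c: "poly.coeff g i \<in> F" for i using assms by (simp add: poly_over_def)
  have "\<phi> (poly g x) = (\<Sum>i\<le>degree g. \<phi> (poly.coeff g i) * \<phi> x ^ i)"
    using assms c by (simp add: poly_altdef field_hom_sum field_hom_mult field_hom_power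
        subfield_mult[OF F] subfield_power[OF F])
  also have "\<dots> = (\<Sum>i\<le>degree g. poly.coeff (map_poly \<phi> g) i * \<phi> x ^ i)"
    by (simp add: coeff_map_poly field_hom_0)
  also have "\<dots> = poly (map_poly \<phi> g) (\<phi> x)"
  proof -
    have "degree (map_poly \<phi> g) = degree g"
    proof (cases "g = 0")
      case False
      then show ?thesis using c field_hom_eq_0 by (intro map_poly_degree_eq) auto
    qed simp
    then show ?thesis by (simp add: poly_altdef)
  qed
  finally show ?thesis .
qed

lemma map_poly_hom_add:
  "poly_over F g \<Longrightarrow> poly_over F h \<Longrightarrow> map_poly \<phi> (g + h) = map_poly \<phi> g + map_poly \<phi> h"
  by (rule poly_eqI) (simp add: coeff_map_poly field_hom_0 field_hom_add poly_over_def)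

lemma map_poly_hom_diff:
  "poly_over F g \<Longrightarrow> poly_over F h \<Longrightarrow> map_poly \<phi> (g - h) = map_poly \<phi> g - map_poly \<phi> h"
  by (rule poly_eqI) (simp add: coeff_map_poly field_hom_0 field_hom_diff poly_over_def)

lemma map_poly_hom_mult:
  "poly_over F g \<Longrightarrow> poly_over F h \<Longrightarrow> map_poly \<phi> (g * h) = map_poly \<phi> g * map_poly \<phi> h"
  by (rule poly_eqI)
     (simp add: coeff_map_poly coeff_mult field_hom_0 field_hom_mult field_hom_sum poly_over_def subfield_mult[OF F])

text \<open>The assumption on w is exactly what makes the value of the image polynomial at w
  independent of the polynomial g chosen to represent g(z).\<close>

lemma field_hom_extend_adjoin_root:
  assumes w: "\<And>g. poly_over F g \<Longrightarrow> poly g z = 0 \<Longrightarrow> poly (map_poly \<phi> g) w = 0"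
  obtains \<psi> where "field_hom_on (adjoin_root F z) \<psi>" "\<And>x. x \<in> F \<Longrightarrow> \<psi> x = \<phi> x" "\<psi> z = w"
proof -
  define \<psi> where "\<psi> x = poly (map_poly \<phi> (SOME g. poly_over F g \<and> poly g z = x)) w" for x
  have \<psi>: "\<psi> (poly g z) = poly (map_poly \<phi> g) w" if g: "poly_over F g" for g
  proof -
    define h where "h = (SOME h. poly_over F h \<and> poly h z = poly g z)"
    have h: "poly_over F h \<and> poly h z = poly g z"
      unfolding h_def by (rule someI[of _ g]) (use g in auto)
    then have "poly (map_poly \<phi> (h - g)) w = 0" using g by (intro w) (auto intro: poly_over_diff[OF F])
    then show ?thesis using g h by (simp add: \<psi>_def h_def[symmetric] map_poly_hom_diff)
  qed
  have base: "\<psi> x = \<phi> x" if "x \<in> F" for x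
  proof -
    have "map_poly \<phi> [:x:] = [:\<phi> x:]"
      by (rule poly_eqI) (simp add: coeff_map_poly coeff_pCons field_hom_0 split: nat.splits)
    then show ?thesis using \<psi>[OF poly_over_const[OF F that]] by simp
  qed
  have "\<psi> z = w"
    using \<psi>[of "monom 1 1"] poly_over_monom[OF F, of 1 1] subfield_1[OF F]
    by (simp add: poly_monom map_poly_monom field_hom_0 field_hom_1)
  moreover have "\<psi> (x + y) = \<psi> x + \<psi> y" "\<psi> (x * y) = \<psi> x * \<psi> y"
    if xy: "x \<in> adjoin_root F z" "y \<in> adjoin_root F z" for x y
  proof -
    obtain g h where gh: "poly_over F g" "x = poly g z" "poly_over F h" "y = poly h z"
      using xy by (auto simp: adjoin_root_def)
    show "\<psi> (x + y) = \<psi> x + \<psi> y"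
      using \<psi>[OF poly_over_add[OF F gh(1,3)]] gh \<psi> by (simp add: map_poly_hom_add)
    show "\<psi> (x * y) = \<psi> x * \<psi> y"
      using \<psi>[OF poly_over_mult[OF F gh(1,3)]] gh \<psi> by (simp add: map_poly_hom_mult)
  qed
  ultimately show ?thesis
    using that[of \<psi>] base subfield_1[OF F] field_hom_1 by (auto simp: field_hom_on_def)
qed

text \<open>Since \<open>\<phi>\<close> is injective, the image of the minimal polynomial keeps its
  degree and has a root by the fundamental theorem of algebra; that root serves for every g
  vanishing at z.\<close>

lemma field_hom_extend_root_exists:
  assumes g: "poly_over F g" "g \<noteq> 0" "poly g z = 0"
  obtains w where "\<And>g. poly_over F g \<Longrightarrow> poly g z = 0 \<Longrightarrow> poly (map_poly \<phi> g) w = 0"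
proof -
  from minimal_poly_exists[OF F g] obtain m where
    m: "poly_over F m" "m \<noteq> 0" "poly m z = 0" "degree m > 0" and
    dvd: "\<forall>h. poly_over F h \<longrightarrow> poly h z = 0 \<longrightarrow> (\<exists>q. poly_over F q \<and> h = q * m)"
    by (elim exE conjE)
  have "degree (map_poly \<phi> m) = degree m"
    using m by (intro map_poly_degree_eq) (auto simp: field_hom_eq_0 poly_over_def)
  then obtain w where w: "poly (map_poly \<phi> m) w = 0"
    using m(4) fundamental_theorem_of_algebra[of "map_poly \<phi> m"] by (auto simp: constant_degree)
  have "poly (map_poly \<phi> h) w = 0" if h: "poly_over F h" "poly h z = 0" for h
    using dvd h w m by (force simp: map_poly_hom_mult)
  then show ?thesis using that by blast
qed

end

text \<open>Through this lemma, agreement of two automorphisms at generators spreads to the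
  generated field.\<close>

lemma subfield_equalizer:
  assumes K: "complex_subfield K" and \<sigma>: "field_hom_on K \<sigma>" and \<tau>: "field_hom_on K \<tau>"
  shows "complex_subfield {x\<in>K. \<sigma> x = \<tau> x}"
  unfolding complex_subfield_def
  using subfield_1[OF K] subfield_diff[OF K] subfield_mult[OF K] subfield_inverse[OF K]
    field_hom_1[OF K \<sigma>] field_hom_diff[OF K \<sigma>] field_hom_mult[OF K \<sigma>] field_hom_inverse[OF K \<sigma>]
    field_hom_1[OF K \<tau>] field_hom_diff[OF K \<tau>] field_hom_mult[OF K \<tau>] field_hom_inverse[OF K \<tau>]
  by auto

section \<open>Integral elements\<close>

definition complex_subring :: "complex set \<Rightarrow> bool" where
  "complex_subring R \<longleftrightarrow> 1 \<in> R \<and> (\<forall>x\<in>R. \<forall>y\<in>R. x - y \<in> R \<and> x * y \<in> R)"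

text \<open>Over \<open>\<rat>\<close> this means algebraic and over \<open>\<int>\<close> algebraic
  integer, so closure under sums and products is proved once for both.\<close>

definition integral_over :: "complex set \<Rightarrow> complex \<Rightarrow> bool" where
  "integral_over R x \<longleftrightarrow> (\<exists>p. lead_coeff p = 1 \<and> (\<forall>i. poly.coeff p i \<in> R) \<and> poly p x = 0)"

context
  fixes R assumes R: "complex_subring R"
begin

lemma subring_1: "1 \<in> R"
  and subring_diff: "x \<in> R \<Longrightarrow> y \<in> R \<Longrightarrow> x - y \<in> R"
  and subring_mult: "x \<in> R \<Longrightarrow> y \<in> R \<Longrightarrow> x * y \<in> R"
  using R unfolding complex_subring_def by auto

lemma subring_0: "0 \<in> R"
  using subring_diff[OF subring_1 subring_1] by simp

lemma subring_uminus: "x \<in> R \<Longrightarrow> - x \<in> R"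
  using subring_diff[OF subring_0, of x] by simp

lemma subring_add: "x \<in> R \<Longrightarrow> y \<in> R \<Longrightarrow> x + y \<in> R"
  using subring_diff[of x "- y"] subring_uminus[of y] by simp

lemma subring_sum: "(\<And>i. i \<in> I \<Longrightarrow> f i \<in> R) \<Longrightarrow> sum f I \<in> R"
  by (induction I rule: infinite_finite_induct) (auto simp: subring_0 subring_add)

lemma subring_coeff_mult:
  "(\<And>i. poly.coeff g i \<in> R) \<Longrightarrow> (\<And>i. poly.coeff h i \<in> R) \<Longrightarrow> poly.coeff (g * h) i \<in> R"
  by (simp add: coeff_mult subring_sum subring_mult)

lemma subring_coeff_prod:
  "(\<And>k i. k \<in> I \<Longrightarrow> poly.coeff (f k) i \<in> R) \<Longrightarrow> poly.coeff (prod f I) i \<in> R"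
proof (induction I arbitrary: i rule: infinite_finite_induct)
  case (insert x I)
  then show ?case by (auto intro!: subring_coeff_mult)
qed (auto simp: coeff_1 subring_0 subring_1)

lemma coeff_char_poly_in_subring:
  assumes M: "M \<in> carrier_mat n n" and ent: "\<And>i j. i < n \<Longrightarrow> j < n \<Longrightarrow> M $$ (i, j) \<in> R"
  shows "poly.coeff (char_poly M) k \<in> R"
proof -
  let ?C = "char_poly_matrix M"
  have C: "poly.coeff (?C $$ (i, j)) l \<in> R" if "i < n" "j < n" for i j l
    using that M ent[OF that]
    by (cases "i = j") (auto simp: char_poly_matrix_def coeff_pCons subring_0 subring_1 subring_uminus split: nat.splits)
  have "poly.coeff (signof p * (\<Prod>i = 0..<n. ?C $$ (i, p i))) l \<in> R" if p: "p permutes {0..<n}" for p l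
  proof -
    have "poly.coeff (\<Prod>i = 0..<n. ?C $$ (i, p i)) l \<in> R" for l
      using p C by (intro subring_coeff_prod) (auto simp: permutes_in_image)
    then show ?thesis by (auto simp: sign_def subring_uminus)
  qed
  then show ?thesis
    unfolding char_poly_def det_def'[OF char_poly_matrix_closed[OF M]] coeff_sum
    by (intro subring_sum) simp
qed

lemma integral_over_if_eigenvalue:
  fixes n :: nat
  assumes eq: "\<And>i. i < n \<Longrightarrow> z * v i = (\<Sum>j<n. a i j * v j)"
    and a: "\<And>i j. i < n \<Longrightarrow> j < n \<Longrightarrow> a i j \<in> R" and nz: "i0 < n" "v i0 \<noteq> 0"
  shows "integral_over R z"
proof -
  define M where "M = Matrix.mat n n (\<lambda>(i, j). a i j)"
  have M: "M \<in> carrier_mat n n" by (simp add: M_def)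
  have "M *\<^sub>v Matrix.vec n v = z \<cdot>\<^sub>v Matrix.vec n v"
    by (rule eq_vecI) (auto simp: M_def scalar_prod_def eq atLeast0LessThan)
  moreover have "Matrix.vec n v \<noteq> 0\<^sub>v n"
  proof
    assume "Matrix.vec n v = 0\<^sub>v n"
    then have "vec_index (Matrix.vec n v) i0 = vec_index (0\<^sub>v n) i0" by simp
    then show False using nz by simp
  qed
  ultimately have "eigenvalue M z"
    unfolding eigenvalue_def eigenvector_def by (intro exI[of _ "Matrix.vec n v"]) (simp add: M_def)
  then have "poly (char_poly M) z = 0" using eigenvalue_root_char_poly[OF M] by simp
  moreover have "poly.coeff (char_poly M) k \<in> R" for k
    using a by (intro coeff_char_poly_in_subring[OF M]) (simp add: M_def)
  ultimately show ?thesis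
    unfolding integral_over_def using degree_monic_char_poly[OF M] by metis
qed

text \<open>The monomials \<open>x\<^sup>i y\<^sup>j\<close> of small degree span an \<open>R\<close>-module that is stable under multiplication
  by \<open>x\<close> and \<open>y\<close>, so \<open>x + y\<close> and \<open>x y\<close> are eigenvalues of matrices over \<open>R\<close>.\<close>

lemma
  assumes x: "integral_over R x" and y: "integral_over R y"
  shows integral_over_add: "integral_over R (x + y)" and integral_over_mult: "integral_over R (x * y)"
proof -
  obtain p q where p: "lead_coeff p = 1" "\<And>i. poly.coeff p i \<in> R" "poly p x = 0"
    and q: "lead_coeff q = 1" "\<And>i. poly.coeff q i \<in> R" "poly q y = 0"
    using x y unfolding integral_over_def by blast
  define d where "d = degree p"
  define e where "e = degree q"
  have "d > 0" "e > 0"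
    using p q by (auto simp: d_def e_def elim!: degree_eq_zeroE intro!: Nat.gr0I)
  \<comment> \<open>The index a * e + b with b < e stands for the monomial x^a y^b.\<close>
  define v where "v i = x ^ (i div e) * y ^ (i mod e)" for i
  define S where "S w \<longleftrightarrow> (\<exists>c. (\<forall>i. c i \<in> R) \<and> w = (\<Sum>i<d*e. c i * v i))" for w
  have S_add: "S (w + w')" if w: "S w" "S w'" for w w'
  proof -
    obtain c c' where "\<forall>i. c i \<in> R" "w = (\<Sum>i<d*e. c i * v i)" "\<forall>i. c' i \<in> R" "w' = (\<Sum>i<d*e. c' i * v i)"
      using w unfolding S_def by blast
    then show ?thesis unfolding S_def
      by (intro exI[of _ "\<lambda>i. c i + c' i"]) (auto simp: subring_add distrib_right sum.distrib)
  qed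
  have S_scale: "S (r * w)" if w: "S w" "r \<in> R" for w r
  proof -
    obtain c where "\<forall>i. c i \<in> R" "w = (\<Sum>i<d*e. c i * v i)"
      using w unfolding S_def by blast
    then show ?thesis unfolding S_def using w
      by (intro exI[of _ "\<lambda>i. r * c i"]) (auto simp: subring_mult sum_distrib_left mult.assoc)
  qed
  have S_0: "S 0" unfolding S_def by (intro exI[of _ "\<lambda>_. 0"]) (simp add: subring_0)
  have S_sum: "S (\<Sum>i\<in>I. f i)" if "\<And>i. i \<in> I \<Longrightarrow> S (f i)" for I and f :: "nat \<Rightarrow> complex"
    using that by (induction I rule: infinite_finite_induct) (auto simp: S_0 S_add)
  have red: "z ^ a = (\<Sum>i<degree p. (- poly.coeff p i) * z ^ (a - degree p + i))"
    if "lead_coeff p = 1" "poly p z = 0" "degree p \<le> a" for p and z :: complex and a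
  proof -
    have "{..degree p} = insert (degree p) {..<degree p}" by auto
    then have "0 = z ^ degree p + (\<Sum>i<degree p. poly.coeff p i * z ^ i)"
      using that by (simp add: poly_altdef)
    then have "z ^ degree p = (\<Sum>i<degree p. (- poly.coeff p i) * z ^ i)"
      by (simp add: sum_negf eq_neg_iff_add_eq_0)
    moreover have "z ^ a = z ^ (a - degree p) * z ^ degree p"
      using that by (simp flip: power_add)
    ultimately show ?thesis by (simp add: sum_distrib_left power_add mult_ac)
  qed
  have S1: "S (x ^ a * y ^ b)" if b: "b < e" for a b
  proof (induction a rule: less_induct)
    case (less a)
    show ?case
    proof (cases "a < d")
      case True
      let ?i = "a * e + b"
      have "a * e + b < (a + 1) * e" using b by simp
      also have "\<dots> \<le> d * e" using True by (intro mult_right_mono) auto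
      finally have i: "?i < d * e" .
      have "x ^ a * y ^ b = v ?i" using b \<open>e > 0\<close> by (simp add: v_def)
      also have "\<dots> = (\<Sum>i<d*e. (if i = ?i then 1 else 0) * v i)"
        using i by (simp add: if_distrib[of "\<lambda>t. t * _"] sum.delta cong: if_cong)
      finally show ?thesis unfolding S_def
        by (intro exI[of _ "\<lambda>i. if i = ?i then 1 else 0"]) (auto simp: subring_0 subring_1)
    next
      case False
      then have e: "x ^ a * y ^ b = (\<Sum>i<d. (- poly.coeff p i) * (x ^ (a - d + i) * y ^ b))"
        using red[OF p(1,3), of a] by (simp add: d_def sum_distrib_right mult.assoc)
      show ?thesis unfolding e using False p
        by (intro S_sum S_scale less.IH) (auto simp: subring_uminus)
    qed
  qed
  have S2: "S (x ^ a * y ^ b)" for a b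
  proof (induction b rule: less_induct)
    case (less b)
    show ?case
    proof (cases "b < e")
      case False
      then have e: "x ^ a * y ^ b = (\<Sum>i<e. (- poly.coeff q i) * (x ^ a * y ^ (b - e + i)))"
        using red[OF q(1,3), of b] by (simp add: e_def sum_distrib_left mult_ac)
      show ?thesis unfolding e using False q
        by (intro S_sum S_scale less.IH) (auto simp: subring_uminus)
    qed (use S1 in simp)
  qed
  have main: "integral_over R z" if z: "\<And>i. S (z * v i)" for z
  proof -
    obtain a where a: "\<And>i. (\<forall>j. a i j \<in> R) \<and> z * v i = (\<Sum>j<d*e. a i j * v j)"
      using z unfolding S_def by metis
    show ?thesis
    proof (rule integral_over_if_eigenvalue)
      show "0 < d * e" "v 0 \<noteq> 0" using \<open>d > 0\<close> \<open>e > 0\<close> by (auto simp: v_def)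
    qed (use a in auto)
  qed
  have e1: "x * v i = x ^ Suc (i div e) * y ^ (i mod e)" "y * v i = x ^ (i div e) * y ^ Suc (i mod e)" for i
    by (simp_all add: v_def)
  show "integral_over R (x + y)"
    using S_add[OF S2 S2] by (intro main) (simp only: distrib_right e1)
  have "x * y * v i = x ^ Suc (i div e) * y ^ Suc (i mod e)" for i
    by (simp add: v_def)
  then show "integral_over R (x * y)"
    using S2 by (intro main) metis
qed

end

section \<open>Algebraic numbers and algebraic integers as integral elements\<close>

lemma algebraic_int_iff_integral_over: "algebraic_int x \<longleftrightarrow> integral_over \<int> x"
  by (auto simp: integral_over_def algebraic_int.simps)

lemma complex_subring_Ints: "complex_subring \<int>"
  by (auto simp: complex_subring_def)

lemma complex_subfield_Rats: "complex_subfield \<rat>"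
  by (auto simp: complex_subfield_def)

lemma complex_subring_Rats: "complex_subring \<rat>"
  by (auto simp: complex_subring_def)

lemma algebraic_iff_integral_over: "algebraic x \<longleftrightarrow> integral_over \<rat> x"
proof
  assume "algebraic x"
  then obtain p where p: "\<forall>i. poly.coeff p i \<in> \<rat>" "p \<noteq> 0" "poly p x = 0"
    by (auto simp: algebraic_altdef)
  let ?q = "smult (inverse (lead_coeff p)) p"
  have "lead_coeff ?q = 1" "\<forall>i. poly.coeff ?q i \<in> \<rat>" "poly ?q x = 0" using p by auto
  then show "integral_over \<rat> x" unfolding integral_over_def by blast
next
  assume "integral_over \<rat> x"
  then obtain p where "lead_coeff p = 1" "\<And>i. poly.coeff p i \<in> \<rat>" "poly p x = 0"
    unfolding integral_over_def by blast
  then show "algebraic x" by (intro algebraicI'[of p]) auto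
qed

lemma algebraic_int_add: "algebraic_int (x + y)" if "algebraic_int x" "algebraic_int y" for x y :: complex
  using that integral_over_add[OF complex_subring_Ints] by (simp add: algebraic_int_iff_integral_over)

lemma algebraic_int_mult: "algebraic_int (x * y)" if "algebraic_int x" "algebraic_int y" for x y :: complex
  using that integral_over_mult[OF complex_subring_Ints] by (simp add: algebraic_int_iff_integral_over)

lemma algebraic_int_sum: "(\<And>i. i \<in> I \<Longrightarrow> algebraic_int (f i)) \<Longrightarrow> algebraic_int (\<Sum>i\<in>I. f i)"
  for f :: "'a \<Rightarrow> complex"
  by (induction I rule: infinite_finite_induct) (auto intro: algebraic_int_add)

lemma algebraic_int_prod: "(\<And>i. i \<in> I \<Longrightarrow> algebraic_int (f i)) \<Longrightarrow> algebraic_int (\<Prod>i\<in>I. f i)"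
  for f :: "'a \<Rightarrow> complex"
  by (induction I rule: infinite_finite_induct) (auto intro: algebraic_int_mult)

lemma algebraic_int_power: "algebraic_int x \<Longrightarrow> algebraic_int (x ^ k)" for x :: complex
  by (induction k) (auto intro: algebraic_int_mult)

lemma algebraic_int_poly:
  "algebraic_int x \<Longrightarrow> algebraic_int (poly (map_poly of_int p) x)" for x :: complex
  unfolding poly_altdef
  by (intro algebraic_int_sum algebraic_int_mult algebraic_int_power)
     (auto simp: coeff_map_poly intro: int_imp_algebraic_int)

lemma complex_subfield_algebraic: "complex_subfield {z. algebraic z}"
proof -
  have "algebraic (x + y)" "algebraic (x * y)" if "algebraic x" "algebraic y" for x y :: complex
    using that integral_over_add[OF complex_subring_Rats] integral_over_mult[OF complex_subring_Rats]
    by (simp_all add: algebraic_iff_integral_over)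
  from this(1)[of _ "- _"] this(2) show ?thesis by (auto simp: complex_subfield_def)
qed

section \<open>Galois theory of splitting fields\<close>

lemma complex_ring_a_inv: "\<ominus>\<^bsub>ring_of_type_algebra\<^esub> x = - (x :: complex)"
proof -
  interpret cr: field "ring_of_type_algebra :: complex ring" by (rule field_from_type_algebra)
  show ?thesis by (rule cr.minus_equality) (auto simp: ring_of_type_algebra_def)
qed

lemma complex_ring_m_inv: "x \<noteq> 0 \<Longrightarrow> inv\<^bsub>ring_of_type_algebra\<^esub> x = inverse (x :: complex)"
proof -
  interpret cr: field "ring_of_type_algebra :: complex ring" by (rule field_from_type_algebra)
  show "x \<noteq> 0 \<Longrightarrow> ?thesis" by (rule cr.comm_inv_char) (auto simp: ring_of_type_algebra_def)
qed

lemma rat_adjoin_incl: "S \<subseteq> rat_adjoin S"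
  unfolding rat_adjoin_def by (auto intro: generate_field.incl)

lemma complex_subfield_rat_adjoin: "complex_subfield (rat_adjoin S)"
proof -
  let ?R = "ring_of_type_algebra :: complex ring"
  have one: "1 \<in> rat_adjoin S"
    using generate_field.one[of ?R S] by (simp add: rat_adjoin_def ring_of_type_algebra_def)
  have neg: "- x \<in> rat_adjoin S" if "x \<in> rat_adjoin S" for x
    using generate_field.a_inv[of x ?R S] that by (simp add: rat_adjoin_def complex_ring_a_inv)
  have add: "x + y \<in> rat_adjoin S" if "x \<in> rat_adjoin S" "y \<in> rat_adjoin S" for x y
    using generate_field.eng_add[of x ?R S y] that by (simp add: rat_adjoin_def ring_of_type_algebra_def)
  have mult: "x * y \<in> rat_adjoin S" if "x \<in> rat_adjoin S" "y \<in> rat_adjoin S" for x y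
    using generate_field.eng_mult[of x ?R S y] that by (simp add: rat_adjoin_def ring_of_type_algebra_def)
  have inv: "inverse x \<in> rat_adjoin S" if x: "x \<in> rat_adjoin S" for x
  proof (cases "x = 0")
    case False
    then show ?thesis
      using generate_field.m_inv[of x ?R S] x complex_ring_m_inv[OF False]
      by (simp add: rat_adjoin_def ring_of_type_algebra_def)
  qed (use x in simp)
  show ?thesis
    unfolding complex_subfield_def using one neg add mult inv by (metis diff_conv_add_uminus)
qed

lemma rat_adjoin_least:
  assumes F: "complex_subfield F" and S: "S \<subseteq> F"
  shows "rat_adjoin S \<subseteq> F"
proof
  fix x assume "x \<in> rat_adjoin S"
  then have "x \<in> generate_field (ring_of_type_algebra :: complex ring) S" by (simp add: rat_adjoin_def)
  then show "x \<in> F"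
  proof induction
    case one
    then show ?case using subfield_1[OF F] by (simp add: ring_of_type_algebra_def)
  next
    case (incl h)
    then show ?case using S by auto
  next
    case (a_inv h)
    then show ?case using subfield_uminus[OF F] by (simp add: complex_ring_a_inv)
  next
    case (m_inv h)
    then have "h \<noteq> 0" by (simp add: ring_of_type_algebra_def)
    then show ?case using m_inv subfield_inverse[OF F] by (simp add: complex_ring_m_inv)
  next
    case (eng_add h1 h2)
    then show ?case using subfield_add[OF F] by (simp add: ring_of_type_algebra_def)
  next
    case (eng_mult h1 h2)
    then show ?case using subfield_mult[OF F] by (simp add: ring_of_type_algebra_def)
  qed
qed

lemma rat_adjoin_mono_subset: "S \<subseteq> rat_adjoin T \<Longrightarrow> rat_adjoin S \<subseteq> rat_adjoin T"
  by (rule rat_adjoin_least[OF complex_subfield_rat_adjoin])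

lemma galois_group_iff:
  assumes K: "complex_subfield K"
  shows "\<sigma> \<in> galois_group K \<longleftrightarrow> field_hom_on K \<sigma> \<and> bij_betw \<sigma> K K \<and> \<sigma> \<in> extensional K"
proof -
  have eq: "\<sigma> \<in> ring_iso ((ring_of_type_algebra :: complex ring)\<lparr>carrier := K\<rparr>)
                   ((ring_of_type_algebra :: complex ring)\<lparr>carrier := K\<rparr>) \<longleftrightarrow>
        field_hom_on K \<sigma> \<and> bij_betw \<sigma> K K"
    unfolding ring_iso_def Ring.ring_hom_def field_hom_on_def
    by (auto simp: ring_of_type_algebra_def bij_betw_def)
  show ?thesis
    unfolding galois_group_def using eq field_hom_Rats[OF K, of \<sigma>] by auto
qed

lemma algebraic_poly_over:
  assumes F: "complex_subfield F" and "algebraic z"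
  obtains g where "poly_over F g" "g \<noteq> 0" "poly g z = 0"
proof -
  obtain g where g: "\<And>i. poly.coeff g i \<in> \<int>" "g \<noteq> 0" "poly g z = 0"
    using assms(2) unfolding algebraic_def by blast
  have "poly_over F g" unfolding poly_over_def
    using g(1) by (metis Ints_cases subfield_of_int[OF F])
  then show ?thesis using that g by blast
qed

lemma field_hom_extend_finite:
  assumes F: "complex_subfield F" "field_hom_on F \<phi>" and S: "finite S" "\<And>s. s \<in> S \<Longrightarrow> algebraic s"
  shows "\<exists>F' \<psi>. complex_subfield F' \<and> F \<subseteq> F' \<and> S \<subseteq> F' \<and> field_hom_on F' \<psi> \<and> (\<forall>x\<in>F. \<psi> x = \<phi> x)"
  using S
proof (induction S rule: finite_induct)
  case empty
  then show ?case using F by blast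
next
  case (insert s S)
  obtain F' \<psi> where F': "complex_subfield F'" "F \<subseteq> F'" "S \<subseteq> F'" "field_hom_on F' \<psi>" "\<forall>x\<in>F. \<psi> x = \<phi> x"
    using insert by auto
  obtain g where g: "poly_over F' g" "g \<noteq> 0" "poly g s = 0"
    using algebraic_poly_over[OF F'(1), of s] insert.prems by auto
  obtain w where w: "\<And>g. poly_over F' g \<Longrightarrow> poly g s = 0 \<Longrightarrow> poly (map_poly \<psi> g) w = 0"
    using field_hom_extend_root_exists[OF F'(1,4) g] by blast
  obtain \<theta> where \<theta>: "field_hom_on (adjoin_root F' s) \<theta>" "\<And>x. x \<in> F' \<Longrightarrow> \<theta> x = \<psi> x"
    using field_hom_extend_adjoin_root[OF F'(1,4) w] by blast
  show ?case
    using subfield_adjoin_root[OF F'(1) g] adjoin_root_base[OF F'(1), of s] adjoin_root_elem[OF F'(1), of s] F' \<theta>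
    by (intro exI[of _ "adjoin_root F' s"] exI[of _ \<theta>]) auto
qed

section \<open>Splitting fields: normality and fixed fields\<close>

definition complex_roots :: "int poly \<Rightarrow> complex set" where
  "complex_roots P = {z. poly (map_poly of_int P) z = 0}"

lemma finite_complex_roots: "P \<noteq> 0 \<Longrightarrow> finite (complex_roots P)"
  unfolding complex_roots_def by (intro poly_roots_finite) (auto simp: map_poly_eq_0_iff)

lemma algebraic_complex_roots: "P \<noteq> 0 \<Longrightarrow> z \<in> complex_roots P \<Longrightarrow> algebraic z"
  unfolding complex_roots_def
  by (intro algebraicI[of "map_poly of_int P"]) (auto simp: coeff_map_poly map_poly_eq_0_iff)

context
  fixes P :: "int poly" and K :: "complex set"
  assumes P0: "P \<noteq> 0" and K_def: "K = rat_adjoin (complex_roots P)"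
begin

lemma splitting_field_subfield: "complex_subfield K"
  by (simp add: K_def complex_subfield_rat_adjoin)

lemma splitting_field_algebraic: "z \<in> K \<Longrightarrow> algebraic z"
  using rat_adjoin_least[OF complex_subfield_algebraic, of "complex_roots P"]
    algebraic_complex_roots[OF P0] by (auto simp: K_def)

lemma field_hom_complex_roots:
  assumes F: "complex_subfield F" "field_hom_on F \<psi>" and R: "complex_roots P \<subseteq> F"
  shows "\<psi> ` complex_roots P = complex_roots P"
proof (rule endo_inj_surj)
  show "finite (complex_roots P)" by (rule finite_complex_roots[OF P0])
  show "\<psi> ` complex_roots P \<subseteq> complex_roots P"
  proof
    fix y assume "y \<in> \<psi> ` complex_roots P"
    then obtain z where z: "z \<in> complex_roots P" "y = \<psi> z" by auto
    then have "poly (map_poly of_int P) y = \<psi> (poly (map_poly of_int P) z)"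
      using field_hom_poly[OF F poly_over_map_of_int[OF F(1)], of z P] R
      by (auto simp: field_hom_map_poly_of_int[OF F])
    then show "y \<in> complex_roots P" using z field_hom_0[OF F] by (simp add: complex_roots_def)
  qed
  show "inj_on \<psi> (complex_roots P)" using field_hom_inj[OF F] R by (rule inj_on_subset)
qed

text \<open>Normality: an extension of \<open>\<phi>\<close> to a field containing K permutes the
  roots of P, hence maps K, which they generate, onto itself.\<close>

lemma galois_extension:
  assumes F: "complex_subfield F" "field_hom_on F \<phi>" and FK: "F \<subseteq> K"
  obtains \<sigma> where "\<sigma> \<in> galois_group K" "\<And>x. x \<in> F \<Longrightarrow> \<sigma> x = \<phi> x"
proof -
  let ?R = "complex_roots P"
  have Ksub: "complex_subfield K" by (rule splitting_field_subfield)
  obtain F' \<psi> where F': "complex_subfield F'" "F \<subseteq> F'" "?R \<subseteq> F'" "field_hom_on F' \<psi>" "\<forall>x\<in>F. \<psi> x = \<phi> x"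
    using field_hom_extend_finite[OF F finite_complex_roots[OF P0]] algebraic_complex_roots[OF P0] by blast
  have KF': "K \<subseteq> F'" unfolding K_def using F' by (intro rat_adjoin_least)
  then have hom: "field_hom_on K \<psi>" using F'(4) by (auto simp: field_hom_on_def)
  have RK: "?R \<subseteq> K" unfolding K_def by (rule rat_adjoin_incl)
  have R: "\<psi> ` ?R = ?R" using field_hom_complex_roots[OF Ksub hom RK] .
  have "complex_subfield {x\<in>K. \<psi> x \<in> K}"
    unfolding complex_subfield_def
    using subfield_1[OF Ksub] subfield_diff[OF Ksub] subfield_mult[OF Ksub] subfield_inverse[OF Ksub]
      field_hom_1[OF Ksub hom] field_hom_diff[OF Ksub hom] field_hom_mult[OF Ksub hom] field_hom_inverse[OF Ksub hom]
    by auto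
  moreover have "?R \<subseteq> {x\<in>K. \<psi> x \<in> K}" using RK R by auto
  ultimately have "K \<subseteq> {x\<in>K. \<psi> x \<in> K}" using rat_adjoin_least unfolding K_def by blast
  then have into: "\<psi> ` K \<subseteq> K" by auto
  have "complex_subfield (\<psi> ` K)"
    unfolding complex_subfield_def
    using subfield_1[OF Ksub] subfield_diff[OF Ksub] subfield_mult[OF Ksub] subfield_inverse[OF Ksub]
      field_hom_1[OF Ksub hom] field_hom_diff[OF Ksub hom, symmetric] field_hom_mult[OF Ksub hom, symmetric]
      field_hom_inverse[OF Ksub hom, symmetric]
    by (auto intro!: imageI)
  moreover have "?R \<subseteq> \<psi> ` K" using image_mono[OF RK, of \<psi>] R by simp
  ultimately have "K \<subseteq> \<psi> ` K" using rat_adjoin_least unfolding K_def by blast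
  then have bij: "bij_betw \<psi> K K" using into field_hom_inj[OF Ksub hom] by (auto simp: bij_betw_def)
  have "restrict \<psi> K \<in> galois_group K"
    unfolding galois_group_iff[OF Ksub]
    using hom bij subfield_1[OF Ksub] subfield_add[OF Ksub] subfield_mult[OF Ksub]
    by (auto simp: field_hom_on_def cong: bij_betw_cong)
  moreover have "restrict \<psi> K x = \<phi> x" if "x \<in> F" for x using F'(5) FK that by auto
  ultimately show ?thesis using that by blast
qed

lemma galois_extension_root:
  assumes F: "complex_subfield F" "field_hom_on F \<phi>" and FK: "F \<subseteq> K" and z: "z \<in> K"
    and w: "\<And>g. poly_over F g \<Longrightarrow> poly g z = 0 \<Longrightarrow> poly (map_poly \<phi> g) w = 0"
  obtains \<sigma> where "\<sigma> \<in> galois_group K" "\<And>x. x \<in> F \<Longrightarrow> \<sigma> x = \<phi> x" "\<sigma> z = w"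
proof -
  have Ksub: "complex_subfield K" by (rule splitting_field_subfield)
  obtain g where g: "poly_over F g" "g \<noteq> 0" "poly g z = 0"
    using algebraic_poly_over[OF F(1) splitting_field_algebraic[OF z]] by blast
  obtain \<psi> where \<psi>: "field_hom_on (adjoin_root F z) \<psi>" "\<And>x. x \<in> F \<Longrightarrow> \<psi> x = \<phi> x" "\<psi> z = w"
    using field_hom_extend_adjoin_root[OF F w] by blast
  have "adjoin_root F z \<subseteq> K"
    using FK z unfolding adjoin_root_def poly_over_def
    by (auto simp: poly_altdef intro!: subfield_sum[OF Ksub] subfield_mult[OF Ksub] subfield_power[OF Ksub])
  then obtain \<sigma> where "\<sigma> \<in> galois_group K" "\<And>x. x \<in> adjoin_root F z \<Longrightarrow> \<sigma> x = \<psi> x"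
    using galois_extension[OF subfield_adjoin_root[OF F(1) g] \<psi>(1)] by blast
  then show ?thesis
    using \<psi> adjoin_root_base[OF F(1), of z] adjoin_root_elem[OF F(1), of z] by (intro that[of \<sigma>]) auto
qed

text \<open>The minimal polynomial of \<open>z\<close> over \<open>F\<close> is separable; if it is not linear, its second root
  yields an automorphism over \<open>F\<close> that moves \<open>z\<close>.\<close>

lemma galois_fixed:
  assumes F: "complex_subfield F" and FK: "F \<subseteq> K" and z: "z \<in> K"
    and fixed: "\<And>\<sigma>. \<sigma> \<in> galois_group K \<Longrightarrow> (\<And>x. x \<in> F \<Longrightarrow> \<sigma> x = x) \<Longrightarrow> \<sigma> z = z"
  shows "z \<in> F"
proof -
  have idh: "field_hom_on F id" by (simp add: field_hom_on_def)
  obtain g where g: "poly_over F g" "g \<noteq> 0" "poly g z = 0"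
    using algebraic_poly_over[OF F splitting_field_algebraic[OF z]] by blast
  from minimal_poly_exists[OF F g] obtain m where
    m: "poly_over F m" "m \<noteq> 0" "poly m z = 0" "degree m > 0" and
    dvd: "\<forall>h. poly_over F h \<longrightarrow> poly h z = 0 \<longrightarrow> (\<exists>q. poly_over F q \<and> h = q * m)" and
    min: "\<forall>h. poly_over F h \<longrightarrow> poly h z = 0 \<longrightarrow> h \<noteq> 0 \<longrightarrow> degree m \<le> degree h"
    by (elim exE conjE)
  obtain q where q: "m = [:-z, 1:] * q" using m(3) by (auto simp: poly_eq_0_iff_dvd dvd_def)
  have q0: "q \<noteq> 0" using q m by auto
  have deg: "degree m = Suc (degree q)" using q0 unfolding q by (subst degree_mult_eq) auto
  have "degree q = 0"
  proof (rule ccontr)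
    assume "degree q \<noteq> 0"
    then obtain w where w: "poly q w = 0"
      using fundamental_theorem_of_algebra[of q] by (auto simp: constant_degree)
    have "pderiv m \<noteq> 0" using m(4) by (simp add: pderiv_eq_0_iff)
    moreover have "degree (pderiv m) < degree m" using m(4) by (simp add: degree_pderiv)
    ultimately have "poly (pderiv m) z \<noteq> 0" using min poly_over_pderiv[OF F m(1)] by force
    moreover have "poly (pderiv m) z = poly q z" unfolding q pderiv_mult by (simp add: pderiv_pCons)
    ultimately have "poly q z \<noteq> 0" by simp
    then have "w \<noteq> z" using w by auto
    have "poly (map_poly id h) w = 0" if "poly_over F h" "poly h z = 0" for h
      using dvd that w q by (auto simp: map_poly_id)
    then obtain \<sigma> where "\<sigma> \<in> galois_group K" "\<And>x. x \<in> F \<Longrightarrow> \<sigma> x = id x" "\<sigma> z = w"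
      using galois_extension_root[OF F idh FK z, of w] by blast
    then show False using fixed[of \<sigma>] \<open>w \<noteq> z\<close> by auto
  qed
  then obtain c where "q = [:c:]" by (auto elim: degree_eq_zeroE)
  then have "m = [:- z * c, c:]" "c \<noteq> 0" using q q0 by auto
  then have "poly.coeff m 0 = - z * c" "poly.coeff m 1 = c" by auto
  then have "- z * c \<in> F" "c \<in> F" using m(1) by (metis poly_over_def)+
  then have "- (- z * c / c) \<in> F" using subfield_divide[OF F] subfield_uminus[OF F] by blast
  then show ?thesis using \<open>c \<noteq> 0\<close> by simp
qed

lemma galois_fixed_Rats:
  assumes "z \<in> K" "\<And>\<sigma>. \<sigma> \<in> galois_group K \<Longrightarrow> \<sigma> z = z"
  shows "z \<in> \<rat>"
  using galois_fixed[OF complex_subfield_Rats Rats_subset_subfield[OF splitting_field_subfield]] assms by blast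

end

section \<open>Minimal polynomials over the integers\<close>

text \<open>The primitive part m of an integer polynomial of least degree vanishing at x works, up
  to sign: pseudo-division gives a g = m q, and since contents multiply (Gauss's lemma), a divides
  the content of q and cancels.\<close>

lemma min_int_poly_aux:
  fixes x :: complex
  assumes "algebraic x"
  shows "\<exists>m :: int poly. Factorial_Ring.irreducible m \<and> lead_coeff m > 0 \<and> poly (map_poly of_int m) x = 0 \<and>
    (\<forall>g. poly (map_poly of_int g) x = 0 \<longrightarrow> m dvd g)"
proof -
  let ?Q = "\<lambda>m :: int poly. m \<noteq> 0 \<and> poly (map_poly of_int m) x = 0"
  obtain m0 where m0: "?Q m0" and min: "\<And>h. ?Q h \<Longrightarrow> degree m0 \<le> degree h"
    using assms by (elim algebraicE') (use ex_has_least_nat[of ?Q _ degree] in metis)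
  define m where "m = (if lead_coeff m0 > 0 then primitive_part m0 else - primitive_part m0)"
  have c0: "content m0 > 0"
    using m0 by (metis content_eq_zero_iff normalize_content normalize_int_def abs_ge_zero order_le_less)
  have "poly (map_poly of_int (smult (content m0) (primitive_part m0))) x = 0" using m0 by simp
  then have root0: "of_int (content m0) * poly (map_poly of_int (primitive_part m0)) x = 0"
    by (simp only: of_int_hom.map_poly_hom_smult poly_smult)
  have lc0: "content m0 * lead_coeff (primitive_part m0) = lead_coeff m0"
    using arg_cong[OF content_times_primitive_part[of m0], of lead_coeff] by (simp only: lead_coeff_smult)
  have cneg: "content (- p) = content p" for p :: "int poly"
    using content_smult[of "-1" p] by simp
  have m: "content m = 1" "poly (map_poly of_int m) x = 0" "degree m = degree m0"
    using m0 root0 c0 by (auto simp: m_def of_int_poly_hom.hom_uminus cneg)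
  have "lead_coeff m0 \<noteq> 0" using m0 by simp
  then have lc: "lead_coeff m > 0"
    using lc0[symmetric] c0 by (auto simp: m_def zero_less_mult_iff mult_less_0_iff not_less order_le_less)
  have mn: "m \<noteq> 0" using lc by auto
  have dvd: "m dvd g" if g: "poly (map_poly of_int g) x = 0" for g
  proof -
    obtain a q where aq: "a \<noteq> 0" "smult a g = m * q + pseudo_mod g m"
      and r: "pseudo_mod g m = 0 \<or> degree (pseudo_mod g m) < degree m"
      using pseudo_mod[OF mn, of g] by blast
    have "poly (map_poly of_int (smult a g)) x = poly (map_poly of_int (m * q + pseudo_mod g m)) x"
      using aq(2) by simp
    then have "poly (map_poly of_int (pseudo_mod g m)) x = 0"
      using g m(2) by (simp add: of_int_poly_hom.hom_add of_int_poly_hom.hom_mult of_int_hom.map_poly_hom_smult)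
    then have "pseudo_mod g m = 0" using r min[of "pseudo_mod g m"] m by force
    then have e: "smult a g = m * q" using aq by simp
    have "content (smult a g) = content (m * q)" by (simp only: e)
    then have "content q = \<bar>a\<bar> * content g" by (simp only: content_smult content_mult m(1)) simp
    then have "a dvd content q" using dvd_mult2[of a "\<bar>a\<bar>" "content g"] by simp
    then have "[:a:] dvd q" by (simp add: const_poly_dvd_iff_dvd_content)
    then obtain q' where "q = smult a q'" by (auto elim!: dvdE)
    then have "smult a g = smult a (m * q')" using e by simp
    then have "smult a (g - m * q') = 0" by (simp add: smult_diff_right)
    then have "g = m * q'" using aq(1) by simp
    then show ?thesis by simp
  qed
  have pos: "degree m > 0"
  proof (rule ccontr)
    assume "\<not> degree m > 0"
    then obtain c where "m = [:c:]" by (auto elim: degree_eq_zeroE)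
    then show False using m(2) mn by simp
  qed
  have "Factorial_Ring.irreducible m"
  proof (rule Factorial_Ring.irreducibleI)
    show "\<not> is_unit m" using pos by (auto simp: is_unit_poly_iff)
    fix a b assume ab: "m = a * b"
    then have "poly (map_poly of_int a) x = 0 \<or> poly (map_poly of_int b) x = 0"
      using m by (simp add: of_int_poly_hom.hom_mult)
    then have "m dvd a \<or> m dvd b" using dvd by auto
    then show "is_unit a \<or> is_unit b"
    proof
      assume "m dvd a"
      then have "a * b dvd a * 1" using ab by simp
      moreover have "a \<noteq> 0" using mn ab by auto
      ultimately have "is_unit b" using dvd_mult_cancel_left[of a b 1] by simp
      then show ?thesis ..
    next
      assume "m dvd b"
      then have "b * a dvd b * 1" using ab by (simp add: mult.commute)
      moreover have "b \<noteq> 0" using mn ab by auto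
      ultimately have "is_unit a" using dvd_mult_cancel_left[of b a 1] by simp
      then show ?thesis ..
    qed
  qed (rule mn)
  then show ?thesis using lc m dvd by blast
qed

lemma min_int_poly_eqI:
  assumes p: "Factorial_Ring.irreducible p" "lead_coeff p > 0" "poly (map_poly of_int p) x = 0"
  shows "min_int_poly x = p"
    and "poly (map_poly of_int g) x = 0 \<Longrightarrow> p dvd g"
proof -
  have "p \<noteq> 0" using p by auto
  then have "algebraic x" using p by (intro algebraicI[of "map_poly of_int p"]) (auto simp: coeff_map_poly map_poly_eq_0_iff)
  then obtain m where m: "Factorial_Ring.irreducible m" "lead_coeff m > 0" "poly (map_poly of_int m) x = 0"
    and dvd: "\<And>g. poly (map_poly of_int g) x = 0 \<Longrightarrow> m dvd g"
    using min_int_poly_aux by blast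
  have uniq: "q = m" if q: "Factorial_Ring.irreducible q" "lead_coeff q > 0" "poly (map_poly of_int q) x = 0" for q
  proof -
    obtain c where c: "q = m * c" using dvd[OF q(3)] by auto
    have "\<not> is_unit m" using m(1) by (rule irreducible_not_unit)
    then have "is_unit c" using q(1) c by (metis irreducibleD)
    then obtain u where u: "c = [:u:]" "is_unit u" by (auto simp: is_unit_poly_iff)
    then have "lead_coeff q = lead_coeff m * u" using c by simp
    then have "u > 0" using q(2) m(2) by (simp add: zero_less_mult_iff)
    then have "u = 1" using u(2) by simp
    then show "q = m" using c u by (simp add: one_pCons[symmetric])
  qed
  show "min_int_poly x = p"
    unfolding min_int_poly_def using p uniq by (intro the_equality) blast+
  show "poly (map_poly of_int g) x = 0 \<Longrightarrow> p dvd g" using dvd uniq[OF p] by blast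
qed

context
  fixes x :: complex assumes x: "algebraic x"
begin

lemma min_int_poly_irreducible: "Factorial_Ring.irreducible (min_int_poly x)"
  and lead_coeff_min_int_poly: "lead_coeff (min_int_poly x) > 0"
  and min_int_poly_root: "poly (map_poly of_int (min_int_poly x)) x = 0"
proof -
  from min_int_poly_aux[OF x] obtain m where m: "Factorial_Ring.irreducible m" "lead_coeff m > 0"
    "poly (map_poly of_int m) x = 0" by (elim exE conjE)
  then have "min_int_poly x = m" by (rule min_int_poly_eqI(1))
  then show "Factorial_Ring.irreducible (min_int_poly x)" "lead_coeff (min_int_poly x) > 0"
    "poly (map_poly of_int (min_int_poly x)) x = 0" using m by simp_all
qed

lemma min_int_poly_nonzero: "min_int_poly x \<noteq> 0"
  using lead_coeff_min_int_poly by auto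

lemma min_int_poly_dvd: "poly (map_poly of_int g) x = 0 \<Longrightarrow> min_int_poly x dvd g"
  by (rule min_int_poly_eqI(2)[OF min_int_poly_irreducible lead_coeff_min_int_poly min_int_poly_root])

lemma alg_conjugates_eq_complex_roots: "alg_conjugates x = complex_roots (min_int_poly x)"
  by (simp add: alg_conjugates_def complex_roots_def)

lemma min_int_poly_conjugate: "y \<in> alg_conjugates x \<Longrightarrow> min_int_poly y = min_int_poly x"
  using min_int_poly_irreducible lead_coeff_min_int_poly
  by (intro min_int_poly_eqI(1)) (auto simp: alg_conjugates_def)

lemma alg_conjugates_conjugate: "y \<in> alg_conjugates x \<Longrightarrow> alg_conjugates y = alg_conjugates x"
  by (simp only: alg_conjugates_def[of y] min_int_poly_conjugate alg_conjugates_def[of x, symmetric])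

lemma algebraic_conjugate: "y \<in> alg_conjugates x \<Longrightarrow> algebraic y"
  using algebraic_complex_roots min_int_poly_nonzero by (auto simp: alg_conjugates_eq_complex_roots)

lemma int_poly_root_conjugate:
  "poly (map_poly of_int g) x = 0 \<Longrightarrow> y \<in> alg_conjugates x \<Longrightarrow> poly (map_poly of_int g) y = 0"
proof -
  assume "poly (map_poly of_int g) x = 0" and y: "y \<in> alg_conjugates x"
  then obtain q where "g = min_int_poly x * q" using min_int_poly_dvd[of g] by blast
  then show ?thesis using y by (simp add: alg_conjugates_def of_int_poly_hom.hom_mult)
qed

lemma degree_min_int_poly_pos: "degree (min_int_poly x) > 0"
proof (rule ccontr)
  assume "\<not> degree (min_int_poly x) > 0"
  then obtain c where "min_int_poly x = [:c:]" by (auto elim: degree_eq_zeroE)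
  then show False using min_int_poly_root min_int_poly_nonzero by simp
qed

end

lemma min_int_poly_rsquarefree:
  assumes x: "algebraic x" shows "rsquarefree (map_poly of_int (min_int_poly x) :: complex poly)"
  unfolding rsquarefree_roots
proof (intro allI notI)
  fix a :: complex
  assume "poly (map_poly of_int (min_int_poly x)) a = 0 \<and> poly (pderiv (map_poly of_int (min_int_poly x))) a = 0"
  then have a: "a \<in> alg_conjugates x" "poly (map_poly of_int (pderiv (min_int_poly x))) a = 0"
    by (auto simp: alg_conjugates_def of_int_hom.map_poly_pderiv)
  have "min_int_poly x dvd pderiv (min_int_poly x)"
    using min_int_poly_dvd[OF algebraic_conjugate[OF x a(1)] a(2)] min_int_poly_conjugate[OF x a(1)] by simp
  moreover have "pderiv (min_int_poly x) \<noteq> 0"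
    using degree_min_int_poly_pos[OF x] by (simp add: pderiv_eq_0_iff)
  ultimately have "degree (min_int_poly x) \<le> degree (pderiv (min_int_poly x))" by (rule dvd_imp_degree_le)
  then show False using degree_min_int_poly_pos[OF x] by (simp add: degree_pderiv)
qed

lemma min_int_poly_decompose:
  assumes x: "algebraic x"
  shows "map_poly of_int (min_int_poly x) =
    smult (of_int (lead_coeff (min_int_poly x))) (\<Prod>z\<in>alg_conjugates x. [:-z, 1:])"
  using complex_poly_decompose_rsquarefree[OF min_int_poly_rsquarefree[OF x]]
  by (simp add: alg_conjugates_def)

lemma card_alg_conjugates:
  assumes x: "algebraic x" shows "card (alg_conjugates x) = alg_degree x"
proof -
  have "degree (map_poly of_int (min_int_poly x) :: complex poly) = card (alg_conjugates x)"
    unfolding min_int_poly_decompose[OF x] using min_int_poly_nonzero[OF x]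
    by (simp add: degree_prod_eq_sum_degree)
  then show ?thesis by (simp add: alg_degree_def)
qed

lemma algebraic_int_min_int_poly_monic:
  assumes "algebraic_int (x :: complex)" shows "lead_coeff (min_int_poly x) = 1"
proof -
  have x: "algebraic x" using assms by auto
  obtain p where p: "poly (map_poly of_int p) x = 0" "lead_coeff p = 1"
    using assms by (auto simp: algebraic_int_altdef_ipoly)
  then obtain q where "p = min_int_poly x * q" using min_int_poly_dvd[OF x] by blast
  then have "lead_coeff (min_int_poly x) * lead_coeff q = 1" using p(2) by (simp add: lead_coeff_mult)
  then show ?thesis using lead_coeff_min_int_poly[OF x] by (auto simp: zmult_eq_1_iff)
qed

lemma clear_denominators:
  assumes "finite I" "\<And>i. i \<in> I \<Longrightarrow> f i \<in> (\<rat> :: complex set)"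
  shows "\<exists>d :: int. d \<noteq> 0 \<and> (\<forall>i\<in>I. of_int d * f i \<in> \<int>)"
  using assms
proof (induction I rule: finite_induct)
  case empty
  show ?case by (intro exI[of _ 1]) simp
next
  case (insert k I)
  then obtain d :: int where d: "d \<noteq> 0" "\<forall>i\<in>I. of_int d * f i \<in> \<int>" by auto
  obtain a b :: int where ab: "b > 0" "f k = of_int a / of_int b"
    using insert.prems[of k] by (auto elim: Rats_cases')
  have "of_int (b * d) * f k = of_int (d * a)" using ab by simp
  then have "of_int (b * d) * f k \<in> \<int>" by (metis Ints_of_int)
  moreover have "of_int (b * d) * f i \<in> \<int>" if "i \<in> I" for i
    using Ints_mult[OF Ints_of_int[of b] bspec[OF d(2) that]] by (simp add: mult.assoc)
  ultimately show ?case using d ab by (intro exI[of _ "b * d"]) auto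
qed

lemma rat_poly_root_conjugate:
  assumes x: "algebraic x" and g: "poly_over \<rat> g" "poly g x = 0" and y: "y \<in> alg_conjugates x"
  shows "poly g y = 0"
proof -
  obtain d :: int where d: "d \<noteq> 0" "\<forall>i\<in>{..degree g}. of_int d * poly.coeff g i \<in> \<int>"
    using clear_denominators[of "{..degree g}" "poly.coeff g"] g(1) by (auto simp: poly_over_def)
  have "poly.coeff (smult (of_int d) g) i \<in> \<int>" for i
    using d(2) by (cases "i \<le> degree g") (auto simp: coeff_eq_0)
  then obtain h where h: "smult (of_int d) g = map_poly of_int h" using intpolyE by metis
  have "poly (map_poly of_int h) x = 0" using g(2) by (simp flip: h)
  then have "poly (map_poly of_int h) y = 0" using int_poly_root_conjugate[OF x _ y] by blast
  then show ?thesis using d(1) by (simp flip: h)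
qed

text \<open>Every root of the minimal polynomial is reached, because sending x to it defines an
  embedding of Q(x), which extends to K.\<close>

lemma alg_conjugates_galois_orbit:
  assumes P: "P \<noteq> 0" "K = rat_adjoin (complex_roots P)" and x: "x \<in> K"
  shows "alg_conjugates x = (\<lambda>\<sigma>. \<sigma> x) ` galois_group K"
proof -
  have K: "complex_subfield K" using splitting_field_subfield[OF P] .
  have alg: "algebraic x" using splitting_field_algebraic[OF P x] .
  show ?thesis
  proof (intro equalityI subsetI)
    fix y assume y: "y \<in> alg_conjugates x"
    have id: "field_hom_on \<rat> id" by (simp add: field_hom_on_def)
    have "\<exists>\<sigma>. \<sigma> \<in> galois_group K \<and> \<sigma> x = y"
      using galois_extension_root[OF P complex_subfield_Rats id Rats_subset_subfield[OF K] x, of y]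
        rat_poly_root_conjugate[OF alg _ _ y] by (auto simp: map_poly_id)
    then show "y \<in> (\<lambda>\<sigma>. \<sigma> x) ` galois_group K" by auto
  next
    fix y assume "y \<in> (\<lambda>\<sigma>. \<sigma> x) ` galois_group K"
    then obtain \<sigma> where \<sigma>: "\<sigma> \<in> galois_group K" "y = \<sigma> x" by auto
    then have hom: "field_hom_on K \<sigma>" using galois_group_iff[OF K] by auto
    show "y \<in> alg_conjugates x"
      using field_hom_poly[OF K hom poly_over_map_of_int[OF K] x, of "min_int_poly x"] min_int_poly_root[OF alg]
        field_hom_0[OF K hom] \<sigma> by (simp add: alg_conjugates_def field_hom_map_poly_of_int[OF K hom])
  qed
qed

section \<open>Multiplicative relations between the conjugates\<close>

text \<open>Every automorphism raises \<open>\<omega>\<close> to some power, and raising to powers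
  commutes. The power exists because \<open>\<omega>\<close>, of exact order N, generates all N-th
  roots of unity.\<close>

lemma galois_commute_on_root_of_unity:
  assumes K: "complex_subfield K" and \<sigma>: "\<sigma> \<in> galois_group K" and \<tau>: "\<tau> \<in> galois_group K"
    and \<omega>: "\<omega> \<in> K" "\<omega> ^ z = 1" "z > 0"
  shows "\<sigma> (\<tau> \<omega>) = \<tau> (\<sigma> \<omega>)"
proof -
  define N where "N = (LEAST N. N > 0 \<and> \<omega> ^ N = 1)"
  have N: "N > 0 \<and> \<omega> ^ N = 1" unfolding N_def by (rule LeastI[of _ z]) (use \<omega> in auto)
  have N_le: "N \<le> M" if "M > 0" "\<omega> ^ M = 1" for M
    unfolding N_def by (rule Least_le) (use that in auto)
  have \<omega>0: "\<omega> \<noteq> 0" using N by (auto simp: power_0_left)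
  have "inj_on (\<lambda>k. \<omega> ^ k) {..<N}"
  proof (rule linorder_inj_onI')
    fix i j assume ij: "i \<in> {..<N}" "j \<in> {..<N}" "i < j"
    show "\<omega> ^ i \<noteq> \<omega> ^ j"
    proof
      assume e: "\<omega> ^ i = \<omega> ^ j"
      have "\<omega> ^ j = \<omega> ^ i * \<omega> ^ (j - i)" using ij by (simp flip: power_add)
      then have "\<omega> ^ (j - i) = 1" using e \<omega>0 by simp
      then show False using N_le[of "j - i"] ij by auto
    qed
  qed
  then have card: "card ((\<lambda>k. \<omega> ^ k) ` {..<N}) = N" by (simp add: card_image)
  have "(\<lambda>k. \<omega> ^ k) ` {..<N} \<subseteq> {u. u ^ N = 1}"
    using N by (auto simp flip: power_mult) (metis mult.commute power_mult power_one)
  moreover have "finite {u::complex. u ^ N = 1}" "card {u::complex. u ^ N = 1} = N"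
    using N card_roots_unity_eq[of N] by (auto simp: card_gt_0_iff intro!: card_ge_0_finite)
  ultimately have all: "(\<lambda>k. \<omega> ^ k) ` {..<N} = {u. u ^ N = 1}" using card by (intro card_subset_eq) auto
  have pow: "\<exists>k. \<rho> \<omega> = \<omega> ^ k" if "field_hom_on K \<rho>" for \<rho>
  proof -
    have "(\<rho> \<omega>) ^ N = 1" using field_hom_power[OF K that \<omega>(1), of N] N field_hom_1[OF K that] by simp
    then have "\<rho> \<omega> \<in> (\<lambda>k. \<omega> ^ k) ` {..<N}" using all by simp
    then show ?thesis by auto
  qed
  have h: "field_hom_on K \<sigma>" "field_hom_on K \<tau>" using \<sigma> \<tau> galois_group_iff[OF K] by auto
  obtain s t where st: "\<sigma> \<omega> = \<omega> ^ s" "\<tau> \<omega> = \<omega> ^ t" using pow h by blast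
  have "\<sigma> (\<tau> \<omega>) = (\<omega> ^ s) ^ t" using st field_hom_power[OF K h(1) \<omega>(1)] by simp
  moreover have "\<tau> (\<sigma> \<omega>) = (\<omega> ^ t) ^ s" using st field_hom_power[OF K h(2) \<omega>(1)] by simp
  ultimately show ?thesis by (simp flip: power_mult add: mult.commute)
qed

lemma power_int_eq_1_imp_power: "x powi z = 1 \<Longrightarrow> x ^ nat \<bar>z\<bar> = 1" for x :: "'a :: field"
  by (auto simp: power_int_def power_inverse split: if_splits)

definition three_cycle :: "'a \<Rightarrow> 'a \<Rightarrow> 'a \<Rightarrow> 'a \<Rightarrow> 'a" where
  "three_cycle i j k = Transposition.transpose i j \<circ> Transposition.transpose j k"

lemma three_cycle_apply:
  assumes "i \<noteq> j" "j \<noteq> k" "i \<noteq> k"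
  shows "three_cycle i j k i = j" "three_cycle i j k j = k" "three_cycle i j k k = i"
    "l \<notin> {i, j, k} \<Longrightarrow> three_cycle i j k l = l"
  using assms by (auto simp: three_cycle_def Transposition.transpose_def)

lemma three_cycle_permutes: "i \<in> S \<Longrightarrow> j \<in> S \<Longrightarrow> k \<in> S \<Longrightarrow> three_cycle i j k permutes S"
  unfolding three_cycle_def by (intro permutes_compose permutes_swap_id)

lemma three_cycle_even: "i \<noteq> j \<Longrightarrow> j \<noteq> k \<Longrightarrow> evenperm (three_cycle i j k)"
  unfolding three_cycle_def by (simp add: evenperm_comp permutation_swap_id evenperm_swap)

lemma obtain_distinct_outside:
  assumes "finite Z" "card Z + k \<le> n"
  shows "\<exists>xs. length xs = k \<and> distinct xs \<and> set xs \<subseteq> {1..n} - Z"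
proof -
  have "card {1..n} - card Z \<le> card ({1..n} - Z)" by (rule diff_card_le_card_Diff) (rule assms)
  then have "k \<le> card ({1..n} - Z)" using assms by simp
  then obtain Y where Y: "Y \<subseteq> {1..n} - Z" "card Y = k" "finite Y"
    by (rule obtain_subset_with_card_n)
  then obtain xs where "set xs = Y" "distinct xs" using finite_distinct_list by blast
  then show ?thesis using Y distinct_card[of xs] by auto
qed

section \<open>The conjugates under the alternating group\<close>

locale alternating =
  fixes n :: nat and \<beta> :: complex and b :: "nat \<Rightarrow> complex"
  assumes n5: "n \<ge> 5" and alt: "alternating_conjugates n \<beta> b"
begin

definition P :: "int poly" where "P = min_int_poly \<beta>"
definition K :: "complex set" where "K = rat_adjoin (b ` {1..n})"

lemma alg: "algebraic \<beta>" and deg: "alg_degree \<beta> = n"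
  and bij: "bij_betw b {1..n} (alg_conjugates \<beta>)"
  and gal_perms: "galois_perms n b = {p. p permutes {1..n} \<and> evenperm p}"
  using alt by (simp_all add: alternating_conjugates_def alt_group_def)

lemma P_nonzero: "P \<noteq> 0" unfolding P_def by (rule min_int_poly_nonzero[OF alg])

lemma roots: "complex_roots P = b ` {1..n}"
  using bij alg_conjugates_eq_complex_roots[OF alg] by (simp add: P_def bij_betw_def)

lemma K_splitting: "K = rat_adjoin (complex_roots P)"
  by (simp add: K_def roots)

lemma K_field: "complex_subfield K"
  by (rule splitting_field_subfield[OF P_nonzero K_splitting])

lemma b_in_K: "i \<in> {1..n} \<Longrightarrow> b i \<in> K"
  unfolding K_def by (rule subsetD[OF rat_adjoin_incl imageI])

lemma b_inj: "inj_on b {1..n}" using bij by (simp add: bij_betw_def)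

lemma b_eq_iff: "i \<in> {1..n} \<Longrightarrow> j \<in> {1..n} \<Longrightarrow> b i = b j \<longleftrightarrow> i = j"
  by (rule inj_on_eq_iff[OF b_inj])

lemma b_conj: "i \<in> {1..n} \<Longrightarrow> b i \<in> alg_conjugates \<beta>"
  by (rule bij_betwE[OF bij, rule_format])

lemma b_nonzero: "i \<in> {1..n} \<Longrightarrow> b i \<noteq> 0"
proof
  assume "i \<in> {1..n}" "b i = 0"
  then have "0 \<in> alg_conjugates \<beta>" using b_conj[of i] by simp
  then have "min_int_poly 0 = min_int_poly \<beta>" using min_int_poly_conjugate[OF alg] by blast
  moreover have "min_int_poly 0 dvd [:0, 1:]" by (rule min_int_poly_dvd) (auto simp: map_poly_pCons)
  ultimately have "degree (min_int_poly \<beta>) \<le> 1" using dvd_imp_degree_le[of "min_int_poly \<beta>" "[:0, 1:]"] by auto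
  then show False using deg n5 by (simp add: alg_degree_def)
qed

lemma galois_hom: "\<sigma> \<in> galois_group K \<Longrightarrow> field_hom_on K \<sigma>"
  using galois_group_iff[OF K_field] by blast

lemma galois_of_perm:
  assumes "\<pi> permutes {1..n}" "evenperm \<pi>"
  obtains \<sigma> where "\<sigma> \<in> galois_group K" "\<And>i. i \<in> {1..n} \<Longrightarrow> \<sigma> (b i) = b (\<pi> i)"
proof -
  have "\<pi> \<in> galois_perms n b" using assms gal_perms by simp
  then show ?thesis using that unfolding galois_perms_def K_def by blast
qed

lemma perm_of_galois:
  assumes \<sigma>: "\<sigma> \<in> galois_group K"
  obtains \<pi> where "\<pi> permutes {1..n}" "evenperm \<pi>" "\<And>i. i \<in> {1..n} \<Longrightarrow> \<sigma> (b i) = b (\<pi> i)"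
proof -
  have "complex_roots P \<subseteq> K" using b_in_K by (auto simp: roots)
  from field_hom_complex_roots[OF P_nonzero K_splitting K_field galois_hom[OF \<sigma>] this]
  have img: "\<sigma> ` (b ` {1..n}) = b ` {1..n}" by (simp only: roots)
  define \<pi> where "\<pi> i = (if i \<in> {1..n} then inv_into {1..n} b (\<sigma> (b i)) else i)" for i
  have \<pi>: "\<sigma> (b i) = b (\<pi> i)" "\<pi> i \<in> {1..n}" if i: "i \<in> {1..n}" for i
  proof -
    have "\<sigma> (b i) \<in> b ` {1..n}" using img i by blast
    then show "\<sigma> (b i) = b (\<pi> i)" "\<pi> i \<in> {1..n}"
      using i by (auto simp only: \<pi>_def if_True f_inv_into_f inv_into_into)
  qed
  have "inj_on \<pi> {1..n}"
  proof (rule inj_onI)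
    fix i j assume ij: "i \<in> {1..n}" "j \<in> {1..n}" "\<pi> i = \<pi> j"
    then have "\<sigma> (b i) = \<sigma> (b j)" using \<pi>(1)[of i] \<pi>(1)[of j] by simp
    then have "b i = b j"
      using field_hom_inj[OF K_field galois_hom[OF \<sigma>]] b_in_K ij by (auto simp: inj_on_def)
    then show "i = j" using b_eq_iff ij by simp
  qed
  moreover from this have "\<pi> ` {1..n} = {1..n}" using \<pi>(2) by (intro endo_inj_surj) auto
  ultimately have "bij_betw \<pi> {1..n} {1..n}" by (simp add: bij_betw_def)
  then have perm: "\<pi> permutes {1..n}" by (intro bij_imp_permutes) (auto simp: \<pi>_def)
  then have "\<pi> \<in> galois_perms n b"
    unfolding galois_perms_def using perm \<sigma> \<pi>(1) unfolding K_def by blast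
  then show ?thesis using that[of \<pi>] perm \<pi>(1) gal_perms by blast
qed

definition monomial :: "(nat \<Rightarrow> int) \<Rightarrow> complex" where
  "monomial c = (\<Prod>i=1..n. b i powi c i)"

lemma monomial_in_K: "monomial c \<in> K"
  unfolding monomial_def using b_in_K by (intro subfield_prod[OF K_field] subfield_powi[OF K_field])

lemma monomial_nonzero: "monomial c \<noteq> 0"
  unfolding monomial_def using b_nonzero by auto

lemma monomial_diff: "monomial (\<lambda>i. c i - d i) = monomial c / monomial d"
proof -
  have "monomial (\<lambda>i. c i - d i) = (\<Prod>i=1..n. b i powi c i / b i powi d i)"
    unfolding monomial_def using b_nonzero by (intro prod.cong) (auto simp: power_int_diff)
  then show ?thesis by (simp add: monomial_def prod_dividef)
qed

lemma monomial_galois: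
  assumes \<sigma>: "\<sigma> \<in> galois_group K" and \<pi>: "\<pi> permutes {1..n}" "\<And>i. i \<in> {1..n} \<Longrightarrow> \<sigma> (b i) = b (\<pi> i)"
  shows "\<sigma> (monomial c) = (\<Prod>i=1..n. b (\<pi> i) powi c i)" "\<sigma> (monomial (c \<circ> \<pi>)) = monomial c"
proof -
  have e: "\<sigma> (monomial c) = (\<Prod>i=1..n. b (\<pi> i) powi c i)" for c
  proof -
    have "\<sigma> (monomial c) = (\<Prod>i=1..n. \<sigma> (b i powi c i))"
      unfolding monomial_def
      by (rule field_hom_prod[OF K_field galois_hom[OF \<sigma>]]) (rule subfield_powi[OF K_field b_in_K])
    also have "\<dots> = (\<Prod>i=1..n. b (\<pi> i) powi c i)"
      by (rule prod.cong[OF refl])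
         (simp only: field_hom_powi[OF K_field galois_hom[OF \<sigma>] b_in_K] \<pi>(2))
    finally show ?thesis .
  qed
  then show "\<sigma> (monomial c) = (\<Prod>i=1..n. b (\<pi> i) powi c i)" .
  show "\<sigma> (monomial (c \<circ> \<pi>)) = monomial c"
    unfolding e unfolding monomial_def using prod.permute[OF \<pi>(1), of "\<lambda>i. b i powi c i"] by (simp add: o_def)
qed

lemma relation_permute:
  assumes "monomial c = 1" and \<pi>: "\<pi> permutes {1..n}" "evenperm \<pi>"
  shows "monomial (\<lambda>i. c (\<pi> i)) = 1"
proof -
  obtain \<sigma> where \<sigma>: "\<sigma> \<in> galois_group K" "\<And>i. i \<in> {1..n} \<Longrightarrow> \<sigma> (b i) = b (\<pi> i)"
    using galois_of_perm[OF \<pi>] by blast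
  have "\<sigma> (monomial (c \<circ> \<pi>)) = \<sigma> 1"
    using monomial_galois(2)[OF \<sigma>(1) \<pi>(1) \<sigma>(2)] assms(1) field_hom_1[OF K_field galois_hom[OF \<sigma>(1)]] by simp
  then have "monomial (c \<circ> \<pi>) = 1"
    using field_hom_inj[OF K_field galois_hom[OF \<sigma>(1)]] monomial_in_K subfield_1[OF K_field]
    by (auto simp: inj_on_def)
  then show ?thesis by (simp add: o_def)
qed

lemma relation_difference:
  assumes "monomial c = 1" "\<pi> permutes {1..n}" "evenperm \<pi>"
  shows "monomial (\<lambda>i. c i - c (\<pi> i)) = 1"
  using relation_permute[OF assms] assms(1) by (simp add: monomial_diff[of c "\<lambda>i. c (\<pi> i)"])

text \<open>Two applications of \<open>relation_difference\<close> with 3-cycles turn a non-constant relation into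
  \<open>b\<^sub>i\<^sup>z = b\<^sub>m\<^sup>z\<close>.  Then \<open>b\<^sub>i / b\<^sub>m\<close> is a root of unity, on which Galois automorphisms commute; but two
  3-cycles sharing one point do not.\<close>

lemma relation_constant:
  assumes rel: "monomial c = 1" and ij: "i \<in> {1..n}" "j \<in> {1..n}"
  shows "c i = c j"
proof (rule ccontr)
  assume neq: "c i \<noteq> c j"
  then have "i \<noteq> j" by auto
  obtain xs where "length xs = 3" "distinct xs" "set xs \<subseteq> {1..n} - {i, j}"
    using obtain_distinct_outside[of "{i, j}" 3 n] n5 \<open>i \<noteq> j\<close> by auto
  then obtain k l m where klm: "k \<in> {1..n}" "l \<in> {1..n}" "m \<in> {1..n}" "distinct [i, j, k, l, m]"
    using \<open>i \<noteq> j\<close> by (auto simp: numeral_3_eq_3 length_Suc_conv)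
  \<comment> \<open>The cycle i -> j -> k gives d i = c i - c j, which is nonzero, and d vanishes
    off {i, j, k}. The cycle i -> l -> m meets that set only in i, so e is left with d i at i and -
    d i at m.\<close>
  define d where "d t = c t - c (three_cycle i j k t)" for t
  define e where "e t = d t - d (three_cycle i l m t)" for t
  have d1: "monomial d = 1"
    unfolding d_def using ij klm by (intro relation_difference rel three_cycle_permutes three_cycle_even) auto
  have e1: "monomial e = 1"
    unfolding e_def using ij klm by (intro relation_difference d1 three_cycle_permutes three_cycle_even) auto
  have d: "d i = c i - c j" "d l = 0" "d m = 0"
    using klm three_cycle_apply[of i j k] by (auto simp: d_def)
  have e: "e i = d i" "e m = - d i" "\<And>t. t \<notin> {i, m} \<Longrightarrow> e t = 0"
    using klm d three_cycle_apply[of i l m] by (auto simp: e_def) (metis insert_iff singletonD)+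
  define z where "z = d i"
  have z: "z \<noteq> 0" using neq d by (simp add: z_def)
  have "1 = (\<Prod>t\<in>{i, m}. b t powi e t)"
    unfolding e1[symmetric] monomial_def using ij klm e(3) by (intro prod.mono_neutral_right) auto
  then have "b i powi z * b m powi (- z) = 1" using klm e by (simp add: z_def)
  then have "(b i / b m) powi z = 1"
    using b_nonzero[OF klm(3)] by (simp add: power_int_divide_distrib power_int_minus field_simps)
  then have \<omega>: "(b i / b m) ^ nat \<bar>z\<bar> = 1" "nat \<bar>z\<bar> > 0"
    using z power_int_eq_1_imp_power by auto
  have \<omega>K: "b i / b m \<in> K" using ij klm b_in_K subfield_divide[OF K_field] by auto
  \<comment> \<open>\<open>\<sigma>\<close> belongs to j -> m -> i -> j and \<open>\<tau>\<close> to
    j -> k -> l -> j. The latter fixes b i / b m; the former maps it to b j / b i, which the latter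
    maps to b k / b i. Commuting forces b j = b k.\<close>
  obtain \<sigma> where \<sigma>: "\<sigma> \<in> galois_group K" "\<And>t. t \<in> {1..n} \<Longrightarrow> \<sigma> (b t) = b (three_cycle j m i t)"
    using galois_of_perm[of "three_cycle j m i"] ij klm three_cycle_permutes[of j "{1..n}" m i]
      three_cycle_even[of j m i] by auto
  obtain \<tau> where \<tau>: "\<tau> \<in> galois_group K" "\<And>t. t \<in> {1..n} \<Longrightarrow> \<tau> (b t) = b (three_cycle j k l t)"
    using galois_of_perm[of "three_cycle j k l"] ij klm three_cycle_permutes[of j "{1..n}" k l]
      three_cycle_even[of j k l] by auto
  have app: "\<rho> (x / y) = \<rho> x / \<rho> y" if "\<rho> \<in> galois_group K" "x \<in> K" "y \<in> K" for \<rho> x y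
    using field_hom_mult[OF K_field galois_hom[OF that(1)], of x "inverse y"] that
      field_hom_inverse[OF K_field galois_hom[OF that(1)]] subfield_inverse[OF K_field] by (simp add: divide_inverse)
  have ne: "j \<noteq> m" "m \<noteq> i" "j \<noteq> i" "j \<noteq> k" "k \<noteq> l" "j \<noteq> l" "i \<notin> {j, k, l}" "m \<notin> {j, k, l}"
    using klm(4) by auto
  have s: "\<sigma> (b i) = b j" "\<sigma> (b m) = b i" "\<tau> (b i) = b i" "\<tau> (b m) = b m" "\<tau> (b j) = b k"
    using \<sigma>(2)[of i] \<sigma>(2)[of m] \<tau>(2)[of i] \<tau>(2)[of m] \<tau>(2)[of j] ij klm(1-3)
      three_cycle_apply(2,3)[OF ne(1-3)] three_cycle_apply(1)[OF ne(4-6)] three_cycle_apply(4)[OF ne(4-6) ne(7)]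
      three_cycle_apply(4)[OF ne(4-6) ne(8)] by simp_all
  have "\<sigma> (\<tau> (b i / b m)) = \<tau> (\<sigma> (b i / b m))"
    by (rule galois_commute_on_root_of_unity[OF K_field \<sigma>(1) \<tau>(1) \<omega>K \<omega>])
  then have "b j / b i = b k / b i"
    using app[OF \<tau>(1) b_in_K[OF ij(1)] b_in_K[OF klm(3)]] app[OF \<sigma>(1) b_in_K[OF ij(1)] b_in_K[OF klm(3)]]
      app[OF \<tau>(1) b_in_K[OF ij(2)] b_in_K[OF ij(1)]] by (simp add: s)
  then have "b j = b k" using b_nonzero ij by simp
  then show False using b_eq_iff[of j k] ij klm by auto
qed

text \<open>Needed so that the values b_i^p count as distinct zeros. The relation b_i^p = b_j^q has
  exponent 0 at a third index, and a relation has constant exponents, so p at i must cancel against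
  q at j.\<close>

lemma power_root_inj:
  assumes ij: "i \<in> {1..n}" "j \<in> {1..n}" and pq: "p > 0" "q > 0" and eq: "b i ^ p = b j ^ q"
  shows "i = j \<and> p = q"
proof -
  have "card {i, j} + 1 \<le> n" using n5 by (simp add: card_insert_if)
  then obtain xs where "length xs = 1" "distinct xs" "set xs \<subseteq> {1..n} - {i, j}"
    using obtain_distinct_outside[of "{i, j}" 1 n] by blast
  then obtain k where k: "k \<in> {1..n}" "k \<noteq> i" "k \<noteq> j" by (auto simp: length_Suc_conv)
  define c where "c t = (if t = i then int p else 0)" for t
  define d where "d t = (if t = j then int q else 0)" for t
  have cd: "c i = int p" "d j = int q" by (simp_all add: c_def d_def)
  have "monomial c = (\<Prod>t\<in>{i}. b t powi c t)"
    unfolding monomial_def using ij by (intro prod.mono_neutral_right) (auto simp: c_def)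
  then have mc: "monomial c = b i ^ p" using cd by simp
  have "monomial d = (\<Prod>t\<in>{j}. b t powi d t)"
    unfolding monomial_def using ij by (intro prod.mono_neutral_right) (auto simp: d_def)
  then have md: "monomial d = b j ^ q" using cd by simp
  have "monomial (\<lambda>t. c t - d t) = 1"
    using monomial_nonzero[of d] by (simp only: monomial_diff mc md eq) simp
  then have "c i - d i = c k - d k" using relation_constant[of _ i k] ij k by blast
  then show ?thesis using k pq by (auto simp: c_def d_def split: if_splits)
qed

text \<open>The quotient of the two products is a relation whose exponents are the differences
  between a and a permuted copy of a. They are all equal, and they sum to 0, so they vanish.\<close>

lemma monomial_fixed:
  assumes \<pi>: "\<pi> permutes {1..n}" and eq: "(\<Prod>i=1..n. b (\<pi> i) powi a i) = monomial a"
    and i: "i \<in> {1..n}"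
  shows "a (\<pi> i) = a i"
proof -
  let ?\<rho> = "Hilbert_Choice.inv \<pi>"
  have \<rho>: "?\<rho> permutes {1..n}" using permutes_inv[OF \<pi>] .
  have "(\<Prod>i=1..n. b (\<pi> i) powi a i) = (\<Prod>i=1..n. b (\<pi> (?\<rho> i)) powi a (?\<rho> i))"
    using prod.permute[OF \<rho>, of "\<lambda>i. b (\<pi> i) powi a i"] by (simp add: o_def)
  also have "\<dots> = monomial (\<lambda>i. a (?\<rho> i))"
    unfolding monomial_def using permutes_inverses(1)[OF \<pi>] by simp
  finally have "monomial (\<lambda>i. a i - a (?\<rho> i)) = 1"
    using eq monomial_nonzero by (simp add: monomial_diff)
  then have const: "a x - a (?\<rho> x) = a y - a (?\<rho> y)" if "x \<in> {1..n}" "y \<in> {1..n}" for x y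
    using relation_constant[OF _ that] by blast
  define t where "t = a i - a (?\<rho> i)"
  have "(\<Sum>x=1..n. a x - a (?\<rho> x)) = int n * t"
    using const[OF _ i] by (simp add: t_def)
  moreover have "(\<Sum>x=1..n. a (?\<rho> x)) = (\<Sum>x=1..n. a x)"
    using sum.permute[OF \<rho>, of a] by (simp add: o_def)
  ultimately have "t = 0" using n5 by (simp add: sum_subtractf)
  then have "a (\<pi> i) = a (?\<rho> (\<pi> i))" using const[of "\<pi> i" i] i permutes_in_image[OF \<pi>] by (auto simp: t_def)
  then show ?thesis using permutes_inverses(2)[OF \<pi>] by simp
qed

end

section \<open>Generators\<close>

definition equal_pairs :: "nat \<Rightarrow> (nat \<Rightarrow> 'a) \<Rightarrow> (nat \<times> nat) set" where
  "equal_pairs n a = {(i, j). i \<in> {1..n} \<and> j \<in> {1..n} \<and> i < j \<and> a i = a j}"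

lemma finite_equal_pairs: "finite (equal_pairs n a)"
  by (rule finite_subset[of _ "{1..n} \<times> {1..n}"]) (auto simp: equal_pairs_def)

lemma two_equal_pairs:
  assumes "\<not> card (equal_pairs n a) \<le> 1"
  obtains i j k l where "(i, j) \<in> equal_pairs n a" "(k, l) \<in> equal_pairs n a" "(i, j) \<noteq> (k, l)"
proof -
  have "\<not> (\<forall>x\<in>equal_pairs n a. \<forall>y\<in>equal_pairs n a. x = y)"
    using assms card_le_Suc0_iff_eq[OF finite_equal_pairs, of n a] by simp
  then show ?thesis using that by (metis surj_pair)
qed

lemma unique_equal_pair:
  assumes "card (equal_pairs n a) \<le> 1" "p \<in> equal_pairs n a" "q \<in> equal_pairs n a"
  shows "p = q"
  using assms card_le_Suc0_iff_eq[OF finite_equal_pairs, of n a] by auto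

text \<open>Deleting the larger index of the only equal pair leaves an injective family. Conversely,
  two equal pairs give two indices whose values are also taken elsewhere, so at most n - 2 values
  remain.\<close>

lemma card_equal_pairs_le_1_iff:
  "card (equal_pairs n a) \<le> 1 \<longleftrightarrow> card (a ` {1..n}) \<ge> n - 1"
proof
  assume le: "card (equal_pairs n a) \<le> 1"
  obtain j where inj: "inj_on a ({1..n} - {j})"
  proof (cases "equal_pairs n a = {}")
    case True
    have "inj_on a {1..n}"
    proof (rule linorder_inj_onI')
      fix i k assume "i \<in> {1..n}" "k \<in> {1..n}" "i < k"
      then show "a i \<noteq> a k" using True by (auto simp: equal_pairs_def)
    qed
    then show ?thesis using that[of 0] by (simp add: inj_on_diff)
  next
    case False
    then obtain i j where ij: "(i, j) \<in> equal_pairs n a" by auto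
    have "inj_on a ({1..n} - {j})"
    proof (rule linorder_inj_onI')
      fix k l assume kl: "k \<in> {1..n} - {j}" "l \<in> {1..n} - {j}" "k < l"
      show "a k \<noteq> a l"
      proof
        assume "a k = a l"
        then have "(k, l) \<in> equal_pairs n a" using kl by (simp add: equal_pairs_def)
        then have "(k, l) = (i, j)" using unique_equal_pair[OF le _ ij] by blast
        then show False using kl by simp
      qed
    qed
    then show ?thesis using that by blast
  qed
  have "n - 1 \<le> card ({1..n} - {j})" using diff_card_le_card_Diff[of "{j}" "{1..n}"] by simp
  also have "\<dots> = card (a ` ({1..n} - {j}))" using inj by (simp add: card_image)
  also have "\<dots> \<le> card (a ` {1..n})" by (intro card_mono) auto
  finally show "card (a ` {1..n}) \<ge> n - 1" .
next
  assume ge: "card (a ` {1..n}) \<ge> n - 1"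
  show "card (equal_pairs n a) \<le> 1"
  proof (rule ccontr)
    assume "\<not> card (equal_pairs n a) \<le> 1"
    then obtain i j k l where ij: "i \<in> {1..n}" "j \<in> {1..n}" "i < j" "a i = a j"
      and kl: "k \<in> {1..n}" "l \<in> {1..n}" "k < l" "a k = a l" and ne: "(i, j) \<noteq> (k, l)"
      by (rule two_equal_pairs) (auto simp: equal_pairs_def)
    obtain u v where uv: "u \<in> {1..n}" "v \<in> {1..n}" "u \<noteq> v"
      and sub: "a u \<in> a ` ({1..n} - {u, v})" "a v \<in> a ` ({1..n} - {u, v})"
    proof (cases "j = l")
      case True
      then have "i \<noteq> k" using ne by auto
      have "j \<in> {1..n} - {i, k}" using ij kl True by auto
      from imageI[OF this, of a] have "a i \<in> a ` ({1..n} - {i, k})" "a k \<in> a ` ({1..n} - {i, k})"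
        using ij(4) kl(4) True by simp_all
      then show ?thesis using that[of i k] ij(1) kl(1) \<open>i \<noteq> k\<close> by blast
    next
      case False
      \<comment> \<open>\<open>s\<close> and \<open>t\<close> are partners of j and l lying outside
        {j, l}; the case splits handle the chains k < l = i < j and i < j = k < l.\<close>
      define s where "s = (if i = l then k else i)"
      define t where "t = (if k = j then i else k)"
      have "s \<in> {1..n} - {j, l}" "a s = a j" using ij kl False by (auto simp: s_def)
      then have "a j \<in> a ` ({1..n} - {j, l})" by (metis imageI)
      moreover have "t \<in> {1..n} - {j, l}" "a t = a l" using ij kl False by (auto simp: t_def)
      then have "a l \<in> a ` ({1..n} - {j, l})" by (metis imageI)
      ultimately show ?thesis using that[of j l] ij(2) kl(2) False by blast
    qed
    have "{1..n} = {u, v} \<union> ({1..n} - {u, v})" using uv by auto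
    then have "a ` {1..n} = a ` {u, v} \<union> a ` ({1..n} - {u, v})" by (metis image_Un)
    then have "a ` {1..n} \<subseteq> a ` ({1..n} - {u, v})" using sub by auto
    then have "card (a ` {1..n}) \<le> card (a ` ({1..n} - {u, v}))" by (intro card_mono) auto
    also have "\<dots> \<le> card ({1..n} - {u, v})" by (intro card_image_le) auto
    also have "\<dots> = n - 2" using uv by (subst card_Diff_subset) auto
    finally have "n - 1 \<le> n - 2" using ge by linarith
    \<comment> \<open>Truncated subtraction allows n - 1 <= n - 2 when n <= 1, which the two
      distinct indices exclude.\<close>
    moreover have "card {u, v} \<le> card {1..n}" using uv by (intro card_mono) auto
    ultimately show False using uv by auto
  qed
qed

text \<open>Two equal pairs give two distinct transpositions fixing a, whose product is even and
  nontrivial. With a single equal pair, the only nontrivial permutation fixing a is its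
  transposition, which is odd.\<close>

lemma stabilizer_trivial_iff:
  "(\<forall>\<pi>. \<pi> permutes {1..n} \<and> evenperm \<pi> \<and> (\<forall>i\<in>{1..n}. a (\<pi> i) = a i) \<longrightarrow> \<pi> = id) \<longleftrightarrow>
     card (equal_pairs n a) \<le> 1"
proof
  assume triv: "\<forall>\<pi>. \<pi> permutes {1..n} \<and> evenperm \<pi> \<and> (\<forall>i\<in>{1..n}. a (\<pi> i) = a i) \<longrightarrow> \<pi> = id"
  show "card (equal_pairs n a) \<le> 1"
  proof (rule ccontr)
    assume "\<not> card (equal_pairs n a) \<le> 1"
    then obtain i j k l where ij: "i \<in> {1..n}" "j \<in> {1..n}" "i < j" "a i = a j"
      and kl: "k \<in> {1..n}" "l \<in> {1..n}" "k < l" "a k = a l" and ne: "(i, j) \<noteq> (k, l)"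
      by (rule two_equal_pairs) (auto simp: equal_pairs_def)
    let ?\<pi> = "Transposition.transpose i j \<circ> Transposition.transpose k l"
    have "?\<pi> permutes {1..n}" using ij kl by (intro permutes_compose permutes_swap_id) auto
    moreover have "evenperm ?\<pi>"
      using ij kl by (simp add: evenperm_comp permutation_swap_id evenperm_swap)
    moreover have "a (Transposition.transpose i j x) = a x" "a (Transposition.transpose k l x) = a x" for x
      using ij kl by (auto simp: Transposition.transpose_def)
    ultimately have id: "?\<pi> = id" using triv by auto
    have "Transposition.transpose i j x = Transposition.transpose k l x" for x
      using fun_cong[OF id, of "Transposition.transpose k l x"] by simp
    from this[of i] this[of j] show False using ij kl ne by (auto simp: Transposition.transpose_def split: if_splits)
  qed
next
  assume le: "card (equal_pairs n a) \<le> 1"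
  show "\<forall>\<pi>. \<pi> permutes {1..n} \<and> evenperm \<pi> \<and> (\<forall>i\<in>{1..n}. a (\<pi> i) = a i) \<longrightarrow> \<pi> = id"
  proof (intro allI impI, rule ccontr)
    fix \<pi> assume \<pi>: "\<pi> permutes {1..n} \<and> evenperm \<pi> \<and> (\<forall>i\<in>{1..n}. a (\<pi> i) = a i)" and "\<pi> \<noteq> id"
    then obtain i where i: "\<pi> i \<noteq> i" by (auto simp: fun_eq_iff)
    have moved: "(min x (\<pi> x), max x (\<pi> x)) \<in> equal_pairs n a" if "\<pi> x \<noteq> x" for x
    proof -
      have "x \<in> {1..n}" using \<pi> that by (meson permutes_not_in)
      moreover from this have "\<pi> x \<in> {1..n}" "a (\<pi> x) = a x" using \<pi> permutes_in_image[of \<pi> "{1..n}" x] by auto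
      ultimately show ?thesis using that by (auto simp: equal_pairs_def min_def max_def)
    qed
    have set_eq: "{x, \<pi> x} = {i, \<pi> i}" if "\<pi> x \<noteq> x" for x
      using unique_equal_pair[OF le moved[OF that] moved[OF i]] by (auto simp: min_def max_def split: if_splits)
    have inj: "\<pi> x = \<pi> y \<longleftrightarrow> x = y" for x y
      using \<pi> permutes_inj[of \<pi> "{1..n}"] by (auto simp: inj_def)
    have "\<pi> x = Transposition.transpose i (\<pi> i) x" for x
    proof (cases "\<pi> x = x")
      case True
      then have "x \<noteq> i" "x \<noteq> \<pi> i" using i inj by auto
      then show ?thesis using True by (simp add: Transposition.transpose_def)
    next
      case False
      then show ?thesis using set_eq[OF False] by (auto simp: Transposition.transpose_def doubleton_eq_iff)
    qed
    then have "\<pi> = Transposition.transpose i (\<pi> i)" by (rule ext)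
    then have "evenperm (Transposition.transpose i (\<pi> i))" using \<pi> by simp
    then show False using i by (simp add: evenperm_swap)
  qed
qed

context alternating
begin

lemma generator_iff_stabilizer:
  "rat_adjoin {monomial a} = K \<longleftrightarrow>
     (\<forall>\<pi>. \<pi> permutes {1..n} \<and> evenperm \<pi> \<and> (\<forall>i\<in>{1..n}. a (\<pi> i) = a i) \<longrightarrow> \<pi> = id)"
proof
  assume gen: "rat_adjoin {monomial a} = K"
  show "\<forall>\<pi>. \<pi> permutes {1..n} \<and> evenperm \<pi> \<and> (\<forall>i\<in>{1..n}. a (\<pi> i) = a i) \<longrightarrow> \<pi> = id"
  proof (intro allI impI, elim conjE)
    fix \<pi> assume \<pi>: "\<pi> permutes {1..n}" "evenperm \<pi>" "\<forall>i\<in>{1..n}. a (\<pi> i) = a i"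
    obtain \<sigma> where \<sigma>: "\<sigma> \<in> galois_group K" "\<And>i. i \<in> {1..n} \<Longrightarrow> \<sigma> (b i) = b (\<pi> i)"
      using galois_of_perm[OF \<pi>(1,2)] by blast
    have h: "field_hom_on K \<sigma>" by (rule galois_hom[OF \<sigma>(1)])
    have "monomial (a \<circ> \<pi>) = monomial a"
      unfolding monomial_def by (rule prod.cong[OF refl]) (use \<pi>(3) in simp)
    then have fixed: "\<sigma> (monomial a) = monomial a"
      using monomial_galois(2)[OF \<sigma>(1) \<pi>(1) \<sigma>(2), of a] by simp
    have "field_hom_on K (\<lambda>x. x)" by (simp add: field_hom_on_def)
    from subfield_equalizer[OF K_field h this] have "complex_subfield {x\<in>K. \<sigma> x = x}" .
    from rat_adjoin_least[OF this, of "{monomial a}"] have "K \<subseteq> {x\<in>K. \<sigma> x = x}"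
      using fixed monomial_in_K gen by auto
    then have fix_b: "\<sigma> (b i) = b i" if "i \<in> {1..n}" for i using b_in_K[OF that] by auto
    have "\<pi> i = i" for i
    proof (cases "i \<in> {1..n}")
      case True
      then have "b (\<pi> i) = b i" "\<pi> i \<in> {1..n}"
        using fix_b[OF True] \<sigma>(2)[OF True] permutes_in_image[OF \<pi>(1)] by auto
      then show ?thesis using b_eq_iff True by blast
    qed (use permutes_not_in[OF \<pi>(1)] in blast)
    then show "\<pi> = id" by auto
  qed
next
  assume triv: "\<forall>\<pi>. \<pi> permutes {1..n} \<and> evenperm \<pi> \<and> (\<forall>i\<in>{1..n}. a (\<pi> i) = a i) \<longrightarrow> \<pi> = id"
  let ?F = "rat_adjoin {monomial a}"
  have FK: "?F \<subseteq> K" by (rule rat_adjoin_least[OF K_field]) (simp add: monomial_in_K)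
  have "b i \<in> ?F" if i: "i \<in> {1..n}" for i
  proof (rule galois_fixed[OF P_nonzero K_splitting complex_subfield_rat_adjoin FK b_in_K[OF i]])
    fix \<sigma> assume \<sigma>: "\<sigma> \<in> galois_group K" "\<And>x. x \<in> ?F \<Longrightarrow> \<sigma> x = x"
    obtain \<pi> where \<pi>: "\<pi> permutes {1..n}" "evenperm \<pi>" "\<And>i. i \<in> {1..n} \<Longrightarrow> \<sigma> (b i) = b (\<pi> i)"
      using perm_of_galois[OF \<sigma>(1)] by blast
    have "\<sigma> (monomial a) = monomial a" using \<sigma>(2) rat_adjoin_incl by blast
    then have eq: "(\<Prod>i=1..n. b (\<pi> i) powi a i) = monomial a"
      using monomial_galois(1)[OF \<sigma>(1) \<pi>(1,3), of a] by simp
    have "\<forall>i\<in>{1..n}. a (\<pi> i) = a i" using monomial_fixed[OF \<pi>(1) eq] by blast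
    then have "\<pi> = id" using triv \<pi> by blast
    then show "\<sigma> (b i) = b i" using \<pi>(3)[OF i] by simp
  qed
  then have "b ` {1..n} \<subseteq> ?F" by blast
  then have "K \<subseteq> ?F" unfolding K_def by (rule rat_adjoin_mono_subset)
  then show "?F = K" using FK by blast
qed

lemma generator_iff_equal_pairs: "rat_adjoin {monomial a} = K \<longleftrightarrow> card (equal_pairs n a) \<le> 1"
  unfolding generator_iff_stabilizer stabilizer_trivial_iff ..

end

section \<open>Norms and congruences\<close>

lemma freshman_dream:
  fixes u v :: "'a :: comm_ring_1"
  assumes "prime p"
  shows "\<exists>w. (u + v) ^ p = u ^ p + v ^ p + of_nat p * w"
proof -
  have p1: "p > 1" using assms prime_gt_1_nat by blast
  have "\<exists>w. of_nat (p choose k) * u ^ k * v ^ (p - k) = of_nat p * w" if k: "k \<in> {1..<p}" for k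
  proof -
    have "p dvd (p choose k)" using assms k by (intro dvd_choose_prime) auto
    then obtain c where "p choose k = p * c" by (auto elim: dvdE)
    then show ?thesis by (intro exI[of _ "of_nat c * u ^ k * v ^ (p - k)"]) (simp add: mult.assoc)
  qed
  then obtain w where w: "\<And>k. k \<in> {1..<p} \<Longrightarrow> of_nat (p choose k) * u ^ k * v ^ (p - k) = of_nat p * w k"
    by metis
  have set: "{..p} = insert 0 (insert p {1..<p})" using p1 by auto
  have "(u + v) ^ p = (\<Sum>k\<le>p. of_nat (p choose k) * u ^ k * v ^ (p - k))" by (rule binomial_ring)
  also have "\<dots> = v ^ p + (u ^ p + (\<Sum>k\<in>{1..<p}. of_nat (p choose k) * u ^ k * v ^ (p - k)))"
    unfolding set using p1 by simp
  also have "(\<Sum>k\<in>{1..<p}. of_nat (p choose k) * u ^ k * v ^ (p - k)) = (\<Sum>k\<in>{1..<p}. of_nat p * w k)"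
    by (rule sum.cong[OF refl w])
  finally show ?thesis
    by (intro exI[of _ "\<Sum>k\<in>{1..<p}. w k"]) (simp add: sum_distrib_left algebra_simps)
qed

lemma fermat_int:
  assumes p: "prime p"
  shows "\<exists>w. (a::int) ^ p = a + int p * w"
proof (induction a rule: int_induct[of _ 0])
  case base
  show ?case using prime_gt_0_nat[OF p] by (intro exI[of _ 0]) simp
next
  case (step1 i)
  obtain w where "i ^ p = i + int p * w" using step1 by blast
  moreover obtain v where "(i + 1) ^ p = i ^ p + 1 ^ p + int p * v" using freshman_dream[OF p, of i 1] by blast
  ultimately show ?case by (intro exI[of _ "w + v"]) (simp add: algebra_simps)
next
  case (step2 i)
  obtain w where "i ^ p = i + int p * w" using step2 by blast
  moreover obtain v where "(i - 1 + 1) ^ p = (i - 1) ^ p + 1 ^ p + int p * v"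
    using freshman_dream[OF p, of "i - 1" 1] by blast
  ultimately show ?case by (intro exI[of _ "w - v"]) (simp add: algebra_simps)
qed

text \<open>Frobenius modulo p, from Fermat's congruence on the coefficients and the freshman's
  dream on the terms. Applied to P it shows that p divides P(b_i^p), the source of all powers of p
  below.\<close>

lemma pcompose_monom_prime:
  fixes f :: "int poly"
  assumes p: "prime p"
  shows "\<exists>q. pcompose f (monom 1 p) = f ^ p + smult (int p) q"
proof (induction f)
  case 0
  show ?case using prime_gt_0_nat[OF p] by (intro exI[of _ 0]) (simp add: power_0_left)
next
  case (pCons a f)
  obtain q where q: "pcompose f (monom 1 p) = f ^ p + smult (int p) q" using pCons.IH by blast
  obtain w where w: "a ^ p = a + int p * w" using fermat_int[OF p] by blast
  obtain v where v: "([:a:] + monom 1 1 * f) ^ p = [:a:] ^ p + (monom 1 1 * f) ^ p + of_nat p * v"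
    using freshman_dream[OF p] by blast
  have e: "pCons a f = [:a:] + monom 1 1 * f" by (simp add: monom_Suc)
  have "pcompose (pCons a f) (monom 1 p) = [:a:] + monom 1 p * (f ^ p + smult (int p) q)"
    by (simp add: pcompose_pCons q)
  also have "[:a:] = [:a:] ^ p - smult (int p) [:w:]"
    by (simp add: poly_const_pow w)
  also have "monom 1 p * (f ^ p + smult (int p) q) = (monom 1 1 * f) ^ p + smult (int p) (monom 1 p * q)"
    by (simp add: power_mult_distrib monom_power algebra_simps)
  finally have "pcompose (pCons a f) (monom 1 p) = pCons a f ^ p + smult (int p) (monom 1 p * q - [:w:] - v)"
    unfolding e v by (simp add: algebra_simps smult_diff_right smult_add_right of_nat_poly)
  then show ?case by blast
qed

lemma order_ge_if_derivatives_vanish: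
  fixes a :: "'a :: {idom, semiring_char_0}"
  shows "(\<And>j. j < m \<Longrightarrow> poly ((pderiv ^^ j) f) a = 0) \<Longrightarrow> f \<noteq> 0 \<Longrightarrow> order a f \<ge> m"
proof (induction m arbitrary: f)
  case (Suc m)
  have root: "poly f a = 0" using Suc.prems(1)[of 0] by simp
  have d0: "pderiv f \<noteq> 0"
  proof
    assume "pderiv f = 0"
    then obtain c where "f = [:c:]" by (auto simp: pderiv_eq_0_iff elim: degree_eq_zeroE)
    then show False using root Suc.prems by simp
  qed
  have "order a (pderiv f) \<ge> m"
    using Suc.prems(1)[of "Suc _"] d0 by (intro Suc.IH) (simp_all add: funpow_swap1)
  moreover have "order a f = Suc (order a (pderiv f))"
    using root Suc.prems(2) by (intro order_pderiv)
  ultimately show ?case by simp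
qed simp

lemma norm_poly_le:
  fixes z :: complex
  assumes deg: "degree p < N" and c: "\<And>l. cmod (poly.coeff p l) \<le> A"
  shows "cmod (poly p z) \<le> real N * A * max 1 (cmod z) ^ N"
proof -
  have A: "A \<ge> 0" using c[of 0] norm_ge_zero order_trans by blast
  have "cmod (poly p z) \<le> (\<Sum>l\<le>degree p. cmod (poly.coeff p l * z ^ l))"
    unfolding poly_altdef by (rule norm_sum)
  also have "\<dots> \<le> (\<Sum>l\<le>degree p. A * max 1 (cmod z) ^ N)"
  proof (rule sum_mono)
    fix l assume "l \<in> {..degree p}"
    then have "cmod z ^ l \<le> max 1 (cmod z) ^ l" "max 1 (cmod z) ^ l \<le> max 1 (cmod z) ^ N"
      using deg by (auto intro!: power_mono power_increasing)
    then show "cmod (poly.coeff p l * z ^ l) \<le> A * max 1 (cmod z) ^ N"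
      using c[of l] A by (auto simp: norm_mult norm_power intro!: mult_mono)
  qed
  also have "\<dots> = real (Suc (degree p)) * (A * max 1 (cmod z) ^ N)" by simp
  also have "\<dots> \<le> real N * (A * max 1 (cmod z) ^ N)"
    using deg A by (intro mult_right_mono) auto
  finally show ?thesis by (simp add: mult.assoc)
qed

lemma coeff_higher_pderiv_bound:
  fixes f :: "int poly"
  assumes "degree f < N" "\<And>l. \<bar>poly.coeff f l\<bar> \<le> int H"
  shows "degree ((pderiv ^^ j) f) < N \<and> \<bar>poly.coeff ((pderiv ^^ j) f) l\<bar> \<le> int (H * N ^ j)"
proof (induction j arbitrary: l)
  case 0
  then show ?case using assms by simp
next
  case (Suc j)
  let ?g = "(pderiv ^^ j) f"
  have deg: "degree ?g < N" using Suc.IH by blast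
  have "\<bar>int (Suc l) * poly.coeff ?g (Suc l)\<bar> \<le> int N * int (H * N ^ j)"
  proof (cases "Suc l \<le> degree ?g")
    case True
    then have "int (Suc l) \<le> int N" using deg by linarith
    then show ?thesis using Suc.IH[of "Suc l"] by (auto simp: abs_mult intro!: mult_mono)
  next
    case False
    then show ?thesis by (simp add: coeff_eq_0)
  qed
  moreover have "degree (pderiv ?g) < N" using deg degree_pderiv_le[of ?g] by linarith
  ultimately show ?case by (simp add: coeff_pderiv mult_ac)
qed

lemma map_poly_of_int_pderiv_funpow:
  "map_poly of_int ((pderiv ^^ j) f) = (pderiv ^^ j) (map_poly of_int f :: complex poly)"
  by (induction j) (simp_all add: of_int_hom.map_poly_pderiv)

lemma cmod_poly_higher_pderiv_le:
  fixes f :: "int poly"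
  assumes "degree f < N" "\<And>l. \<bar>poly.coeff f l\<bar> \<le> int H"
  shows "cmod (poly (map_poly of_int ((pderiv ^^ j) f)) z) \<le> real H * real N ^ Suc j * max 1 (cmod z) ^ N"
proof -
  have "cmod (poly (map_poly of_int ((pderiv ^^ j) f)) z) \<le> real N * real (H * N ^ j) * max 1 (cmod z) ^ N"
  proof (rule norm_poly_le)
    show "degree (map_poly of_int ((pderiv ^^ j) f) :: complex poly) < N"
      using coeff_higher_pderiv_bound[OF assms, where j = j] by simp
    fix l
    have "\<bar>poly.coeff ((pderiv ^^ j) f) l\<bar> \<le> int (H * N ^ j)"
      using coeff_higher_pderiv_bound[OF assms] by blast
    then have "\<bar>real_of_int (poly.coeff ((pderiv ^^ j) f) l)\<bar> \<le> real (H * N ^ j)" by linarith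
    then show "cmod (poly.coeff (map_poly of_int ((pderiv ^^ j) f)) l) \<le> real (H * N ^ j)"
      by (simp add: coeff_map_poly)
  qed
  then show ?thesis by (simp add: mult_ac)
qed

section \<open>Norms of integer polynomials at the conjugates of a unit\<close>

locale alternating_unit = alternating +
  assumes unit: "algebraic_unit \<beta>"
begin

abbreviation ipoly :: "int poly \<Rightarrow> complex \<Rightarrow> complex" where
  "ipoly f z \<equiv> poly (map_poly of_int f) z"

text \<open>The Mahler measure of \<beta>: no leading coefficient appears because P is monic for a
  unit.\<close>

definition mahler :: real where "mahler = (\<Prod>i=1..n. max 1 (cmod (b i)))"

lemma mahler_ge_1: "mahler \<ge> 1"
  unfolding mahler_def by (rule prod_ge_1) simp

lemma P_monic: "lead_coeff P = 1"
  unfolding P_def using unit by (intro algebraic_int_min_int_poly_monic) (simp add: algebraic_unit_def)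

lemma ipoly_P_root: "i \<in> {1..n} \<Longrightarrow> ipoly P (b i) = 0"
  using b_conj by (simp add: P_def alg_conjugates_def)

lemma vanish_conjugates:
  assumes "ipoly f (b i) = 0" "i \<in> {1..n}" "j \<in> {1..n}"
  shows "ipoly f (b j) = 0"
proof (rule int_poly_root_conjugate[OF _ assms(1)])
  show "algebraic (b i)" using algebraic_conjugate[OF alg b_conj[OF assms(2)]] .
  show "b j \<in> alg_conjugates (b i)"
    using alg_conjugates_conjugate[OF alg b_conj[OF assms(2)]] b_conj[OF assms(3)] by simp
qed

lemma P_dvd:
  assumes "ipoly f (b i) = 0" "i \<in> {1..n}"
  shows "P dvd f"
  using min_int_poly_dvd[OF algebraic_conjugate[OF alg b_conj[OF assms(2)]] assms(1)]
    min_int_poly_conjugate[OF alg b_conj[OF assms(2)]] by (simp add: P_def)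

lemma algebraic_int_b: "i \<in> {1..n} \<Longrightarrow> algebraic_int (b i)"
  using ipoly_P_root P_monic by (auto simp: algebraic_int_altdef_ipoly)

text \<open>A product fixed by the Galois group is rational, and a rational algebraic integer is an
  integer. A general f is allowed so that inverses are covered as well as polynomial values.\<close>

lemma galois_invariant_prod_Ints:
  assumes f: "\<And>i. i \<in> {1..n} \<Longrightarrow> f (b i) \<in> K" "\<And>i. i \<in> {1..n} \<Longrightarrow> algebraic_int (f (b i))"
    and inv: "\<And>\<sigma> i. \<sigma> \<in> galois_group K \<Longrightarrow> i \<in> {1..n} \<Longrightarrow> \<sigma> (f (b i)) = f (\<sigma> (b i))"
  shows "(\<Prod>i=1..n. f (b i)) \<in> \<int>"
proof -
  have "(\<Prod>i=1..n. f (b i)) \<in> \<rat>"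
  proof (rule galois_fixed_Rats[OF P_nonzero K_splitting])
    show "(\<Prod>i=1..n. f (b i)) \<in> K" using f(1) by (rule subfield_prod[OF K_field])
    fix \<sigma> assume \<sigma>: "\<sigma> \<in> galois_group K"
    obtain \<pi> where \<pi>: "\<pi> permutes {1..n}" "\<And>i. i \<in> {1..n} \<Longrightarrow> \<sigma> (b i) = b (\<pi> i)"
      using perm_of_galois[OF \<sigma>] by blast
    have "\<sigma> (\<Prod>i=1..n. f (b i)) = (\<Prod>i=1..n. \<sigma> (f (b i)))"
      using f(1) by (rule field_hom_prod[OF K_field galois_hom[OF \<sigma>]])
    also have "\<dots> = (\<Prod>i=1..n. f (b (\<pi> i)))"
      by (rule prod.cong[OF refl]) (simp only: inv[OF \<sigma>] \<pi>(2))
    also have "\<dots> = (\<Prod>i=1..n. f (b i))"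
      using prod.permute[OF \<pi>(1), of "\<lambda>i. f (b i)"] by (simp add: o_def)
    finally show "\<sigma> (\<Prod>i=1..n. f (b i)) = (\<Prod>i=1..n. f (b i))" .
  qed
  moreover have "algebraic_int (\<Prod>i=1..n. f (b i))" using f(2) by (rule algebraic_int_prod)
  ultimately show ?thesis using rational_algebraic_int_is_int by blast
qed

lemma norm_Ints: "(\<Prod>i=1..n. ipoly f (b i)) \<in> \<int>"
proof (rule galois_invariant_prod_Ints)
  fix i assume i: "i \<in> {1..n}"
  show "ipoly f (b i) \<in> K"
    unfolding poly_altdef using b_in_K[OF i]
    by (intro subfield_sum[OF K_field] subfield_mult[OF K_field] subfield_power[OF K_field])
       (auto simp: coeff_map_poly subfield_of_int[OF K_field])
  show "algebraic_int (ipoly f (b i))" using algebraic_int_poly[OF algebraic_int_b[OF i]] .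
  fix \<sigma> assume \<sigma>: "\<sigma> \<in> galois_group K"
  show "\<sigma> (ipoly f (b i)) = ipoly f (\<sigma> (b i))"
    using field_hom_poly[OF K_field galois_hom[OF \<sigma>] poly_over_map_of_int[OF K_field] b_in_K[OF i], of f]
    by (simp only: field_hom_map_poly_of_int[OF K_field galois_hom[OF \<sigma>]])
qed

text \<open>An integer of absolute value below 1 is 0, and an integer polynomial vanishing at one
  conjugate vanishes at all. Both the construction of F and its transfer to the points b_i^p end
  here.\<close>

lemma norm_lt_1_vanish:
  assumes "(\<Prod>i=1..n. cmod (ipoly f (b i))) < 1" "j \<in> {1..n}"
  shows "ipoly f (b j) = 0"
proof -
  obtain z :: int where z: "(\<Prod>i=1..n. ipoly f (b i)) = of_int z" using norm_Ints by (auto elim: Ints_cases)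
  have "cmod (of_int z) < 1" using assms(1) by (simp flip: z add: prod_norm)
  then have "z = 0" by simp
  then have "(\<Prod>i=1..n. ipoly f (b i)) = 0" using z by simp
  then obtain i where "i \<in> {1..n}" "ipoly f (b i) = 0" by auto
  then show ?thesis using vanish_conjugates assms(2) by blast
qed

text \<open>The roots of P are simple, so each factor P lowers the order at every b_i by exactly
  one.\<close>

lemma P_power_dvd:
  "f \<noteq> 0 \<Longrightarrow> (\<And>i. i \<in> {1..n} \<Longrightarrow> order (b i) (map_poly of_int f) \<ge> m) \<Longrightarrow> P ^ m dvd f"
proof (induction m arbitrary: f)
  case (Suc m)
  have one: "1 \<in> {1..n}" using n5 by simp
  have f0: "(map_poly of_int f :: complex poly) \<noteq> 0" using Suc.prems(1) by simp
  have "ipoly f (b 1) = 0" using Suc.prems(2)[OF one] f0 by (simp add: order_root)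
  then obtain g where g: "f = P * g" using P_dvd[OF _ one] by blast
  have g0: "g \<noteq> 0" using Suc.prems(1) g by auto
  have "order (b i) (map_poly of_int g) \<ge> m" if i: "i \<in> {1..n}" for i
  proof -
    have "order (b i) (map_poly of_int P) = 1"
      using min_int_poly_rsquarefree[OF alg] ipoly_P_root[OF i] P_nonzero
      by (intro rsquarefree_root_order) (simp_all add: P_def)
    moreover have "order (b i) (map_poly of_int f) =
        order (b i) (map_poly of_int P) + order (b i) (map_poly of_int g)"
      using f0 unfolding g of_int_poly_hom.hom_mult by (rule order_mult)
    ultimately show ?thesis using Suc.prems(2)[OF i] by simp
  qed
  then have "P ^ m dvd g" using Suc.IH[OF g0] by blast
  then show ?case unfolding g by (simp add: mult_dvd_mono)
qed simp

end

section \<open>The auxiliary polynomial\<close>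

definition poly_of_fun :: "nat \<Rightarrow> (nat \<Rightarrow> int) \<Rightarrow> int poly" where
  "poly_of_fun N f = (\<Sum>l<N. monom (f l) l)"

lemma coeff_poly_of_fun: "poly.coeff (poly_of_fun N f) l = (if l < N then f l else 0)"
  by (simp add: poly_of_fun_def coeff_sum)

lemma degree_poly_of_fun: "N > 0 \<Longrightarrow> degree (poly_of_fun N f) < N"
  using degree_le[of "N - 1" "poly_of_fun N f"] by (force simp: coeff_poly_of_fun)

lemma higher_pderiv_diff: "(pderiv ^^ j) (f - g) = (pderiv ^^ j) f - (pderiv ^^ j) g"
  for f g :: "'a :: idom poly"
  by (induction j) (simp_all add: pderiv_diff)

lemma ipoly_cnj: "poly (map_poly of_int f) (cnj z) = cnj (poly (map_poly of_int f) z)"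
proof -
  have "map_poly cnj (map_poly of_int f) = map_poly of_int f"
    by (rule poly_eqI) (simp add: coeff_map_poly)
  then show ?thesis using poly_map_poly_cnj[of "map_poly of_int f" "cnj z"] by simp
qed

lemma abs_diff_lt_if_floor_eq:
  fixes x y :: real
  assumes "\<eta> > 0" "\<lfloor>x / \<eta>\<rfloor> = \<lfloor>y / \<eta>\<rfloor>"
  shows "\<bar>x - y\<bar> < \<eta>"
proof -
  have "\<bar>x / \<eta> - y / \<eta>\<bar> < 1" using assms(2) by linarith
  then have "\<bar>x - y\<bar> / \<eta> < 1" using assms(1) by (simp flip: diff_divide_distrib)
  then show ?thesis using assms(1) by simp
qed

lemma ipoly_pcompose_monom:
  "poly (map_poly of_int (pcompose f (monom 1 p))) z = poly (map_poly of_int f) (z ^ p :: complex)"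
  by (simp add: of_int_hom.map_poly_pcompose poly_pcompose poly_monom)

context alternating_unit
begin

lemma conjugate_index:
  assumes "i \<in> {1..n}"
  obtains i' where "i' \<in> {1..n}" "b i' = cnj (b i)"
proof -
  have "ipoly P (cnj (b i)) = 0" using ipoly_P_root[OF assms] by (simp add: ipoly_cnj)
  then have "cnj (b i) \<in> b ` {1..n}" using roots by (auto simp: complex_roots_def)
  then show ?thesis using that by (metis imageE)
qed

text \<open>Only one real coordinate of \<open>f\<^sup>(\<^sup>j\<^sup>)(b\<^sub>i)\<close> is recorded for each \<open>i\<close>: the real part if \<open>b\<^sub>i\<close> lies in the
  closed upper half plane and the imaginary part otherwise.  Complex conjugation recovers the rest.\<close>

lemma auxiliary_polynomial:
  fixes N H m :: nat and E :: real
  assumes N: "N > 0" and H: "H > 0" and E: "E \<ge> 1" and ME: "mahler ^ N \<le> E ^ n"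
    and count: "(\<Prod>j<m. 8 * real H * real N ^ Suc j * E) ^ n < (real H + 1) ^ N"
  shows "\<exists>F. F \<noteq> 0 \<and> degree F < N \<and> (\<forall>l. \<bar>poly.coeff F l\<bar> \<le> int H) \<and> P ^ m dvd F"
proof -
  define B where "B i = max 1 (cmod (b i))" for i
  \<comment> \<open>The mesh is proportional to \<open>B i ^ N\<close>, the natural size of the
    values at b i, so the number of cells does not depend on i. The 3 makes the product of all
    \<open>2 * \<eta> i\<close> at most (2/3)^n, which is below 1.\<close>
  define \<eta> where "\<eta> i = B i ^ N / (3 * E)" for i
  define D where "D = {..<N} \<rightarrow>\<^sub>E {0..int H}"
  define v where "v f i j = ipoly ((pderiv ^^ j) (poly_of_fun N f)) (b i)" for f i j
  define u where "u f i j = (if Im (b i) \<ge> 0 then Re (v f i j) else Im (v f i j))" for f i j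
  define I where "I = {1..n} \<times> {..<m}"
  define cell where "cell f = (\<lambda>(i, j)\<in>I. \<lfloor>u f i j / \<eta> i\<rfloor>)" for f
  define V where "V j = 3 * real H * real N ^ Suc j * E" for j
  define R where "R = (\<Pi>\<^sub>E (i, j)\<in>I. {\<lfloor>- V j\<rfloor>..\<lfloor>V j\<rfloor>})"
  have B: "B i \<ge> 1" for i by (simp add: B_def)
  have \<eta>: "\<eta> i > 0" for i
  proof -
    have "B i ^ N > 0" using B[of i] by simp
    then show ?thesis using E by (simp add: \<eta>_def)
  qed
  have "card D = (H + 1) ^ N" unfolding D_def by (subst card_PiE) (auto simp: nat_add_distrib)
  then have cardD: "real (card D) = (real H + 1) ^ N" by (simp add: add.commute)
  have finD: "finite D" unfolding D_def by (rule finite_PiE) auto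
  have finI: "finite I" by (simp add: I_def)
  have finR: "finite R" unfolding R_def by (rule finite_PiE[OF finI]) auto
  have one: "1 \<le> real H * real N ^ Suc j * E" for j
  proof -
    have "1 \<le> H * N ^ Suc j" using H N by (simp add: Suc_leI)
    then have "1 \<le> real (H * N ^ Suc j)" by linarith
    then have "1 * 1 \<le> real (H * N ^ Suc j) * E" using E by (intro mult_mono) auto
    then show ?thesis by (simp only: of_nat_mult of_nat_power mult_1)
  qed
  have cardV: "real (card {\<lfloor>- V j\<rfloor>..\<lfloor>V j\<rfloor>}) \<le> 8 * real H * real N ^ Suc j * E" for j
  proof -
    have V: "V j = 3 * (real H * real N ^ Suc j * E)" by (simp add: V_def)
    then have "V j \<ge> 0" using one[of j] by linarith
    then have "\<lfloor>- V j\<rfloor> \<le> \<lfloor>V j\<rfloor>" by (intro floor_mono) simp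
    then have "real (card {\<lfloor>- V j\<rfloor>..\<lfloor>V j\<rfloor>}) = real_of_int (\<lfloor>V j\<rfloor> + 1 - \<lfloor>- V j\<rfloor>)" by simp
    also have "\<dots> \<le> 2 * V j + 2" by linarith
    \<comment> \<open>With V j = 3 X and X >= 1 the count is at most 6 X + 2 <= 8 X; this is the 8
      in the hypothesis \<open>count\<close>.\<close>
    also have "\<dots> \<le> 8 * (real H * real N ^ Suc j * E)" unfolding V using one[of j] by linarith
    also have "\<dots> = 8 * real H * real N ^ Suc j * E" by (simp add: mult.assoc)
    finally show ?thesis .
  qed
  have "real (card R) = (\<Prod>(i, j)\<in>I. real (card {\<lfloor>- V j\<rfloor>..\<lfloor>V j\<rfloor>}))"
    unfolding R_def by (subst card_PiE[OF finI]) (simp add: case_prod_unfold of_nat_prod)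
  also have "\<dots> = (\<Prod>i=1..n. \<Prod>j<m. real (card {\<lfloor>- V j\<rfloor>..\<lfloor>V j\<rfloor>}))"
    unfolding I_def by (rule prod.cartesian_product[symmetric])
  also have "\<dots> = (\<Prod>j<m. real (card {\<lfloor>- V j\<rfloor>..\<lfloor>V j\<rfloor>})) ^ n" by simp
  also have "\<dots> \<le> (\<Prod>j<m. 8 * real H * real N ^ Suc j * E) ^ n"
    using cardV by (intro power_mono prod_mono prod_nonneg) auto
  finally have "real (card R) < real (card D)" using count cardD by linarith
  then have less: "card R < card D" by linarith
  have Dmem: "f l \<in> {0..int H}" if "f \<in> D" "l < N" for f l
    using PiE_mem[of f "{..<N}" "\<lambda>_. {0..int H}" l] that by (simp add: D_def)
  have fbound: "\<bar>poly.coeff (poly_of_fun N f) l\<bar> \<le> int H" if f: "f \<in> D" for f l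
  proof (cases "l < N")
    case True
    from Dmem[OF f this] show ?thesis using True by (simp add: coeff_poly_of_fun)
  qed (simp add: coeff_poly_of_fun)
  have vbound: "cmod (v f i j) \<le> real H * real N ^ Suc j * B i ^ N" if "f \<in> D" for f i j
    unfolding v_def B_def using degree_poly_of_fun[OF N] fbound[OF that] by (rule cmod_poly_higher_pderiv_le)
  have "cell f \<in> R" if f: "f \<in> D" for f
    unfolding cell_def R_def
  proof (rule restrict_PiE_iff[THEN iffD2], rule ballI)
    fix x assume "x \<in> I"
    obtain i j where x: "x = (i, j)" by (cases x)
    have "\<bar>u f i j\<bar> \<le> cmod (v f i j)" using abs_Re_le_cmod abs_Im_le_cmod by (simp add: u_def)
    also have "\<dots> \<le> V j * \<eta> i" using vbound[OF f, of i j] E by (simp add: V_def \<eta>_def mult.assoc)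
    finally have "\<bar>u f i j / \<eta> i\<bar> \<le> V j" using \<eta>[of i] by (simp add: divide_le_eq)
    then have "- V j \<le> u f i j / \<eta> i" "u f i j / \<eta> i \<le> V j" by linarith+
    then show "(case x of (i, j) \<Rightarrow> \<lfloor>u f i j / \<eta> i\<rfloor>) \<in> (case x of (i, j) \<Rightarrow> {\<lfloor>- V j\<rfloor>..\<lfloor>V j\<rfloor>})"
      unfolding x by (simp add: floor_mono)
  qed
  then have "cell ` D \<subseteq> R" by blast
  then have "card (cell ` D) < card D" using less card_mono[OF finR, of "cell ` D"] by linarith
  then have "\<not> inj_on cell D" by (rule pigeonhole)
  then obtain f g where fg: "f \<in> D" "g \<in> D" "f \<noteq> g" "cell f = cell g" unfolding inj_on_def by blast
  define F where "F = poly_of_fun N f - poly_of_fun N g"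
  have cF: "poly.coeff F l = (if l < N then f l - g l else 0)" for l
    by (simp add: F_def coeff_poly_of_fun)
  have F0: "F \<noteq> 0"
  proof
    assume "F = 0"
    then have "f l = g l" if "l < N" for l using cF[of l] that by simp
    then have "f = g" by (intro PiE_ext[OF fg(1,2)[unfolded D_def]]) simp
    then show False using fg by simp
  qed
  have degF: "degree F < N"
    unfolding F_def using degree_diff_less[OF degree_poly_of_fun[OF N] degree_poly_of_fun[OF N]] .
  have boundF: "\<bar>poly.coeff F l\<bar> \<le> int H" for l
  proof (cases "l < N")
    case True
    from Dmem[OF fg(1) this] Dmem[OF fg(2) this] show ?thesis using True by (auto simp: cF abs_le_iff)
  qed (simp add: cF)
  have vanish: "ipoly ((pderiv ^^ j) F) (b i) = 0" if j: "j < m" and i: "i \<in> {1..n}" for i j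
  proof -
    define w where "w i = ipoly ((pderiv ^^ j) F) (b i)" for i
    have w: "w i = v f i j - v g i j" for i
      by (simp add: w_def v_def F_def higher_pderiv_diff of_int_poly_hom.hom_minus)
    have u: "\<bar>u f i j - u g i j\<bar> < \<eta> i" if "i \<in> {1..n}" for i
    proof (rule abs_diff_lt_if_floor_eq[OF \<eta>])
      have "(i, j) \<in> I" using that j by (simp add: I_def)
      then show "\<lfloor>u f i j / \<eta> i\<rfloor> = \<lfloor>u g i j / \<eta> i\<rfloor>"
        using fun_cong[OF fg(4), of "(i, j)"] by (simp add: cell_def)
    qed
    have upper: "\<bar>Re (w i)\<bar> < \<eta> i" if "i \<in> {1..n}" "Im (b i) \<ge> 0" for i
      using u[OF that(1)] that(2) by (simp add: w u_def)
    have lower: "\<bar>Im (w i)\<bar> < \<eta> i" if "i \<in> {1..n}" "Im (b i) < 0" for i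
      using u[OF that(1)] that(2) by (simp add: w u_def)
    have small: "cmod (w i) \<le> 2 * \<eta> i" if i: "i \<in> {1..n}" for i
    proof -
      obtain i' where i': "i' \<in> {1..n}" "b i' = cnj (b i)" using conjugate_index[OF i] .
      have wi': "w i' = cnj (w i)" by (simp add: w_def i' ipoly_cnj)
      have \<eta>i': "\<eta> i' = \<eta> i" by (simp add: \<eta>_def B_def i')
      have "\<bar>Re (w i)\<bar> < \<eta> i"
        using upper[OF i] upper[OF i'(1)] i'(2) wi' \<eta>i' by (cases "Im (b i) \<ge> 0") auto
      moreover have "\<bar>Im (w i)\<bar> < \<eta> i"
      proof (cases "Im (b i) = 0")
        case True
        then have "cnj (b i) = b i" by (simp add: complex_eq_iff)
        then have "w i = cnj (w i)" by (simp add: w_def flip: ipoly_cnj)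
        then have "Im (w i) = 0" by (simp add: complex_eq_iff)
        then show ?thesis using \<eta>[of i] by simp
      next
        case False
        then show ?thesis using lower[OF i] lower[OF i'(1)] i'(2) wi' \<eta>i'
          by (cases "Im (b i) < 0") auto
      qed
      ultimately show ?thesis using cmod_le[of "w i"] by linarith
    qed
    have "(\<Prod>i=1..n. cmod (w i)) \<le> (\<Prod>i=1..n. 2 * \<eta> i)" using small by (intro prod_mono) simp
    also have "\<dots> = (\<Prod>i=1..n. (2 / (3 * E)) * B i ^ N)" by (simp add: \<eta>_def)
    also have "\<dots> = (2 / (3 * E)) ^ n * mahler ^ N"
      by (simp only: prod.distrib prod_constant card_atLeastAtMost mahler_def B_def prod_power_distrib) simp
    also have "\<dots> \<le> (2 / (3 * E)) ^ n * E ^ n" using ME E by (intro mult_left_mono) auto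
    also have "\<dots> = (2 / 3) ^ n" using E by (simp flip: power_mult_distrib)
    also have "\<dots> < 1" using n5 by (simp add: power_less_one_iff)
    finally show ?thesis unfolding w_def using norm_lt_1_vanish[OF _ i] by blast
  qed
  have "P ^ m dvd F"
  proof (rule P_power_dvd[OF F0])
    fix i assume i: "i \<in> {1..n}"
    show "order (b i) (map_poly of_int F) \<ge> m"
      by (rule order_ge_if_derivatives_vanish) (use vanish[OF _ i] F0 in \<open>simp_all add: map_poly_of_int_pderiv_funpow\<close>)
  qed
  then show ?thesis using F0 degF boundF by blast
qed

text \<open>Since p divides P(b_i^p), the factorisation F = P^m G gives F(b_i^p) = p^m R(b_i) with
  an integer polynomial R. The size bound puts the norm of F at these points below p^(m n), so the
  norm of R is below 1.\<close>

lemma vanish_at_prime_powers: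
  assumes F: "degree F < N" "\<And>l. \<bar>poly.coeff F l\<bar> \<le> int H" "P ^ m dvd F" and p: "prime p"
    and small: "(real N * real H) ^ n * mahler ^ (p * N) < real p ^ (m * n)" and i: "i \<in> {1..n}"
  shows "ipoly F (b i ^ p) = 0"
proof -
  obtain G where G: "F = P ^ m * G" using F(3) by blast
  obtain Q where Q: "pcompose P (monom 1 p) = P ^ p + smult (int p) Q" using pcompose_monom_prime[OF p] by blast
  define R where "R = Q ^ m * pcompose G (monom 1 p)"
  have p0: "p > 0" using prime_gt_0_nat[OF p] .
  have F_R: "ipoly F (b i ^ p) = of_nat p ^ m * ipoly R (b i)" if i: "i \<in> {1..n}" for i
  proof -
    have "ipoly P (b i ^ p) = ipoly (P ^ p + smult (int p) Q) (b i)"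
      unfolding Q[symmetric] by (simp only: ipoly_pcompose_monom)
    also have "\<dots> = of_nat p * ipoly Q (b i)"
      using ipoly_P_root[OF i] p0
      by (simp add: of_int_poly_hom.hom_add of_int_poly_hom.hom_power of_int_hom.map_poly_hom_smult power_0_left)
    finally show ?thesis
      by (simp add: G R_def of_int_poly_hom.hom_mult of_int_poly_hom.hom_power ipoly_pcompose_monom power_mult_distrib)
  qed
  have "cmod (ipoly F (b i ^ p)) \<le> real N * real H * max 1 (cmod (b i)) ^ (p * N)" if "i \<in> {1..n}" for i
  proof -
    have "max 1 (cmod (b i) ^ p) \<le> max 1 (cmod (b i)) ^ p"
      by (intro max.boundedI) (auto intro: one_le_power power_mono)
    then have "max 1 (cmod (b i ^ p)) ^ N \<le> (max 1 (cmod (b i)) ^ p) ^ N"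
      by (intro power_mono) (auto simp: norm_power)
    then have "real H * real N ^ Suc 0 * max 1 (cmod (b i ^ p)) ^ N
        \<le> real H * real N ^ Suc 0 * (max 1 (cmod (b i)) ^ p) ^ N"
      by (rule mult_left_mono) simp
    moreover have "cmod (ipoly F (b i ^ p)) \<le> real H * real N ^ Suc 0 * max 1 (cmod (b i ^ p)) ^ N"
      using cmod_poly_higher_pderiv_le[OF F(1,2), of 0 "b i ^ p"] by simp
    ultimately show ?thesis by (simp add: mult_ac flip: power_mult)
  qed
  then have "(\<Prod>i=1..n. cmod (ipoly F (b i ^ p))) \<le> (\<Prod>i=1..n. real N * real H * max 1 (cmod (b i)) ^ (p * N))"
    by (intro prod_mono) simp
  also have "\<dots> = (real N * real H) ^ n * mahler ^ (p * N)"
    by (simp only: prod.distrib prod_constant card_atLeastAtMost mahler_def prod_power_distrib)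
       (simp add: power_mult_distrib)
  also have "\<dots> < real p ^ (m * n)" by (rule small)
  finally have "(\<Prod>i=1..n. real p ^ m * cmod (ipoly R (b i))) < real p ^ (m * n)"
    using F_R by (simp add: norm_mult norm_power)
  then have "real p ^ (m * n) * (\<Prod>i=1..n. cmod (ipoly R (b i))) < real p ^ (m * n) * 1"
    by (simp add: prod.distrib power_mult)
  then have "(\<Prod>i=1..n. cmod (ipoly R (b i))) < 1"
    using p0 by (subst (asm) mult_less_cancel_left_pos) auto
  then have "ipoly R (b i) = 0" using norm_lt_1_vanish[OF _ i] by blast
  then show ?thesis using F_R[OF i] by simp
qed

text \<open>The degree bound is exactly n * k, the number of distinct points b_i^p with p in S, so
  vanishing at all of them contradicts F being nonzero.\<close>

lemma dobrowolski_aux: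
  fixes H m k :: nat and E :: real
  assumes S: "finite S" "card S = k" "k > 0" "\<And>p. p \<in> S \<Longrightarrow> prime p"
    and H: "H > 0" and E: "E \<ge> 1" "mahler ^ (n * k) \<le> E ^ n"
    and count: "(\<Prod>j<m. 8 * real H * real (n * k) ^ Suc j * E) ^ n < (real H + 1) ^ (n * k)"
    and small: "\<And>p. p \<in> S \<Longrightarrow> (real (n * k) * real H) ^ n * mahler ^ (p * (n * k)) < real p ^ (m * n)"
  shows False
proof -
  have N: "n * k > 0" using n5 S(3) by simp
  obtain F where F: "F \<noteq> 0" "degree F < n * k" "\<And>l. \<bar>poly.coeff F l\<bar> \<le> int H" "P ^ m dvd F"
    using auxiliary_polynomial[OF N H E count] by blast
  have inj: "inj_on (\<lambda>(i, p). b i ^ p) ({1..n} \<times> S)"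
  proof (rule inj_onI, clarsimp)
    fix i p j q assume "Suc 0 \<le> i" "i \<le> n" "p \<in> S" "Suc 0 \<le> j" "j \<le> n" "q \<in> S" "b i ^ p = b j ^ q"
    then show "i = j \<and> p = q" using power_root_inj[of i j p q] S(4) prime_gt_0_nat by auto
  qed
  have "(\<lambda>(i, p). b i ^ p) ` ({1..n} \<times> S) \<subseteq> {z. ipoly F z = 0}"
    using vanish_at_prime_powers[OF F(2,3,4)] S(4) small by auto
  moreover have fin: "finite {z. ipoly F z = 0}" using F(1) by (intro poly_roots_finite) simp
  ultimately have "card ((\<lambda>(i, p). b i ^ p) ` ({1..n} \<times> S)) \<le> card {z. ipoly F z = 0}"
    by (intro card_mono)
  also have "\<dots> \<le> degree (map_poly of_int F :: complex poly)"
    using F(1) by (intro card_poly_roots_bound) simp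
  also have "\<dots> < n * k" using F(2) by simp
  finally show False using inj S by (simp add: card_image card_cartesian_product)
qed

end

section \<open>Dobrowolski's inequality in logarithmic form\<close>

lemma sum_arithmetic_progression:
  "(\<Sum>j<m. c + real (Suc j) * l) = real m * c + real m * (real m + 1) / 2 * (l :: real)"
proof -
  have "2 * (\<Sum>j<m. c + real (Suc j) * l) = 2 * real m * c + real m * (real m + 1) * l"
    by (induction m) (simp_all add: algebra_simps)
  then show ?thesis by simp
qed

context alternating_unit
begin

lemma ln_mahler_nonneg: "ln mahler \<ge> 0"
  using mahler_ge_1 by simp

text \<open>T is the logarithm of the coefficient bound: \<open>cond\<close> is the pigeonhole
  count, and the conclusion says that for some prime the size condition for vanishing at the b_i^p
  fails.\<close>

lemma dobrowolski_height:
  fixes m k :: nat and T :: real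
  assumes S: "finite S" "card S = k" "\<And>p. p \<in> S \<Longrightarrow> prime p" and mk: "m < k" and T: "T \<ge> 0"
    and cond: "(real k - real m) * T \<ge>
      real m * ln 8 + (real m * (real m + 1) / 2) * ln (real (n * k)) + real m * real k * ln mahler"
  shows "\<exists>p\<in>S. real m * ln (real p) \<le> ln (real (n * k)) + T + real p * real k * ln mahler"
proof (rule ccontr)
  assume neg: "\<not> ?thesis"
  define L where "L = ln mahler"
  \<comment> \<open>Rounding down serves both sides: H <= exp T in the size estimates and exp T < H
    + 1 in the count. With E = exp (k L) the required bound of \<open>mahler ^ (n * k)\<close> by
    \<open>E ^ n\<close> is an equality.\<close>
  define H where "H = nat \<lfloor>exp T\<rfloor>"
  define E where "E = exp (real k * L)"
  have L: "L \<ge> 0" using ln_mahler_nonneg by (simp add: L_def)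
  have M: "mahler = exp L" using mahler_ge_1 by (simp add: L_def)
  have eT: "exp T \<ge> 1" using T by simp
  then have H1: "\<lfloor>exp T\<rfloor> \<ge> 1" by simp
  then have H: "H > 0" by (simp add: H_def)
  have Hr: "real H = of_int \<lfloor>exp T\<rfloor>" using H1 by (simp add: H_def)
  have HT: "real H \<le> exp T" "exp T < real H + 1" unfolding Hr by linarith+
  have k: "k > 0" using mk by simp
  have N: "real (n * k) > 0" using n5 k by simp
  define l where "l = ln (real (n * k))"
  have Nl: "real (n * k) = exp l" using N by (simp add: l_def)
  show False
  proof (rule dobrowolski_aux[OF S(1,2) k S(3) H])
    show "E \<ge> 1" using L by (simp add: E_def)
    show "mahler ^ (n * k) \<le> E ^ n"
      by (simp add: M E_def flip: exp_of_nat_mult)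
    have "(\<Prod>j<m. 8 * real H * real (n * k) ^ Suc j * E) \<le> (\<Prod>j<m. exp (ln 8 + T + real (Suc j) * l + real k * L))"
    proof (rule prod_mono, intro conjI)
      fix j
      have pw: "real (n * k) ^ Suc j = exp (real (Suc j) * l)" unfolding Nl by (simp only: exp_of_nat_mult)
      have "8 * real H * real (n * k) ^ Suc j * E \<le> 8 * exp T * real (n * k) ^ Suc j * E"
        using HT(1) by (intro mult_right_mono mult_left_mono) (auto simp: E_def)
      also have "\<dots> = exp (ln 8 + T + real (Suc j) * l + real k * L)"
        by (simp only: pw exp_add E_def) simp
      finally show "8 * real H * real (n * k) ^ Suc j * E \<le> exp (ln 8 + T + real (Suc j) * l + real k * L)" .
      show "0 \<le> 8 * real H * real (n * k) ^ Suc j * E" by (simp add: E_def)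
    qed
    also have "\<dots> = exp (\<Sum>j<m. ln 8 + T + real (Suc j) * l + real k * L)"
      by (simp add: exp_sum)
    also have "(\<Sum>j<m. ln 8 + T + real (Suc j) * l + real k * L) =
        real m * ln 8 + real m * T + (real m * (real m + 1) / 2) * l + real m * real k * L"
      using sum_arithmetic_progression[of "ln 8 + T + real k * L" l m] by (simp add: algebra_simps)
    also have "exp \<dots> \<le> exp (real k * T)" using cond by (simp add: L_def l_def algebra_simps)
    finally have "(\<Prod>j<m. 8 * real H * real (n * k) ^ Suc j * E) \<le> exp (real k * T)" .
    then have "(\<Prod>j<m. 8 * real H * real (n * k) ^ Suc j * E) ^ n \<le> exp (real k * T) ^ n"
      by (intro power_mono prod_nonneg) (auto simp: E_def)
    also have "\<dots> = exp T ^ (n * k)" by (simp flip: exp_of_nat_mult add: mult_ac)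
    also have "\<dots> < (real H + 1) ^ (n * k)" using HT(2) n5 k by (intro power_strict_mono) auto
    finally show "(\<Prod>j<m. 8 * real H * real (n * k) ^ Suc j * E) ^ n < (real H + 1) ^ (n * k)" .
    fix p assume p: "p \<in> S"
    have p0: "real p > 0" using S(3)[OF p] prime_gt_0_nat by simp
    have "l + T + real p * real k * L < real m * ln (real p)" using neg p by (auto simp: l_def L_def)
    then have lt: "real n * (l + T + real p * real k * L) < real n * (real m * ln (real p))" using n5 by simp
    have "real (n * k) * real H \<le> exp l * exp T" unfolding Nl using HT(1) by (intro mult_left_mono) auto
    then have "(real (n * k) * real H) ^ n * mahler ^ (p * (n * k)) \<le> (exp l * exp T) ^ n * exp L ^ (p * (n * k))"
      unfolding M by (intro mult_right_mono power_mono) auto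
    also have "\<dots> = exp (real n * (l + T + real p * real k * L))"
      by (simp add: exp_add[symmetric] exp_of_nat_mult[symmetric] algebra_simps)
    also have "\<dots> < exp (real n * (real m * ln (real p)))" using lt by simp
    also have "\<dots> = exp (ln (real p)) ^ (m * n)"
      by (simp only: exp_of_nat_mult[symmetric]) (simp add: mult_ac)
    also have "\<dots> = real p ^ (m * n)" using p0 by simp
    finally show "(real (n * k) * real H) ^ n * mahler ^ (p * (n * k)) < real p ^ (m * n)" .
  qed
qed

section \<open>Logarithms of the conjugates of a unit\<close>

lemma algebraic_int_inverse_b:
  assumes i: "i \<in> {1..n}"
  shows "algebraic_int (inverse (b i))"
proof -
  have \<beta>: "\<beta> \<noteq> 0" "algebraic_int (inverse \<beta>)" using unit by (auto simp: algebraic_unit_def)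
  then obtain q where q: "ipoly q (inverse \<beta>) = 0" "lead_coeff q = 1" by (auto simp: algebraic_int_altdef_ipoly)
  \<comment> \<open>Reversing coefficients turns the monic polynomial of 1 / \<beta> into one
    vanishing at \<beta>, hence at b i; reversing back reaches 1 / b i.\<close>
  have refl: "ipoly (reflect_poly q) z = z ^ degree q * ipoly q (inverse z)" if "z \<noteq> 0" for z
  proof -
    have "map_poly of_int (reflect_poly q) = (reflect_poly (map_poly of_int q) :: complex poly)"
      by (rule poly_eqI) (simp add: coeff_map_poly coeff_reflect_poly)
    then show ?thesis using poly_reflect_poly_nz[OF that, of "map_poly of_int q"] by simp
  qed
  have "ipoly (reflect_poly q) \<beta> = 0" using refl[OF \<beta>(1)] q by simp
  then have "ipoly (reflect_poly q) (b i) = 0" by (rule int_poly_root_conjugate[OF alg _ b_conj[OF i]])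
  then have "ipoly q (inverse (b i)) = 0" using refl[OF b_nonzero[OF i]] b_nonzero[OF i] by simp
  then show ?thesis using q(2) by (auto simp: algebraic_int_altdef_ipoly)
qed

text \<open>The product of the b_i and the product of their inverses are both integers, since the
  inverses are integral too.\<close>

lemma norm_prod_b: "(\<Prod>i=1..n. cmod (b i)) = 1"
proof -
  have "(\<Prod>i=1..n. ipoly [:0, 1:] (b i)) \<in> \<int>" by (rule norm_Ints)
  then have "(\<Prod>i=1..n. b i) \<in> \<int>" by (simp add: map_poly_pCons)
  then obtain c where c: "(\<Prod>i=1..n. b i) = of_int c" by (auto elim: Ints_cases)
  have "(\<Prod>i=1..n. inverse (b i)) \<in> \<int>"
  proof (rule galois_invariant_prod_Ints)
    fix \<sigma> i assume \<sigma>: "\<sigma> \<in> galois_group K" and i: "i \<in> {1..n}"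
    show "\<sigma> (inverse (b i)) = inverse (\<sigma> (b i))"
      by (rule field_hom_inverse[OF K_field galois_hom[OF \<sigma>] b_in_K[OF i]])
  qed (rule subfield_inverse[OF K_field b_in_K] algebraic_int_inverse_b, assumption)+
  then obtain d where d: "(\<Prod>i=1..n. inverse (b i)) = of_int d" by (auto elim: Ints_cases)
  have "(\<Prod>i=1..n. b i) * (\<Prod>i=1..n. inverse (b i)) = (\<Prod>i=1..n. 1)"
    unfolding prod.distrib[symmetric] by (rule prod.cong[OF refl]) (use b_nonzero in simp)
  then have "of_int (c * d) = (1 :: complex)" by (simp only: c d of_int_mult prod.neutral_const)
  then have "c * d = 1" by (metis of_int_eq_1_iff)
  then have "\<bar>c\<bar> = 1" by (auto simp: zmult_eq_1_iff)
  then have "cmod (of_int c) = 1" by simp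
  then show ?thesis by (simp flip: c add: prod_norm)
qed

lemma sum_ln_b: "(\<Sum>i=1..n. ln (cmod (b i))) = 0"
  using norm_prod_b b_nonzero by (subst ln_prod[symmetric]) auto

text \<open>From log max(1, r) = (log r + |log r|) / 2, where the first terms sum to 0.\<close>

lemma sum_abs_ln_b: "(\<Sum>i=1..n. \<bar>ln (cmod (b i))\<bar>) = 2 * ln mahler"
proof -
  have "ln mahler = (\<Sum>i=1..n. ln (max 1 (cmod (b i))))"
    unfolding mahler_def by (rule ln_prod) (auto simp: max_def)
  also have "\<dots> = (\<Sum>i=1..n. (ln (cmod (b i)) + \<bar>ln (cmod (b i))\<bar>) / 2)"
  proof (rule sum.cong[OF refl])
    fix i assume "i \<in> {1..n}"
    then have "cmod (b i) > 0" using b_nonzero by simp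
    then show "ln (max 1 (cmod (b i))) = (ln (cmod (b i)) + \<bar>ln (cmod (b i))\<bar>) / 2"
      by (cases "cmod (b i) \<ge> 1") (auto simp: max_def abs_if)
  qed
  also have "\<dots> = (\<Sum>i=1..n. \<bar>ln (cmod (b i))\<bar>) / 2"
    using sum_ln_b by (simp add: sum.distrib flip: sum_divide_distrib)
  finally show ?thesis by simp
qed

end

section \<open>Moments of signed sums\<close>

text \<open>A sign vector is encoded by the set B of its negative positions, so an expectation over
  random signs is a sum over \<open>Pow J\<close> divided by \<open>2 ^ card J\<close>.\<close>

definition rademacher :: "'a set \<Rightarrow> 'a \<Rightarrow> real" where
  "rademacher B j = (if j \<in> B then -1 else 1)"

lemma sum_Pow_insert:
  assumes "finite J" "x \<notin> J"
  shows "(\<Sum>B\<in>Pow (insert x J). f B) = (\<Sum>B\<in>Pow J. f B) + (\<Sum>B\<in>Pow J. f (insert x B) :: real)"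
proof -
  have "inj_on (insert x) (Pow J)" using assms(2) by (auto simp: inj_on_def)
  moreover have "Pow J \<inter> insert x ` Pow J = {}" using assms(2) by auto
  ultimately show ?thesis
    unfolding Pow_insert using assms(1) by (subst sum.union_disjoint) (auto simp: sum.reindex)
qed

text \<open>Fixing the sign at x moves \<open>z x\<close> into the offset R; the moments below carry
  an offset so that this induction goes through.\<close>

lemma rademacher_sum_insert:
  fixes z :: "'a \<Rightarrow> real" and g :: "real \<Rightarrow> real"
  assumes J: "finite J" "x \<notin> J"
  shows "(\<Sum>B\<in>Pow (insert x J). g (R + (\<Sum>j\<in>insert x J. rademacher B j * z j))) =
    (\<Sum>B\<in>Pow J. g ((R + z x) + (\<Sum>j\<in>J. rademacher B j * z j))) +
    (\<Sum>B\<in>Pow J. g ((R - z x) + (\<Sum>j\<in>J. rademacher B j * z j)))"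
proof -
  have "(\<Sum>j\<in>J. rademacher (insert x B) j * z j) = (\<Sum>j\<in>J. rademacher B j * z j)" for B
    using J by (intro sum.cong) (auto simp: rademacher_def)
  moreover have "rademacher B x = 1" if "B \<in> Pow J" for B using that J by (auto simp: rademacher_def)
  moreover have "rademacher (insert x B) x = -1" for B by (simp add: rademacher_def)
  ultimately show ?thesis
    using J by (simp add: sum_Pow_insert algebra_simps)
qed

lemma rademacher_second_moment:
  fixes z :: "'a \<Rightarrow> real"
  assumes "finite J"
  shows "(\<Sum>B\<in>Pow J. (R + (\<Sum>j\<in>J. rademacher B j * z j))\<^sup>2) = 2 ^ card J * (R\<^sup>2 + (\<Sum>j\<in>J. (z j)\<^sup>2))"
  using assms
proof (induction J arbitrary: R rule: finite_induct)
  case (insert x J)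
  show ?case
    unfolding rademacher_sum_insert[OF insert.hyps, of "\<lambda>t. t\<^sup>2" R z] insert.IH
    using insert.hyps by (simp add: power2_eq_square algebra_simps)
qed simp

text \<open>The mean falls short of the bound by exactly twice the sum of the z_j^4; the induction
  discards this part as the term \<open>4 * y ^ 4\<close>.\<close>

lemma rademacher_fourth_moment:
  fixes z :: "'a \<Rightarrow> real"
  assumes "finite J"
  shows "(\<Sum>B\<in>Pow J. (R + (\<Sum>j\<in>J. rademacher B j * z j)) ^ 4) \<le>
    2 ^ card J * (R ^ 4 + 6 * R\<^sup>2 * (\<Sum>j\<in>J. (z j)\<^sup>2) + 3 * (\<Sum>j\<in>J. (z j)\<^sup>2)\<^sup>2)"
  using assms
proof (induction J arbitrary: R rule: finite_induct)
  case (insert x J)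
  define s where "s = (\<Sum>j\<in>J. (z j)\<^sup>2)"
  define y where "y = z x"
  have "(\<Sum>B\<in>Pow (insert x J). (R + (\<Sum>j\<in>insert x J. rademacher B j * z j)) ^ 4) \<le>
      2 ^ card J * ((R + y) ^ 4 + 6 * (R + y)\<^sup>2 * s + 3 * s\<^sup>2) +
      2 ^ card J * ((R - y) ^ 4 + 6 * (R - y)\<^sup>2 * s + 3 * s\<^sup>2)"
    unfolding rademacher_sum_insert[OF insert.hyps, of "\<lambda>t. t ^ 4" R z] s_def y_def by (intro add_mono insert.IH)
  also have "\<dots> = 2 ^ card J * (2 * (R ^ 4 + 6 * R\<^sup>2 * (s + y\<^sup>2) + 3 * (s + y\<^sup>2)\<^sup>2) - 4 * y ^ 4)"
    by (simp add: power2_eq_square power4_eq_xxxx algebra_simps)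
  also have "\<dots> \<le> 2 ^ card J * (2 * (R ^ 4 + 6 * R\<^sup>2 * (s + y\<^sup>2) + 3 * (s + y\<^sup>2)\<^sup>2))"
    by (intro mult_left_mono) auto
  also have "\<dots> = 2 ^ card (insert x J) * (R ^ 4 + 6 * R\<^sup>2 * (s + y\<^sup>2) + 3 * (s + y\<^sup>2)\<^sup>2)"
    using insert.hyps by simp
  finally show ?case using insert.hyps by (simp add: s_def y_def add.commute)
qed simp

text \<open>With x = |y| / t and c = sqrt 3 this is x (x - c)^2 (x + 2 c) >= 0. Among the quartics A
  y^2 - B y^4 tangent to |y| at |y| = c t, this c gives the best bound for second moment t^2 and
  fourth moment at most 3 t^4.\<close>

lemma abs_ge_quartic:
  fixes y t :: real
  assumes t: "t > 0"
  shows "\<bar>y\<bar> \<ge> sqrt 3 / (2 * t) * y\<^sup>2 - 1 / (6 * sqrt 3 * t ^ 3) * y ^ 4"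
proof -
  define c where "c = sqrt (3 :: real)"
  have c: "c > 0" "c * c = 3" by (simp_all add: c_def)
  define x where "x = \<bar>y\<bar> / t"
  have x: "x \<ge> 0" "\<bar>y\<bar> = x * t" using t by (simp_all add: x_def)
  have "0 \<le> x * ((x - c)\<^sup>2 * (x + 2 * c))" using x c by simp
  also have "\<dots> = x ^ 4 - 3 * (c * c) * x\<^sup>2 + 2 * (c * c) * c * x"
    by (simp add: power2_eq_square power4_eq_xxxx algebra_simps)
  also have "\<dots> = x ^ 4 - 9 * x\<^sup>2 + 6 * c * x" by (simp add: c)
  finally have "9 * x\<^sup>2 - x ^ 4 \<le> 6 * c * x" by simp
  then have "(9 * x\<^sup>2 - x ^ 4) / (6 * c) \<le> x" using c by (simp add: field_simps)
  moreover have "(9 * x\<^sup>2 - x ^ 4) / (6 * c) = c / 2 * x\<^sup>2 - 1 / (6 * c) * x ^ 4"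
    using c by (simp add: field_simps)
  ultimately have "c / 2 * x\<^sup>2 - 1 / (6 * c) * x ^ 4 \<le> x" by simp
  then have "(c / 2 * x\<^sup>2 - 1 / (6 * c) * x ^ 4) * t \<le> x * t" using t by simp
  moreover have "y\<^sup>2 = (x * t)\<^sup>2" "y ^ 4 = (x * t) ^ 4" using x(2) by (metis power2_abs, metis power_even_abs_numeral even_numeral)
  then have "c / (2 * t) * y\<^sup>2 - 1 / (6 * c * t ^ 3) * y ^ 4 = (c / 2 * x\<^sup>2 - 1 / (6 * c) * x ^ 4) * t"
    using t c by (simp add: field_simps power2_eq_square power4_eq_xxxx power3_eq_cube)
  ultimately show ?thesis using x(2) by (simp add: c_def)
qed

text \<open>Khinchine's inequality with constant \<open>1/\<surd>3\<close>, by comparing \<open>\<bar>y\<bar>\<close> with a quartic tangent to it.\<close>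

lemma khinchine:
  fixes z :: "'a \<Rightarrow> real"
  assumes J: "finite J"
  shows "(\<Sum>B\<in>Pow J. \<bar>R + (\<Sum>j\<in>J. rademacher B j * z j)\<bar>) \<ge> 2 ^ card J * sqrt ((\<Sum>j\<in>J. (z j)\<^sup>2) / 3)"
proof -
  define s where "s = (\<Sum>j\<in>J. (z j)\<^sup>2)"
  define t where "t = sqrt (R\<^sup>2 + s)"
  define y where "y B = R + (\<Sum>j\<in>J. rademacher B j * z j)" for B
  have s: "s \<ge> 0" unfolding s_def by (rule sum_nonneg) simp
  show ?thesis
  proof (cases "s = 0")
    case True
    then show ?thesis by (simp add: s_def[symmetric] sum_nonneg)
  next
    case False
    then have pos: "R\<^sup>2 + s > 0" using s by (simp add: add_nonneg_pos)
    then have t: "t > 0" by (simp add: t_def)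
    have t2: "t\<^sup>2 = R\<^sup>2 + s" using pos by (simp add: t_def)
    have t4: "t ^ 4 = (R\<^sup>2 + s)\<^sup>2" unfolding t2[symmetric] by (simp add: power2_eq_square power4_eq_xxxx)
    have m4_le: "R ^ 4 + 6 * R\<^sup>2 * s + 3 * s\<^sup>2 \<le> 3 * t ^ 4"
    proof -
      have "3 * t ^ 4 = R ^ 4 + 6 * R\<^sup>2 * s + 3 * s\<^sup>2 + 2 * R ^ 4"
        unfolding t4 by (simp add: power2_eq_square power4_eq_xxxx algebra_simps)
      moreover have "R ^ 4 \<ge> 0" by simp
      ultimately show ?thesis by linarith
    qed
    have m2: "(\<Sum>B\<in>Pow J. (y B)\<^sup>2) = 2 ^ card J * t\<^sup>2"
      unfolding y_def t2 s_def by (rule rademacher_second_moment[OF J])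
    have "(\<Sum>B\<in>Pow J. y B ^ 4) \<le> 2 ^ card J * (R ^ 4 + 6 * R\<^sup>2 * s + 3 * s\<^sup>2)"
      unfolding y_def s_def by (rule rademacher_fourth_moment[OF J])
    also have "\<dots> \<le> 2 ^ card J * (3 * t ^ 4)"
      using m4_le by (intro mult_left_mono) auto
    finally have m4: "(\<Sum>B\<in>Pow J. y B ^ 4) \<le> 2 ^ card J * (3 * t ^ 4)" .
    have "2 ^ card J * (t / sqrt 3) = sqrt 3 / (2 * t) * (2 ^ card J * t\<^sup>2) - 1 / (6 * sqrt 3 * t ^ 3) * (2 ^ card J * (3 * t ^ 4))"
    proof -
      have r: "sqrt 3 * sqrt 3 = (3::real)" by simp
      have e1: "t / sqrt 3 = sqrt 3 / 3 * t" using r by (simp add: field_simps)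
      have e2: "1 / (6 * sqrt 3 * t ^ 3) * (3 * t ^ 4) = sqrt 3 / 6 * t"
        using t r by (simp add: field_simps power3_eq_cube power4_eq_xxxx)
      have e3: "sqrt 3 / (2 * t) * t\<^sup>2 = sqrt 3 / 2 * t" using t by (simp add: power2_eq_square)
      show ?thesis
        unfolding mult.left_commute[of "sqrt 3 / (2 * t)" "2 ^ card J"]
          mult.left_commute[of "1 / (6 * sqrt 3 * t ^ 3)" "2 ^ card J"] e1 e2 e3
        by (simp add: algebra_simps)
    qed
    also have "\<dots> \<le> sqrt 3 / (2 * t) * (\<Sum>B\<in>Pow J. (y B)\<^sup>2) - 1 / (6 * sqrt 3 * t ^ 3) * (\<Sum>B\<in>Pow J. y B ^ 4)"
      unfolding m2 using m4 t by (intro diff_mono mult_left_mono) auto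
    also have "\<dots> = (\<Sum>B\<in>Pow J. sqrt 3 / (2 * t) * (y B)\<^sup>2 - 1 / (6 * sqrt 3 * t ^ 3) * y B ^ 4)"
      by (simp only: sum_distrib_left sum_subtractf)
    also have "\<dots> \<le> (\<Sum>B\<in>Pow J. \<bar>y B\<bar>)" by (intro sum_mono abs_ge_quartic[OF t])
    finally have "2 ^ card J * (t / sqrt 3) \<le> (\<Sum>B\<in>Pow J. \<bar>y B\<bar>)" .
    moreover have "sqrt (s / 3) \<le> t / sqrt 3"
      unfolding t_def by (simp add: real_sqrt_divide divide_right_mono)
    then have "2 ^ card J * sqrt (s / 3) \<le> 2 ^ card J * (t / sqrt 3)" by (intro mult_left_mono) auto
    ultimately show ?thesis unfolding y_def s_def by linarith
  qed
qed

text \<open>Replaces the square root by a form linear in the |c j|, so that a sum over permutations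
  can be taken term by term. The Cauchy-Schwarz step loses nothing when all |c j| are equal.\<close>

lemma weighted_cauchy_schwarz:
  fixes z c w :: "'a \<Rightarrow> real"
  assumes J: "finite J" and z: "\<And>j. j \<in> J \<Longrightarrow> \<bar>z j\<bar> \<ge> w j * \<bar>c j\<bar>" and w: "\<And>j. j \<in> J \<Longrightarrow> w j \<ge> 0"
    and W: "(\<Sum>j\<in>J. (w j)\<^sup>2) > 0"
  shows "(\<Sum>j\<in>J. (w j)\<^sup>2 * \<bar>c j\<bar>) / sqrt (\<Sum>j\<in>J. (w j)\<^sup>2) \<le> sqrt (\<Sum>j\<in>J. (z j)\<^sup>2)"
proof -
  have "(\<Sum>j\<in>J. (w j)\<^sup>2 * \<bar>c j\<bar>) = (\<Sum>j\<in>J. \<bar>w j\<bar> * \<bar>w j * c j\<bar>)"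
    by (rule sum.cong) (simp_all add: abs_mult power2_eq_square flip: mult.assoc)
  also have "\<dots> \<le> L2_set w J * L2_set (\<lambda>j. w j * c j) J" by (rule L2_set_mult_ineq)
  also have "L2_set w J * L2_set (\<lambda>j. w j * c j) J \<le> L2_set w J * sqrt (\<Sum>j\<in>J. (z j)\<^sup>2)"
  proof (rule mult_left_mono)
    show "L2_set (\<lambda>j. w j * c j) J \<le> sqrt (\<Sum>j\<in>J. (z j)\<^sup>2)"
      unfolding L2_set_def
    proof (intro real_sqrt_le_mono sum_mono)
      fix j assume j: "j \<in> J"
      then have "(w j * \<bar>c j\<bar>)\<^sup>2 \<le> \<bar>z j\<bar>\<^sup>2" using z w by (intro power_mono) auto
      then show "(w j * c j)\<^sup>2 \<le> (z j)\<^sup>2" by (simp add: power_mult_distrib)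
    qed
  qed (rule L2_set_nonneg)
  finally have "(\<Sum>j\<in>J. (w j)\<^sup>2 * \<bar>c j\<bar>) \<le> sqrt (\<Sum>j\<in>J. (w j)\<^sup>2) * sqrt (\<Sum>j\<in>J. (z j)\<^sup>2)"
    by (simp add: L2_set_def)
  then show ?thesis using W by (simp add: divide_le_eq mult.commute)
qed

text \<open>As the x l sum to 0, card U times x (\<pi> i) is the sum over l of the differences x
  (\<pi> i) - x (\<pi> l). After summing over all permutations, the card U - 1 differences with l
  distinct from i contribute equally.\<close>

lemma sum_perm_abs_diff:
  fixes x :: "'a \<Rightarrow> real"
  assumes U: "finite U" and x: "(\<Sum>i\<in>U. x i) = 0" and ij: "i \<in> U" "i' \<in> U" "i \<noteq> i'"
  shows "(\<Sum>\<pi> | \<pi> permutes U. \<bar>x (\<pi> i) - x (\<pi> i')\<bar>) \<ge> fact (card U) * (\<Sum>i\<in>U. \<bar>x i\<bar>) / (real (card U) - 1)"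
proof -
  let ?S = "{\<pi>. \<pi> permutes U}"
  define Q where "Q l = (\<Sum>\<pi>\<in>?S. \<bar>x (\<pi> i) - x (\<pi> l)\<bar>)" for l
  define R where "R l = (\<Sum>\<pi>\<in>?S. \<bar>x (\<pi> l)\<bar>)" for l
  have n2: "card U \<ge> 2" using card_mono[OF U, of "{i, i'}"] ij by simp
  have Q: "Q l = Q i'" if l: "l \<in> U - {i}" for l
  proof -
    have "Q i' = (\<Sum>\<pi>\<in>?S. \<bar>x ((\<pi> \<circ> Transposition.transpose l i') i) - x ((\<pi> \<circ> Transposition.transpose l i') i')\<bar>)"
      unfolding Q_def by (rule sum_permutations_compose_right) (use l ij in \<open>auto intro: permutes_swap_id\<close>)
    also have "\<dots> = Q l" unfolding Q_def using l ij by (auto simp: Transposition.transpose_def)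
    finally show ?thesis by simp
  qed
  have R: "R l = R i" if l: "l \<in> U" for l
  proof -
    have "R i = (\<Sum>\<pi>\<in>?S. \<bar>x ((\<pi> \<circ> Transposition.transpose l i) i)\<bar>)"
      unfolding R_def by (rule sum_permutations_compose_right) (use l ij in \<open>auto intro: permutes_swap_id\<close>)
    then show ?thesis unfolding R_def by simp
  qed
  have invariant: "(\<Sum>l\<in>U. g (x (\<pi> l))) = (\<Sum>l\<in>U. g (x l))" if "\<pi> \<in> ?S" for \<pi> and g :: "real \<Rightarrow> real"
    using sum.permute[of \<pi> U "\<lambda>l. g (x l)"] that by (simp add: o_def)
  have "real (card U) * R i = (\<Sum>l\<in>U. R l)" using R by simp
  also have "\<dots> = (\<Sum>\<pi>\<in>?S. \<Sum>l\<in>U. \<bar>x (\<pi> l)\<bar>)" unfolding R_def by (rule sum.swap)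
  also have "\<dots> = (\<Sum>\<pi>\<in>?S. \<Sum>l\<in>U. \<bar>x l\<bar>)" by (rule sum.cong[OF refl invariant])
  also have "\<dots> = fact (card U) * (\<Sum>l\<in>U. \<bar>x l\<bar>)" by (simp add: card_permutations[OF refl U])
  finally have nR: "real (card U) * R i = fact (card U) * (\<Sum>l\<in>U. \<bar>x l\<bar>)" .
  have "real (card U) * R i = (\<Sum>\<pi>\<in>?S. \<bar>real (card U) * x (\<pi> i)\<bar>)"
    unfolding R_def by (simp add: sum_distrib_left abs_mult)
  also have "\<dots> \<le> (\<Sum>\<pi>\<in>?S. \<Sum>l\<in>U - {i}. \<bar>x (\<pi> i) - x (\<pi> l)\<bar>)"
  proof (rule sum_mono)
    fix \<pi> assume \<pi>: "\<pi> \<in> ?S"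
    have "(\<Sum>l\<in>U - {i}. x (\<pi> i) - x (\<pi> l)) = (\<Sum>l\<in>U. x (\<pi> i) - x (\<pi> l))"
      using U ij by (subst sum.remove[of U i]) auto
    also have "\<dots> = real (card U) * x (\<pi> i) - (\<Sum>l\<in>U. x (\<pi> l))" by (simp add: sum_subtractf)
    also have "(\<Sum>l\<in>U. x (\<pi> l)) = 0" using invariant[OF \<pi>, of "\<lambda>t. t"] x by simp
    finally have "real (card U) * x (\<pi> i) = (\<Sum>l\<in>U - {i}. x (\<pi> i) - x (\<pi> l))" by simp
    then show "\<bar>real (card U) * x (\<pi> i)\<bar> \<le> (\<Sum>l\<in>U - {i}. \<bar>x (\<pi> i) - x (\<pi> l)\<bar>)"
      using sum_abs[of "\<lambda>l. x (\<pi> i) - x (\<pi> l)" "U - {i}"] by simp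
  qed
  also have "\<dots> = (\<Sum>l\<in>U - {i}. Q l)" unfolding Q_def by (rule sum.swap)
  also have "\<dots> = (\<Sum>l\<in>U - {i}. Q i')" by (rule sum.cong[OF refl Q])
  also have "\<dots> = (real (card U) - 1) * Q i'" using U ij n2 by (simp add: of_nat_diff)
  finally have "fact (card U) * (\<Sum>l\<in>U. \<bar>x l\<bar>) \<le> (real (card U) - 1) * Q i'" using nR by simp
  then show ?thesis using n2 by (simp add: Q_def divide_le_eq mult.commute)
qed

section \<open>Linear forms averaged over permutations\<close>

text \<open>A family of disjoint pairs \<open>{p j, q j}\<close> of elements of \<open>U\<close>; \<open>pair_swap p q J B\<close> exchanges the
  two members of each pair with \<open>j \<in> B\<close>.\<close>

definition pair_swap :: "('j \<Rightarrow> 'a) \<Rightarrow> ('j \<Rightarrow> 'a) \<Rightarrow> 'j set \<Rightarrow> 'j set \<Rightarrow> 'a \<Rightarrow> 'a" where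
  "pair_swap p q J B x =
     (if x \<in> p ` B then q (inv_into J p x) else if x \<in> q ` B then p (inv_into J q x) else x)"

locale disjoint_pairs =
  fixes U :: "'a set" and J :: "'j set" and p q :: "'j \<Rightarrow> 'a"
  assumes U: "finite U" and J: "finite J"
    and p: "inj_on p J" "p ` J \<subseteq> U" and q: "inj_on q J" "q ` J \<subseteq> U"
    and disj: "p ` J \<inter> q ` J = {}"
begin

lemma pq_ne: "i \<in> J \<Longrightarrow> j \<in> J \<Longrightarrow> p i \<noteq> q j"
  using disj by blast

lemma pair_swap_p: "B \<subseteq> J \<Longrightarrow> j \<in> J \<Longrightarrow> pair_swap p q J B (p j) = (if j \<in> B then q j else p j)"
  using pq_ne[of j] inj_on_image_mem_iff[OF p(1), of j B]
  by (auto simp: pair_swap_def inv_into_f_f[OF p(1)])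

lemma pair_swap_q: "B \<subseteq> J \<Longrightarrow> j \<in> J \<Longrightarrow> pair_swap p q J B (q j) = (if j \<in> B then p j else q j)"
proof -
  assume B: "B \<subseteq> J" and j: "j \<in> J"
  have "q j \<notin> p ` B" using pq_ne[OF _ j] B by force
  then show ?thesis using inj_on_image_mem_iff[OF q(1) j B] j
    by (simp add: pair_swap_def inv_into_f_f[OF q(1)])
qed

lemma pair_swap_other: "B \<subseteq> J \<Longrightarrow> x \<notin> p ` J \<union> q ` J \<Longrightarrow> pair_swap p q J B x = x"
  by (auto simp: pair_swap_def)

lemma pair_swap_permutes:
  assumes B: "B \<subseteq> J"
  shows "pair_swap p q J B permutes U"
proof -
  let ?t = "pair_swap p q J B"
  have invol: "?t (?t x) = x" for x
  proof (cases "x \<in> p ` J \<union> q ` J")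
    case True
    then show ?thesis using pair_swap_p[OF B] pair_swap_q[OF B] by (auto split: if_splits)
  qed (simp add: pair_swap_other[OF B])
  have "\<exists>!y. ?t y = x" for x
    by (rule ex1I[of _ "?t x"]) (auto simp: invol)
  moreover have "?t x = x" if "x \<notin> U" for x
    using that p(2) q(2) by (intro pair_swap_other[OF B]) auto
  ultimately show ?thesis unfolding permutes_def by blast
qed

text \<open>From a x + c y = ((a + c)(x + y) + (a - c)(x - y)) / 2: exchanging x and y only changes
  the sign of the last product, so the pairs contribute a fixed offset plus a Rademacher
  sum.\<close>

lemma linear_form_pair_swap:
  fixes a x :: "'a \<Rightarrow> real"
  assumes B: "B \<subseteq> J"
  shows "(\<Sum>i\<in>U. a i * x (\<pi> (pair_swap p q J B i))) =
    ((\<Sum>i\<in>U - p ` J - q ` J. a i * x (\<pi> i)) + (\<Sum>j\<in>J. (a (p j) + a (q j)) / 2 * (x (\<pi> (p j)) + x (\<pi> (q j))))) +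
    (\<Sum>j\<in>J. rademacher B j * ((a (p j) - a (q j)) / 2 * (x (\<pi> (p j)) - x (\<pi> (q j)))))"
proof -
  let ?f = "\<lambda>i. a i * x (\<pi> (pair_swap p q J B i))"
  have "sum ?f U = sum ?f (U - p ` J - q ` J) + sum ?f (q ` J) + sum ?f (p ` J)"
  proof -
    have "sum ?f U = sum ?f (U - p ` J) + sum ?f (p ` J)" using sum.subset_diff[OF p(2) U] by blast
    moreover have "q ` J \<subseteq> U - p ` J" using q(2) disj by blast
    then have "sum ?f (U - p ` J) = sum ?f (U - p ` J - q ` J) + sum ?f (q ` J)"
      using U by (intro sum.subset_diff) auto
    ultimately show ?thesis by simp
  qed
  also have "sum ?f (U - p ` J - q ` J) = (\<Sum>i\<in>U - p ` J - q ` J. a i * x (\<pi> i))"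
    by (rule sum.cong) (auto simp: pair_swap_other[OF B])
  also have "sum ?f (q ` J) = (\<Sum>j\<in>J. a (q j) * x (\<pi> (if j \<in> B then p j else q j)))"
    using q(1) by (simp add: sum.reindex pair_swap_q[OF B])
  also have "sum ?f (p ` J) = (\<Sum>j\<in>J. a (p j) * x (\<pi> (if j \<in> B then q j else p j)))"
    using p(1) by (simp add: sum.reindex pair_swap_p[OF B])
  also have "(\<Sum>i\<in>U - p ` J - q ` J. a i * x (\<pi> i)) + (\<Sum>j\<in>J. a (q j) * x (\<pi> (if j \<in> B then p j else q j))) +
      (\<Sum>j\<in>J. a (p j) * x (\<pi> (if j \<in> B then q j else p j))) =
    (\<Sum>i\<in>U - p ` J - q ` J. a i * x (\<pi> i)) +
      (\<Sum>j\<in>J. a (q j) * x (\<pi> (if j \<in> B then p j else q j)) + a (p j) * x (\<pi> (if j \<in> B then q j else p j)))"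
    by (simp add: sum.distrib)
  also have "(\<Sum>j\<in>J. a (q j) * x (\<pi> (if j \<in> B then p j else q j)) + a (p j) * x (\<pi> (if j \<in> B then q j else p j))) =
    (\<Sum>j\<in>J. (a (p j) + a (q j)) / 2 * (x (\<pi> (p j)) + x (\<pi> (q j))) +
        rademacher B j * ((a (p j) - a (q j)) / 2 * (x (\<pi> (p j)) - x (\<pi> (q j)))))"
    by (rule sum.cong[OF refl]) (auto simp: rademacher_def field_simps)
  finally show ?thesis by (simp add: sum.distrib)
qed

text \<open>The sum over the full symmetric group is unchanged when every \<open>pair_swap\<close>
  is composed on the right, so for each permutation one may average over the exchanges, which act as
  independent signs.\<close>

lemma sum_perm_linear_form_ge:
  fixes a x :: "'a \<Rightarrow> real" and w :: "'j \<Rightarrow> real"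
  assumes w: "\<And>j. j \<in> J \<Longrightarrow> \<bar>a (p j) - a (q j)\<bar> \<ge> w j" "\<And>j. j \<in> J \<Longrightarrow> w j \<ge> 0"
    and W: "(\<Sum>j\<in>J. (w j)\<^sup>2) > 0" and x: "(\<Sum>i\<in>U. x i) = 0"
  shows "(\<Sum>\<pi> | \<pi> permutes U. \<bar>\<Sum>i\<in>U. a i * x (\<pi> i)\<bar>) \<ge>
    fact (card U) * sqrt ((\<Sum>j\<in>J. (w j)\<^sup>2) / 3) / 2 * (\<Sum>i\<in>U. \<bar>x i\<bar>) / (real (card U) - 1)"
proof -
  let ?S = "{\<pi>. \<pi> permutes U}"
  define V where "V = (\<Sum>j\<in>J. (w j)\<^sup>2)"
  define Y where "Y \<pi> = (\<Sum>i\<in>U. a i * x (\<pi> i))" for \<pi>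
  define c where "c \<pi> j = (x (\<pi> (p j)) - x (\<pi> (q j))) / 2" for \<pi> :: "'a \<Rightarrow> 'a" and j
  define z where "z \<pi> j = (a (p j) - a (q j)) / 2 * (x (\<pi> (p j)) - x (\<pi> (q j)))" for \<pi> :: "'a \<Rightarrow> 'a" and j
  define D where "D = fact (card U) * (\<Sum>i\<in>U. \<bar>x i\<bar>) / (real (card U) - 1)"
  have V: "V > 0" using W by (simp add: V_def)
  have inv: "(\<Sum>\<pi>\<in>?S. \<bar>Y \<pi>\<bar>) = (\<Sum>\<pi>\<in>?S. \<bar>Y (\<pi> \<circ> pair_swap p q J B)\<bar>)" if "B \<in> Pow J" for B
    using that by (intro sum_permutations_compose_right pair_swap_permutes) auto
  have perm: "(\<Sum>j\<in>J. (w j)\<^sup>2 * \<bar>c \<pi> j\<bar>) / sqrt V / sqrt 3 * 2 ^ card J \<le>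
      (\<Sum>B\<in>Pow J. \<bar>Y (\<pi> \<circ> pair_swap p q J B)\<bar>)" for \<pi>
  proof -
    define R where "R = (\<Sum>i\<in>U - p ` J - q ` J. a i * x (\<pi> i)) +
      (\<Sum>j\<in>J. (a (p j) + a (q j)) / 2 * (x (\<pi> (p j)) + x (\<pi> (q j))))"
    have "\<bar>z \<pi> j\<bar> \<ge> w j * \<bar>c \<pi> j\<bar>" if "j \<in> J" for j
      using w[OF that] by (simp add: z_def c_def abs_mult mult_right_mono)
    then have "(\<Sum>j\<in>J. (w j)\<^sup>2 * \<bar>c \<pi> j\<bar>) / sqrt V \<le> sqrt (\<Sum>j\<in>J. (z \<pi> j)\<^sup>2)"
      unfolding V_def using w(2) W by (intro weighted_cauchy_schwarz[OF J]) auto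
    then have "(\<Sum>j\<in>J. (w j)\<^sup>2 * \<bar>c \<pi> j\<bar>) / sqrt V / sqrt 3 * 2 ^ card J \<le>
        sqrt (\<Sum>j\<in>J. (z \<pi> j)\<^sup>2) / sqrt 3 * 2 ^ card J"
      by (intro mult_right_mono divide_right_mono) auto
    also have "\<dots> = 2 ^ card J * sqrt ((\<Sum>j\<in>J. (z \<pi> j)\<^sup>2) / 3)" by (simp add: real_sqrt_divide)
    also have "\<dots> \<le> (\<Sum>B\<in>Pow J. \<bar>R + (\<Sum>j\<in>J. rademacher B j * z \<pi> j)\<bar>)" by (rule khinchine[OF J])
    also have "\<dots> = (\<Sum>B\<in>Pow J. \<bar>Y (\<pi> \<circ> pair_swap p q J B)\<bar>)"
      unfolding Y_def R_def z_def o_def by (rule sum.cong[OF refl]) (simp only: linear_form_pair_swap Pow_iff)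
    finally show ?thesis .
  qed
  have D: "D / 2 \<le> (\<Sum>\<pi>\<in>?S. \<bar>c \<pi> j\<bar>)" if j: "j \<in> J" for j
  proof -
    have "D \<le> (\<Sum>\<pi>\<in>?S. \<bar>x (\<pi> (p j)) - x (\<pi> (q j))\<bar>)"
      unfolding D_def using p(2) q(2) j pq_ne[OF j j] by (intro sum_perm_abs_diff[OF U x]) auto
    then show ?thesis unfolding c_def by (simp flip: sum_divide_distrib)
  qed
  have "2 ^ card J * (V * (D / 2) / sqrt V / sqrt 3) =
      (\<Sum>j\<in>J. (w j)\<^sup>2 * (D / 2)) / sqrt V / sqrt 3 * 2 ^ card J"
    unfolding sum_distrib_right[symmetric] V_def[symmetric] by (simp add: mult_ac)
  also have "\<dots> \<le> (\<Sum>j\<in>J. (w j)\<^sup>2 * (\<Sum>\<pi>\<in>?S. \<bar>c \<pi> j\<bar>)) / sqrt V / sqrt 3 * 2 ^ card J"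
    using D V by (intro mult_right_mono divide_right_mono sum_mono mult_left_mono) auto
  also have "(\<Sum>j\<in>J. (w j)\<^sup>2 * (\<Sum>\<pi>\<in>?S. \<bar>c \<pi> j\<bar>)) = (\<Sum>\<pi>\<in>?S. \<Sum>j\<in>J. (w j)\<^sup>2 * \<bar>c \<pi> j\<bar>)"
    unfolding sum_distrib_left by (rule sum.swap)
  also have "\<dots> / sqrt V / sqrt 3 * 2 ^ card J = (\<Sum>\<pi>\<in>?S. (\<Sum>j\<in>J. (w j)\<^sup>2 * \<bar>c \<pi> j\<bar>) / sqrt V / sqrt 3 * 2 ^ card J)"
    by (simp only: sum_divide_distrib sum_distrib_right)
  also have "\<dots> \<le> (\<Sum>\<pi>\<in>?S. \<Sum>B\<in>Pow J. \<bar>Y (\<pi> \<circ> pair_swap p q J B)\<bar>)" by (intro sum_mono perm)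
  also have "\<dots> = (\<Sum>B\<in>Pow J. \<Sum>\<pi>\<in>?S. \<bar>Y (\<pi> \<circ> pair_swap p q J B)\<bar>)" by (rule sum.swap)
  also have "\<dots> = (\<Sum>B\<in>Pow J. \<Sum>\<pi>\<in>?S. \<bar>Y \<pi>\<bar>)" by (rule sum.cong[OF refl]) (simp only: inv)
  also have "\<dots> = 2 ^ card J * (\<Sum>\<pi>\<in>?S. \<bar>Y \<pi>\<bar>)" using J by (simp add: card_Pow)
  finally have "V * (D / 2) / sqrt V / sqrt 3 \<le> (\<Sum>\<pi>\<in>?S. \<bar>Y \<pi>\<bar>)"
    by (rule mult_left_le_imp_le) simp
  moreover have "V * (D / 2) / sqrt V = sqrt V * (D / 2)"
    using V by (simp add: divide_eq_eq flip: real_sqrt_mult)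
  ultimately have "sqrt V * (D / 2) / sqrt 3 \<le> (\<Sum>\<pi>\<in>?S. \<bar>Y \<pi>\<bar>)" by (simp only:)
  moreover define d where "d = real (card U) - 1"
  ultimately show ?thesis
    unfolding V_def[symmetric] D_def Y_def d_def[symmetric] by (simp add: real_sqrt_divide mult_ac)
qed

end

lemma sum_even_compose_right:
  assumes U: "finite U" and \<rho>: "\<rho> permutes U" "evenperm \<rho>"
  shows "(\<Sum>\<pi> | \<pi> permutes U \<and> evenperm \<pi>. f (\<pi> \<circ> \<rho>)) = (\<Sum>\<pi> | \<pi> permutes U \<and> evenperm \<pi>. f \<pi> :: real)"
proof -
  have perm: "permutation \<tau>" if "\<tau> permutes U" for \<tau> using U that permutation_permutes by blast
  have \<rho>': "Hilbert_Choice.inv \<rho> permutes U" "evenperm (Hilbert_Choice.inv \<rho>)"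
    using permutes_inv[OF \<rho>(1)] evenperm_inv[OF perm[OF \<rho>(1)]] \<rho>(2) by auto
  show ?thesis
    by (rule sum.reindex_bij_witness[where i = "\<lambda>\<tau>. \<tau> \<circ> Hilbert_Choice.inv \<rho>" and j = "\<lambda>\<tau>. \<tau> \<circ> \<rho>"])
       (use \<rho> \<rho>' perm in \<open>auto simp: o_assoc[symmetric] permutes_inv_o[OF \<rho>(1)] evenperm_comp intro: permutes_compose\<close>)
qed

lemma sum_perm_split_parity:
  assumes U: "finite U" and uv: "u \<in> U" "v \<in> U" "u \<noteq> v"
    and f: "\<And>\<pi>. \<pi> permutes U \<Longrightarrow> f (\<pi> \<circ> Transposition.transpose u v) = f \<pi>"
  shows "(\<Sum>\<pi> | \<pi> permutes U. f \<pi>) = 2 * (\<Sum>\<pi> | \<pi> permutes U \<and> evenperm \<pi>. f \<pi> :: real)"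
proof -
  have perm: "permutation \<tau>" if "\<tau> permutes U" for \<tau> using U that permutation_permutes by blast
  have t: "Transposition.transpose u v permutes U" using uv by (intro permutes_swap_id)
  have fin: "finite {\<pi>. \<pi> permutes U \<and> evenperm \<pi>}" "finite {\<pi>. \<pi> permutes U \<and> \<not> evenperm \<pi>}"
    by (rule finite_subset[OF _ finite_permutations[OF U]], auto)+
  have "{\<pi>. \<pi> permutes U} = {\<pi>. \<pi> permutes U \<and> evenperm \<pi>} \<union> {\<pi>. \<pi> permutes U \<and> \<not> evenperm \<pi>}" by auto
  then have "(\<Sum>\<pi> | \<pi> permutes U. f \<pi>) =
      (\<Sum>\<pi> | \<pi> permutes U \<and> evenperm \<pi>. f \<pi>) + (\<Sum>\<pi> | \<pi> permutes U \<and> \<not> evenperm \<pi>. f \<pi>)"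
    by (simp only:) (rule sum.union_disjoint[OF fin], auto)
  also have "(\<Sum>\<pi> | \<pi> permutes U \<and> \<not> evenperm \<pi>. f \<pi>) = (\<Sum>\<pi> | \<pi> permutes U \<and> evenperm \<pi>. f \<pi>)"
    by (rule sum.reindex_bij_witness[where i = "\<lambda>\<tau>. \<tau> \<circ> Transposition.transpose u v" and j = "\<lambda>\<tau>. \<tau> \<circ> Transposition.transpose u v"])
       (use t perm uv f in \<open>auto simp: o_assoc[symmetric] evenperm_comp evenperm_swap permutation_swap_id intro: permutes_compose\<close>)
  finally show ?thesis by simp
qed

text \<open>Averaging the coefficients over a 3-cycle does not increase the sum over the alternating group, and
  it makes the linear form invariant under a transposition, so that one may sum over the symmetric group.\<close>

lemma sum_even_linear_form_ge:
  fixes a x :: "'a \<Rightarrow> real"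
  assumes U: "finite U" and uvw: "u \<in> U" "v \<in> U" "w \<in> U" "u \<noteq> v" "v \<noteq> w" "u \<noteq> w"
  defines "a' \<equiv> \<lambda>i. if i \<in> {u, v, w} then (a u + a v + a w) / 3 else a i"
  shows "(\<Sum>\<pi> | \<pi> permutes U \<and> evenperm \<pi>. \<bar>\<Sum>i\<in>U. a i * x (\<pi> i)\<bar>) \<ge>
    (\<Sum>\<pi> | \<pi> permutes U. \<bar>\<Sum>i\<in>U. a' i * x (\<pi> i)\<bar>) / 2"
proof -
  let ?A = "{\<pi>. \<pi> permutes U \<and> evenperm \<pi>}"
  define Y where "Y c \<pi> = (\<Sum>i\<in>U. c i * x (\<pi> i))" for c :: "'a \<Rightarrow> real" and \<pi>
  define Z where "Z \<pi> = (\<Sum>i\<in>U - {u, v, w}. a i * x (\<pi> i))" for \<pi>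
  have split: "Y c \<pi> = (\<Sum>i\<in>U - {u, v, w}. c i * x (\<pi> i)) + (c u * x (\<pi> u) + c v * x (\<pi> v) + c w * x (\<pi> w))" for c \<pi>
  proof -
    have "Y c \<pi> = (\<Sum>i\<in>U - {u, v, w}. c i * x (\<pi> i)) + (\<Sum>i\<in>{u, v, w}. c i * x (\<pi> i))"
      unfolding Y_def using uvw U by (intro sum.subset_diff) auto
    then show ?thesis using uvw by (simp add: add.assoc)
  qed
  have Ya: "Y a \<pi> = Z \<pi> + (a u * x (\<pi> u) + a v * x (\<pi> v) + a w * x (\<pi> w))" for \<pi>
    unfolding split Z_def ..
  have Ya': "Y a' \<pi> = Z \<pi> + (a u + a v + a w) / 3 * (x (\<pi> u) + x (\<pi> v) + x (\<pi> w))" for \<pi>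
  proof -
    have "(\<Sum>i\<in>U - {u, v, w}. a' i * x (\<pi> i)) = Z \<pi>" unfolding Z_def by (rule sum.cong) (auto simp: a'_def)
    then show ?thesis unfolding split by (simp add: a'_def algebra_simps)
  qed
  let ?\<rho> = "three_cycle u v w"
  have \<rho>: "?\<rho> permutes U" "evenperm ?\<rho>"
    using uvw three_cycle_permutes[of u U v w] three_cycle_even[of u v w] by auto
  note app = three_cycle_apply[OF uvw(4,5,6)]
  have Z\<rho>: "Z (\<pi> \<circ> ?\<rho>) = Z \<pi>" for \<pi> unfolding Z_def by (rule sum.cong) (auto simp: app(4))
  have avg: "3 * Y a' \<pi> = Y a \<pi> + Y a (\<pi> \<circ> ?\<rho>) + Y a (\<pi> \<circ> ?\<rho> \<circ> ?\<rho>)" for \<pi>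
  proof -
    have "3 * Y a' \<pi> = 3 * Z \<pi> + (a u + a v + a w) * (x (\<pi> u) + x (\<pi> v) + x (\<pi> w))"
      unfolding Ya' by simp
    then show ?thesis unfolding Ya Z\<rho> by (simp add: app algebra_simps)
  qed
  have "3 * (\<Sum>\<pi>\<in>?A. \<bar>Y a' \<pi>\<bar>) = (\<Sum>\<pi>\<in>?A. \<bar>3 * Y a' \<pi>\<bar>)" by (simp add: sum_distrib_left abs_mult)
  also have "\<dots> \<le> (\<Sum>\<pi>\<in>?A. \<bar>Y a \<pi>\<bar> + \<bar>Y a (\<pi> \<circ> ?\<rho>)\<bar> + \<bar>Y a (\<pi> \<circ> ?\<rho> \<circ> ?\<rho>)\<bar>)"
    unfolding avg by (intro sum_mono) linarith
  also have "\<dots> = 3 * (\<Sum>\<pi>\<in>?A. \<bar>Y a \<pi>\<bar>)"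
    using sum_even_compose_right[OF U \<rho>, of "\<lambda>\<pi>. \<bar>Y a \<pi>\<bar>"]
      sum_even_compose_right[OF U \<rho>, of "\<lambda>\<pi>. \<bar>Y a (\<pi> \<circ> ?\<rho>)\<bar>"]
    by (simp add: sum.distrib)
  finally have "(\<Sum>\<pi>\<in>?A. \<bar>Y a' \<pi>\<bar>) \<le> (\<Sum>\<pi>\<in>?A. \<bar>Y a \<pi>\<bar>)" by simp
  moreover have "Z (\<pi> \<circ> Transposition.transpose u v) = Z \<pi>" for \<pi>
    unfolding Z_def by (rule sum.cong) (auto simp: Transposition.transpose_def)
  then have "Y a' (\<pi> \<circ> Transposition.transpose u v) = Y a' \<pi>" for \<pi>
    unfolding Ya' using uvw by (simp add: Transposition.transpose_def add_ac)
  then have "(\<Sum>\<pi> | \<pi> permutes U. \<bar>Y a' \<pi>\<bar>) = 2 * (\<Sum>\<pi>\<in>?A. \<bar>Y a' \<pi>\<bar>)"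
    by (intro sum_perm_split_parity[OF U uvw(1,2,4)]) simp
  ultimately show ?thesis unfolding Y_def by simp
qed

section \<open>Height of a generator\<close>

lemma strict_sorted_int_gap:
  fixes xs :: "int list"
  assumes "sorted_wrt (<) xs" "i \<le> j" "j < length xs"
  shows "xs ! j - xs ! i \<ge> int j - int i"
  using assms(2,3)
proof (induction j rule: dec_induct)
  case (step j)
  have "xs ! j < xs ! Suc j" using assms(1) step.prems by (simp add: sorted_wrt_nth_less)
  then show ?case using step by simp
qed simp

text \<open>The terms are the least possible gaps when s distinct integers are paired from the
  outside inwards. Removing the outermost pair lowers s by 2, hence the induction in steps of
  two.\<close>

lemma sum_squares_progression:
  "(\<Sum>j<s div 2. (real s - 1 - 2 * real j)\<^sup>2) = real s * ((real s)\<^sup>2 - 1) / 6"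
proof (induction s rule: induct_nat_012)
  case (ge2 s)
  have "(\<Sum>j<Suc (Suc s) div 2. (real (Suc (Suc s)) - 1 - 2 * real j)\<^sup>2) =
      (real s + 1)\<^sup>2 + (\<Sum>j<s div 2. (real s - 1 - 2 * real j)\<^sup>2)"
    by (simp add: sum.lessThan_Suc_shift algebra_simps del: sum.lessThan_Suc)
  also have "\<dots> = (real s + 1)\<^sup>2 + real s * ((real s)\<^sup>2 - 1) / 6" by (simp only: ge2)
  also have "\<dots> = real (Suc (Suc s)) * ((real (Suc (Suc s)))\<^sup>2 - 1) / 6"
    by (simp add: power2_eq_square field_simps)
  finally show ?case .
qed simp_all

lemma distinct_values_enumeration:
  fixes a :: "nat \<Rightarrow> int"
  assumes "card (a ` {1..n}) \<ge> s"
  shows "\<exists>e. (\<forall>l<s. e l \<in> {1..n}) \<and> inj_on e {..<s} \<and>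
    (\<forall>l l'. l \<le> l' \<longrightarrow> l' < s \<longrightarrow> a (e l') - a (e l) \<ge> int l' - int l)"
proof -
  obtain T where T: "T \<subseteq> a ` {1..n}" "card T = s" "finite T"
    using obtain_subset_with_card_n[OF assms] by blast
  define xs where "xs = sorted_list_of_set T"
  have xs: "sorted_wrt (<) xs" "length xs = s" "set xs = T"
    using T by (simp_all add: xs_def)
  define e where "e l = inv_into {1..n} a (xs ! l)" for l
  have mem: "xs ! l \<in> a ` {1..n}" if "l < s" for l
    using that xs T(1) nth_mem[of l xs] by auto
  have e: "e l \<in> {1..n}" "a (e l) = xs ! l" if "l < s" for l
    using inv_into_into[OF mem[OF that]] f_inv_into_f[OF mem[OF that]] by (simp_all add: e_def)
  have gap: "a (e l') - a (e l) \<ge> int l' - int l" if "l \<le> l'" "l' < s" for l l'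
    using strict_sorted_int_gap[OF xs(1) that(1)] that xs(2) e(2) by simp
  have "inj_on e {..<s}"
  proof (rule linorder_inj_onI')
    fix i j assume "i \<in> {..<s}" "j \<in> {..<s}" "i < j"
    then have "a (e j) - a (e i) > 0" using gap[of i j] by simp
    then show "e i \<noteq> e j" by auto
  qed
  then show ?thesis using e(1) gap by blast
qed

text \<open>Of the at least n - 1 distinct exponents, n - 4 are kept for the pairing; three of the
  four remaining indices serve the average over a 3-cycle. The bound n >= 6 leaves at least one
  pair.\<close>

lemma sum_even_int_linear_form_ge:
  fixes a :: "nat \<Rightarrow> int" and x :: "nat \<Rightarrow> real"
  assumes n: "n \<ge> 6" and a: "card (a ` {1..n}) \<ge> n - 1" and x: "(\<Sum>i=1..n. x i) = 0"
  defines "s \<equiv> real n - 4"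
  shows "(\<Sum>\<pi> | \<pi> permutes {1..n} \<and> evenperm \<pi>. \<bar>\<Sum>i=1..n. real_of_int (a i) * x (\<pi> i)\<bar>) \<ge>
    fact n / 4 * sqrt (s * (s\<^sup>2 - 1) / 18) * (\<Sum>i=1..n. \<bar>x i\<bar>) / (real n - 1)"
proof -
  define r where "r = n - 4"
  have s: "s = real r" "r \<ge> 2" using n by (simp_all add: s_def r_def)
  have "card (a ` {1..n}) \<ge> r" using a by (simp add: r_def)
  from distinct_values_enumeration[OF this] obtain e where
    e_all: "\<forall>l<r. e l \<in> {1..n}" "inj_on e {..<r}"
    "\<forall>l l'. l \<le> l' \<longrightarrow> l' < r \<longrightarrow> a (e l') - a (e l) \<ge> int l' - int l"
    by (elim exE conjE)
  note e = e_all(1)[rule_format] e_all(2) e_all(3)[rule_format]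
  have "card (e ` {..<r}) = r" using e(2) by (simp add: card_image)
  then have "card (e ` {..<r}) + 3 \<le> n" using n by (simp add: r_def)
  then obtain ys where ys: "length ys = 3" "distinct ys" "set ys \<subseteq> {1..n} - e ` {..<r}"
    using obtain_distinct_outside[of "e ` {..<r}" 3 n] by blast
  then obtain u v w where ys_eq: "ys = [u, v, w]" by (auto simp: numeral_3_eq_3 length_Suc_conv)
  then have uvw: "u \<in> {1..n}" "v \<in> {1..n}" "w \<in> {1..n}" "u \<noteq> v" "v \<noteq> w" "u \<noteq> w"
    and out: "{u, v, w} \<inter> e ` {..<r} = {}" using ys by auto
  define a' where "a' i = (if i \<in> {u, v, w} then (real_of_int (a u) + real_of_int (a v) + real_of_int (a w)) / 3
    else real_of_int (a i))" for i
  have a'e: "a' (e l) = real_of_int (a (e l))" if "l < r" for l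
    using out that by (auto simp: a'_def)
  define J where "J = {..<r div 2}"
  \<comment> \<open>Opposite ends of the increasing enumeration are paired; for odd r the middle
    index stays unpaired.\<close>
  define p where "p j = e (r - 1 - j)" for j
  define q where "q j = e j" for j
  interpret disjoint_pairs "{1..n}" J p q
  proof
    show "inj_on p J" unfolding p_def J_def
      by (rule inj_onI) (use inj_onD[OF e(2)] in force)
    show "inj_on q J" unfolding q_def J_def by (rule inj_on_subset[OF e(2)]) auto
    show "p ` J \<subseteq> {1..n}" "q ` J \<subseteq> {1..n}" using e(1) s(2) by (auto simp: p_def q_def J_def)
    show "p ` J \<inter> q ` J = {}"
    proof (rule ccontr)
      assume "p ` J \<inter> q ` J \<noteq> {}"
      then obtain i j where ij: "i < r div 2" "j < r div 2" "e (r - 1 - i) = e j" by (auto simp: p_def q_def J_def)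
      then have "r - 1 - i = j" using inj_onD[OF e(2), of "r - 1 - i" j] by simp
      then show False using ij by linarith
    qed
  qed (auto simp: J_def)
  define wt where "wt j = real r - 1 - 2 * real j" for j
  have W: "(\<Sum>j\<in>J. (wt j)\<^sup>2) = s * (s\<^sup>2 - 1) / 6"
    unfolding J_def wt_def s(1) by (rule sum_squares_progression)
  have "s\<^sup>2 \<ge> 2\<^sup>2" using s by (intro power_mono) auto
  then have "s * (s\<^sup>2 - 1) > 0" using s by (intro mult_pos_pos) auto
  then have Wpos: "(\<Sum>j\<in>J. (wt j)\<^sup>2) > 0" unfolding W by simp
  have w1: "\<bar>a' (p j) - a' (q j)\<bar> \<ge> wt j" if "j \<in> J" for j
  proof -
    have j: "j < r div 2" using that by (simp add: J_def)
    then have "j \<le> r - 1 - j" "r - 1 - j < r" "j < r" by linarith+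
    moreover from this have "int (r - 1 - j) - int j = int r - 1 - 2 * int j" by linarith
    ultimately have "a (e (r - 1 - j)) - a (e j) \<ge> int r - 1 - 2 * int j" using e(3)[of j "r - 1 - j"] by simp
    then have "real_of_int (a (e (r - 1 - j))) - real_of_int (a (e j)) \<ge> wt j" by (simp add: wt_def)
    then show ?thesis using a'e \<open>j < r\<close> \<open>r - 1 - j < r\<close> by (simp add: p_def q_def)
  qed
  have w2: "wt j \<ge> 0" if "j \<in> J" for j
  proof -
    have "j < r div 2" using that by (simp add: J_def)
    then have "2 * j + 1 \<le> r" by linarith
    then have "real (2 * j + 1) \<le> real r" by (simp only: of_nat_le_iff)
    then show ?thesis by (simp add: wt_def)
  qed
  have "fact n / 4 * sqrt (s * (s\<^sup>2 - 1) / 18) * (\<Sum>i=1..n. \<bar>x i\<bar>) / (real n - 1) =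
      (fact (card {1..n}) * sqrt ((\<Sum>j\<in>J. (wt j)\<^sup>2) / 3) / 2 * (\<Sum>i\<in>{1..n}. \<bar>x i\<bar>) / (real (card {1..n}) - 1)) / 2"
    unfolding W by simp
  also have "\<dots> \<le> (\<Sum>\<pi> | \<pi> permutes {1..n}. \<bar>\<Sum>i\<in>{1..n}. a' i * x (\<pi> i)\<bar>) / 2"
    using sum_perm_linear_form_ge[OF w1 w2 Wpos x] by (intro divide_right_mono) auto
  also have "\<dots> \<le> (\<Sum>\<pi> | \<pi> permutes {1..n} \<and> evenperm \<pi>. \<bar>\<Sum>i=1..n. real_of_int (a i) * x (\<pi> i)\<bar>)"
    using sum_even_linear_form_ge[of "{1..n}" u v w "\<lambda>i. real_of_int (a i)" x, OF _ uvw] by (simp add: a'_def)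
  finally show ?thesis .
qed

lemma card_even_permutations:
  assumes "n \<ge> 2" shows "real (card {\<pi>. \<pi> permutes {1..n} \<and> evenperm \<pi>}) = fact n / 2"
proof -
  have "(\<Sum>\<pi> | \<pi> permutes {1..n}. 1 :: real) = 2 * (\<Sum>\<pi> | \<pi> permutes {1..n} \<and> evenperm \<pi>. 1)"
    using assms by (intro sum_perm_split_parity[of _ 1 2]) auto
  then show ?thesis by (simp add: card_permutations)
qed

lemma ln_power_int: "t > 0 \<Longrightarrow> ln (t powi k) = real_of_int k * ln (t :: real)"
  by (auto simp: power_int_def ln_realpow ln_inverse)

section \<open>Conjugates and height of a monomial\<close>

context alternating_unit
begin

definition conj_monomial :: "(nat \<Rightarrow> int) \<Rightarrow> (nat \<Rightarrow> nat) \<Rightarrow> complex" where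
  "conj_monomial a \<pi> = (\<Prod>i=1..n. b (\<pi> i) powi a i)"

abbreviation evens :: "(nat \<Rightarrow> nat) set" where
  "evens \<equiv> {\<pi>. \<pi> permutes {1..n} \<and> evenperm \<pi>}"

lemma algebraic_monomial: "algebraic (monomial a)"
  using splitting_field_algebraic[OF P_nonzero K_splitting monomial_in_K] .

lemma alg_conjugates_monomial: "alg_conjugates (monomial a) = conj_monomial a ` evens"
proof -
  have "(\<lambda>\<sigma>. \<sigma> (monomial a)) ` galois_group K = conj_monomial a ` evens"
  proof (intro equalityI subsetI)
    fix y assume "y \<in> (\<lambda>\<sigma>. \<sigma> (monomial a)) ` galois_group K"
    then obtain \<sigma> where \<sigma>: "\<sigma> \<in> galois_group K" "y = \<sigma> (monomial a)" by blast
    obtain \<pi> where \<pi>: "\<pi> permutes {1..n}" "evenperm \<pi>" "\<And>i. i \<in> {1..n} \<Longrightarrow> \<sigma> (b i) = b (\<pi> i)"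
      using perm_of_galois[OF \<sigma>(1)] by blast
    then have "y = conj_monomial a \<pi>"
      using monomial_galois(1)[OF \<sigma>(1) \<pi>(1,3)] \<sigma>(2) by (simp add: conj_monomial_def)
    then show "y \<in> conj_monomial a ` evens" using \<pi> by blast
  next
    fix y assume "y \<in> conj_monomial a ` evens"
    then obtain \<pi> where \<pi>: "\<pi> permutes {1..n}" "evenperm \<pi>" "y = conj_monomial a \<pi>" by blast
    obtain \<sigma> where \<sigma>: "\<sigma> \<in> galois_group K" "\<And>i. i \<in> {1..n} \<Longrightarrow> \<sigma> (b i) = b (\<pi> i)"
      using galois_of_perm[OF \<pi>(1,2)] by blast
    then have "y = \<sigma> (monomial a)"
      using monomial_galois(1)[OF \<sigma>(1) \<pi>(1) \<sigma>(2)] \<pi>(3) by (simp add: conj_monomial_def)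
    then show "y \<in> (\<lambda>\<sigma>. \<sigma> (monomial a)) ` galois_group K" using \<sigma>(1) by blast
  qed
  then show ?thesis using alg_conjugates_galois_orbit[OF P_nonzero K_splitting monomial_in_K] by simp
qed

lemma conj_monomial_inj:
  assumes gen: "rat_adjoin {monomial a} = K"
  shows "inj_on (conj_monomial a) evens"
proof (rule inj_onI)
  fix \<pi> \<pi>' assume "\<pi> \<in> evens" "\<pi>' \<in> evens" and eq: "conj_monomial a \<pi> = conj_monomial a \<pi>'"
  then have \<pi>: "\<pi> permutes {1..n}" "evenperm \<pi>" and \<pi>': "\<pi>' permutes {1..n}" "evenperm \<pi>'" by auto
  obtain \<sigma> where \<sigma>: "\<sigma> \<in> galois_group K" "\<And>i. i \<in> {1..n} \<Longrightarrow> \<sigma> (b i) = b (\<pi> i)"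
    using galois_of_perm[OF \<pi>] by blast
  obtain \<tau> where \<tau>: "\<tau> \<in> galois_group K" "\<And>i. i \<in> {1..n} \<Longrightarrow> \<tau> (b i) = b (\<pi>' i)"
    using galois_of_perm[OF \<pi>'] by blast
  have "\<sigma> (monomial a) = \<tau> (monomial a)"
    using eq monomial_galois(1)[OF \<sigma>(1) \<pi>(1) \<sigma>(2)] monomial_galois(1)[OF \<tau>(1) \<pi>'(1) \<tau>(2)]
    by (simp add: conj_monomial_def)
  moreover have "complex_subfield {x\<in>K. \<sigma> x = \<tau> x}"
    by (rule subfield_equalizer[OF K_field galois_hom[OF \<sigma>(1)] galois_hom[OF \<tau>(1)]])
  ultimately have "K \<subseteq> {x\<in>K. \<sigma> x = \<tau> x}"
    using rat_adjoin_least[of "{x\<in>K. \<sigma> x = \<tau> x}" "{monomial a}"] monomial_in_K gen by auto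
  then have agree: "\<sigma> (b i) = \<tau> (b i)" if "i \<in> {1..n}" for i using b_in_K[OF that] by auto
  have "\<pi> i = \<pi>' i" for i
  proof (cases "i \<in> {1..n}")
    case True
    then have "b (\<pi> i) = b (\<pi>' i)" using \<sigma>(2)[OF True] \<tau>(2)[OF True] agree[OF True] by simp
    moreover have "\<pi> i \<in> {1..n}" "\<pi>' i \<in> {1..n}"
      using True permutes_in_image[OF \<pi>(1)] permutes_in_image[OF \<pi>'(1)] by blast+
    ultimately show ?thesis using b_eq_iff by blast
  next
    case False
    then show ?thesis using permutes_not_in[OF \<pi>(1)] permutes_not_in[OF \<pi>'(1)] by simp
  qed
  then show "\<pi> = \<pi>'" by (rule ext)
qed

text \<open>A 3-cycle takes i to j, so the mean of x (\<pi> i) is the same for all i, namely 0.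
  Hence the logarithms of the absolute values of the conjugates balance, and their positive part is
  half the sum of absolute values.\<close>

lemma sum_even_linear_form_eq_0:
  fixes a x :: "nat \<Rightarrow> real"
  assumes x: "(\<Sum>i=1..n. x i) = 0"
  shows "(\<Sum>\<pi>\<in>evens. \<Sum>i=1..n. a i * x (\<pi> i)) = 0"
proof -
  define S where "S i = (\<Sum>\<pi>\<in>evens. x (\<pi> i))" for i
  have eq: "S i = S j" if ij: "i \<in> {1..n}" "j \<in> {1..n}" for i j
  proof (cases "i = j")
    case False
    have "card {i, j} + 1 \<le> n" using n5 by (simp add: card_insert_if)
    then obtain xs where "length xs = 1" "distinct xs" "set xs \<subseteq> {1..n} - {i, j}"
      using obtain_distinct_outside[of "{i, j}" 1 n] by blast
    then obtain k where k: "k \<in> {1..n}" "k \<noteq> i" "k \<noteq> j" by (auto simp: length_Suc_conv)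
    have "(\<Sum>\<pi>\<in>evens. x ((\<pi> \<circ> three_cycle i j k) i)) = (\<Sum>\<pi>\<in>evens. x (\<pi> i))"
      using ij k False by (intro sum_even_compose_right three_cycle_permutes three_cycle_even) auto
    then show ?thesis using three_cycle_apply(1)[of i j k] False k by (simp add: S_def)
  qed simp
  have "(\<Sum>i=1..n. S i) = (\<Sum>\<pi>\<in>evens. \<Sum>i=1..n. x (\<pi> i))" unfolding S_def by (rule sum.swap)
  also have "\<dots> = (\<Sum>\<pi>\<in>evens. 0)"
  proof (rule sum.cong[OF refl])
    fix \<pi> assume "\<pi> \<in> evens"
    then show "(\<Sum>i=1..n. x (\<pi> i)) = 0" using sum.permute[of \<pi> "{1..n}" x] x by (simp add: o_def)
  qed
  finally have tot: "(\<Sum>i=1..n. S i) = 0" by simp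
  have S0: "S i = 0" if i: "i \<in> {1..n}" for i
  proof -
    have "(\<Sum>j=1..n. S j) = (\<Sum>j=1..n. S i)" by (rule sum.cong[OF refl]) (rule eq[OF _ i])
    then have "real n * S i = 0" using tot by simp
    then show ?thesis using n5 by simp
  qed
  have "(\<Sum>\<pi>\<in>evens. \<Sum>i=1..n. a i * x (\<pi> i)) = (\<Sum>i=1..n. a i * S i)"
    unfolding S_def sum_distrib_left by (rule sum.swap)
  also have "\<dots> = 0" using S0 by simp
  finally show ?thesis .
qed

lemma weil_height_monomial_ge:
  assumes n6: "n \<ge> 6" and gen: "rat_adjoin {monomial a} = K"
  defines "s \<equiv> real n - 4"
  shows "weil_height (monomial a) \<ge> sqrt (s * (s\<^sup>2 - 1) / 18) / 2 * ln mahler / (real n - 1)"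
proof -
  define x where "x i = ln (cmod (b i))" for i
  define y where "y \<pi> = (\<Sum>i=1..n. real_of_int (a i) * x (\<pi> i))" for \<pi>
  have x0: "(\<Sum>i=1..n. x i) = 0" unfolding x_def by (rule sum_ln_b)
  have inj: "inj_on (conj_monomial a) evens" by (rule conj_monomial_inj[OF gen])
  have fin: "finite evens" by (rule finite_subset[OF _ finite_permutations[of "{1..n}"]]) auto
  have card: "real (alg_degree (monomial a)) = fact n / 2"
    using card_alg_conjugates[OF algebraic_monomial, of a] card_image[OF inj] n5 card_even_permutations[of n]
    by (simp add: alg_conjugates_monomial)
  have cpos: "cmod (b (\<pi> i)) > 0" if "\<pi> \<in> evens" "i \<in> {1..n}" for \<pi> i
    using b_nonzero[of "\<pi> i"] permutes_in_image[of \<pi> "{1..n}" i] that by simp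
  have ln_conj: "ln (cmod (conj_monomial a \<pi>)) = y \<pi>" if \<pi>: "\<pi> \<in> evens" for \<pi>
  proof -
    have "cmod (conj_monomial a \<pi>) = (\<Prod>i=1..n. cmod (b (\<pi> i)) powi a i)"
      unfolding conj_monomial_def by (simp add: prod_norm[symmetric] norm_power_int)
    also have "ln \<dots> = (\<Sum>i=1..n. ln (cmod (b (\<pi> i)) powi a i))"
      by (intro ln_prod not_sym[OF less_imp_neq[OF zero_less_power_int[OF cpos[OF \<pi>]]]]) auto
    also have "\<dots> = y \<pi>" unfolding y_def x_def
      by (rule sum.cong[OF refl]) (use cpos[OF \<pi>] in \<open>simp add: ln_power_int\<close>)
    finally show ?thesis .
  qed
  have nz: "conj_monomial a \<pi> \<noteq> 0" if "\<pi> \<in> evens" for \<pi>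
    unfolding conj_monomial_def using cpos[OF that] by (simp add: prod_zero_iff)
  \<comment> \<open>A nonzero integer leading coefficient has absolute value at least 1; this
    suffices for a lower bound without deciding whether the monomial is integral.\<close>
  have "real_of_int \<bar>lead_coeff (min_int_poly (monomial a))\<bar> \<ge> 1"
    using lead_coeff_min_int_poly[OF algebraic_monomial, of a] by linarith
  then have "alg_mahler (monomial a) \<ge> 1 * (\<Prod>z\<in>alg_conjugates (monomial a). max 1 (cmod z))"
    unfolding alg_mahler_def by (intro mult_right_mono prod_nonneg) auto
  also have "1 * (\<Prod>z\<in>alg_conjugates (monomial a). max 1 (cmod z)) = (\<Prod>\<pi>\<in>evens. max 1 (cmod (conj_monomial a \<pi>)))"
    using inj by (simp add: alg_conjugates_monomial prod.reindex)
  finally have mahler_ge: "(\<Prod>\<pi>\<in>evens. max 1 (cmod (conj_monomial a \<pi>))) \<le> alg_mahler (monomial a)" .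
  have "(\<Sum>\<pi>\<in>evens. \<bar>y \<pi>\<bar>) / 2 = (\<Sum>\<pi>\<in>evens. (y \<pi> + \<bar>y \<pi>\<bar>) / 2)"
    using sum_even_linear_form_eq_0[OF x0, of "\<lambda>i. real_of_int (a i)"]
    by (simp add: y_def sum.distrib flip: sum_divide_distrib)
  also have "\<dots> = (\<Sum>\<pi>\<in>evens. ln (max 1 (cmod (conj_monomial a \<pi>))))"
  proof (rule sum.cong[OF refl])
    fix \<pi> assume \<pi>: "\<pi> \<in> evens"
    have "cmod (conj_monomial a \<pi>) > 0" using nz[OF \<pi>] by simp
    then show "(y \<pi> + \<bar>y \<pi>\<bar>) / 2 = ln (max 1 (cmod (conj_monomial a \<pi>)))"
      unfolding ln_conj[OF \<pi>, symmetric]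
      by (cases "cmod (conj_monomial a \<pi>) \<ge> 1") (auto simp: max_def abs_if)
  qed
  also have "\<dots> = ln (\<Prod>\<pi>\<in>evens. max 1 (cmod (conj_monomial a \<pi>)))"
    using fin by (intro ln_prod[symmetric]) (auto simp: max_def)
  also have "\<dots> \<le> ln (alg_mahler (monomial a))"
  proof -
    have "(\<Prod>\<pi>\<in>evens. max 1 (cmod (conj_monomial a \<pi>))) > 0" by (rule prod_pos) (simp add: less_max_iff_disj)
    then show ?thesis using mahler_ge by simp
  qed
  finally have lower: "(\<Sum>\<pi>\<in>evens. \<bar>y \<pi>\<bar>) / 2 \<le> ln (alg_mahler (monomial a))" .
  have "card (a ` {1..n}) \<ge> n - 1"
    using gen generator_iff_equal_pairs card_equal_pairs_le_1_iff by blast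
  from sum_even_int_linear_form_ge[OF n6 this x0, unfolded x_def sum_abs_ln_b]
  have "fact n / 4 * sqrt (s * (s\<^sup>2 - 1) / 18) * (2 * ln mahler) / (real n - 1) \<le> (\<Sum>\<pi>\<in>evens. \<bar>y \<pi>\<bar>)"
    unfolding y_def s_def x_def .
  then have "fact n / 4 * sqrt (s * (s\<^sup>2 - 1) / 18) * (2 * ln mahler) / (real n - 1) / 2
      \<le> (\<Sum>\<pi>\<in>evens. \<bar>y \<pi>\<bar>) / 2"
    by (rule divide_right_mono) simp
  also note lower
  finally have "fact n / 4 * sqrt (s * (s\<^sup>2 - 1) / 18) * (2 * ln mahler) / (real n - 1) / 2 / (fact n / 2)
      \<le> ln (alg_mahler (monomial a)) / (fact n / 2)"
    by (rule divide_right_mono) simp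
  moreover have "f / 4 * q * (2 * l) / d / 2 / (f / 2) = q / 2 * l / d" if "f \<noteq> 0" for f q l d :: real
    using that by simp
  from this[OF fact_nonzero] have "fact n / 4 * sqrt (s * (s\<^sup>2 - 1) / 18) * (2 * ln mahler) / (real n - 1) / 2 / (fact n / 2) =
      sqrt (s * (s\<^sup>2 - 1) / 18) / 2 * ln mahler / (real n - 1)" .
  ultimately show ?thesis unfolding weil_height_def card by (simp only:)
qed

lemma weil_height_monomial_nonneg: "weil_height (monomial a) \<ge> 0"
proof -
  have "real_of_int \<bar>lead_coeff (min_int_poly (monomial a))\<bar> \<ge> 1"
    using lead_coeff_min_int_poly[OF algebraic_monomial, of a] by linarith
  moreover have "(\<Prod>z\<in>alg_conjugates (monomial a). max 1 (cmod z)) \<ge> 1" by (rule prod_ge_1) simp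
  ultimately have "alg_mahler (monomial a) \<ge> 1 * 1" unfolding alg_mahler_def by (intro mult_mono) auto
  then show ?thesis unfolding weil_height_def by simp
qed

end

section \<open>A lower bound for the number of primes\<close>

text \<open>The entries \<open>1 / (k (n choose k))\<close> of the Leibniz harmonic triangle satisfy a Pascal-like recursion,
  so a common multiple of \<open>1, \<dots>, n\<close> clears all their denominators.\<close>

lemma harmonic_triangle_rec:
  assumes "1 \<le> k" "k < n"
  shows "1 / (real (Suc k) * real (n choose Suc k)) =
    1 / (real k * real ((n - 1) choose k)) - 1 / (real k * real (n choose k))"
proof -
  define c where "c = real (n choose k)"
  have c: "c > 0" using assms by (simp add: c_def)
  have k: "real k > 0" "real n - real k > 0" using assms by auto
  have "Suc k * (n choose Suc k) = (n - k) * (n choose k)"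
    by (simp only: binomial_absorption binomial_absorb_comp)
  then have e1: "real (Suc k) * real (n choose Suc k) = (real n - real k) * c"
    using assms unfolding c_def by (metis of_nat_mult of_nat_diff less_imp_le)
  have "(n - k) * (n choose k) = n * ((n - 1) choose k)" by (rule binomial_absorb_comp)
  then have e2: "(real n - real k) * c = real n * real ((n - 1) choose k)"
    using assms unfolding c_def by (metis of_nat_mult of_nat_diff less_imp_le)
  then have e3: "real ((n - 1) choose k) = (real n - real k) * c / real n" using assms by (simp add: field_simps)
  show ?thesis unfolding e1 e3 c_def[symmetric] using c k assms by (simp add: field_simps)
qed

lemma common_multiple_ge_binomial:
  assumes L: "\<And>j. j \<in> {1..N} \<Longrightarrow> j dvd L" and kn: "1 \<le> k" "k \<le> n" "n \<le> N"
  shows "real L / (real k * real (n choose k)) \<in> \<int>"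
  using kn
proof (induction k arbitrary: n rule: nat_induct_at_least)
  case base
  have "n dvd L" using base by (intro L) auto
  then obtain q where "L = n * q" by blast
  then have "real L / (real 1 * real (n choose 1)) = real q" using base by simp
  then show ?case by simp
next
  case (Suc k)
  have "real L / (real (Suc k) * real (n choose Suc k)) =
      real L / (real k * real ((n - 1) choose k)) - real L / (real k * real (n choose k))"
  proof -
    have "real L / t = real L * (1 / t)" for t by simp
    then show ?thesis
      using harmonic_triangle_rec[of k n] Suc.hyps Suc.prems by (simp only: right_diff_distrib Suc_le_eq)
  qed
  moreover have "real L / (real k * real ((n - 1) choose k)) \<in> \<int>" "real L / (real k * real (n choose k)) \<in> \<int>"
    using Suc.IH[of "n - 1"] Suc.IH[of n] Suc.prems by auto
  ultimately show ?case by simp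
qed

text \<open>L is the least common multiple of 1, ..., n: each prime p <= n enters with its largest
  power not exceeding n, so it contributes at most n.\<close>

lemma common_multiple_exists:
  fixes n :: nat
  shows "\<exists>L > 0. (\<forall>j\<in>{1..n}. j dvd L) \<and> L \<le> n ^ card {p. prime p \<and> p \<le> n}"
proof -
  define Q where "Q = {p. prime p \<and> p \<le> n}"
  \<comment> \<open>The bound e <= n keeps the set finite for every p, so that \<open>Max\<close> is
    meaningful; for primes it excludes nothing, as i < p ^ i.\<close>
  define e where "e p = Max {e::nat. e \<le> n \<and> p ^ e \<le> n}" for p
  define L where "L = (\<Prod>p\<in>Q. p ^ e p)"
  have finQ: "finite Q" unfolding Q_def by (rule finite_subset[of _ "{..n}"]) auto
  have e: "p ^ e p \<le> n" if "p \<in> Q" for p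
  proof -
    have "p \<ge> 1" "p \<le> n" using that prime_ge_1_nat by (auto simp: Q_def)
    then have "0 \<in> {e. e \<le> n \<and> p ^ e \<le> n}" by simp
    then have "e p \<in> {e. e \<le> n \<and> p ^ e \<le> n}" unfolding e_def by (intro Max_in) auto
    then show ?thesis by simp
  qed
  have e_max: "i \<le> e p" if "p \<in> Q" "p ^ i \<le> n" for p i
  proof -
    have "p \<ge> 2" using that prime_ge_2_nat by (auto simp: Q_def)
    then have "i < p ^ i" by (intro power_gt_expt) simp
    then have "i \<in> {e. e \<le> n \<and> p ^ e \<le> n}" using that by auto
    then show ?thesis unfolding e_def by (intro Max_ge) auto
  qed
  have "L > 0" unfolding L_def by (intro prod_pos) (auto simp: Q_def prime_gt_0_nat)
  moreover have "j dvd L" if j: "j \<in> {1..n}" for j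
  proof (rule multiplicity_le_imp_dvd)
    show "j \<noteq> 0" using j by auto
    fix p :: nat assume p: "prime p"
    show "multiplicity p j \<le> multiplicity p L"
    proof (cases "p \<in> Q")
      case True
      have "p ^ multiplicity p j \<le> j" using j by (intro dvd_imp_le multiplicity_dvd) auto
      then have "multiplicity p j \<le> e p" using j by (intro e_max[OF True]) auto
      also have "\<dots> = multiplicity p L"
        unfolding L_def using True finQ p by (subst multiplicity_prod_prime_powers) (auto simp: Q_def)
      finally show ?thesis .
    next
      case False
      then have "\<not> p dvd j" using p j dvd_imp_le[of p j] by (auto simp: Q_def)
      then show ?thesis by (simp add: not_dvd_imp_multiplicity_0)
    qed
  qed
  moreover have "L \<le> n ^ card Q"
    unfolding L_def using e prod_mono[of Q "\<lambda>p. p ^ e p" "\<lambda>_. n"] by simp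
  ultimately show ?thesis unfolding Q_def by blast
qed

text \<open>N times the central binomial coefficient divides every common multiple of 1, ..., 2 N.
  The factor N absorbs the 2 N + 1 in 4^N <= (2 N + 1) (2 N choose N), so only log 3 is
  lost.\<close>

lemma chebyshev_lower:
  assumes N: "N \<ge> 1"
  shows "real (card {p. prime p \<and> p \<le> 2 * N}) * ln (2 * real N) \<ge> 2 * real N * ln 2 - ln 3"
proof -
  obtain L where L: "L > 0" "\<forall>j\<in>{1..2*N}. j dvd L" "L \<le> (2 * N) ^ card {p. prime p \<and> p \<le> 2 * N}"
    using common_multiple_exists[of "2 * N"] by blast
  define c where "c = real ((2 * N) choose N)"
  have c: "c > 0" by (simp add: c_def)
  have "real L / (real N * c) \<in> \<int>"
    unfolding c_def using L(2) N by (intro common_multiple_ge_binomial[of "2 * N"]) auto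
  then obtain q where q: "real L / (real N * c) = of_int q" by (auto elim: Ints_cases)
  have "real L / (real N * c) > 0" using L c N by simp
  then have "q \<ge> 1" using q by simp
  then have "real L / (real N * c) \<ge> 1" using q by simp
  then have Lc: "real N * c \<le> real L" using c N by (simp add: field_simps)
  have "(4::nat) ^ N = (\<Sum>k\<le>2*N. (2 * N) choose k)" by (simp add: choose_row_sum power_mult)
  also have "\<dots> \<le> (\<Sum>k\<le>2*N. (2 * N) choose N)" by (intro sum_mono binomial_maximum')
  also have "\<dots> = (2 * N + 1) * ((2 * N) choose N)" by simp
  finally have "real (4 ^ N) \<le> real ((2 * N + 1) * ((2 * N) choose N))" by (simp only: of_nat_le_iff)
  then have "4 ^ N \<le> (2 * real N + 1) * c" by (simp add: c_def algebra_simps)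
  also have "\<dots> \<le> (3 * real N) * c" using N c by (intro mult_right_mono) auto
  also have "\<dots> \<le> 3 * real L" using Lc by simp
  also have "\<dots> \<le> 3 * (2 * real N) ^ card {p. prime p \<and> p \<le> 2 * N}"
  proof -
    have "real L \<le> real ((2 * N) ^ card {p. prime p \<and> p \<le> 2 * N})" using L(3) by (simp only: of_nat_le_iff)
    then show ?thesis by simp
  qed
  finally have "ln (4 ^ N) \<le> ln (3 * (2 * real N) ^ card {p. prime p \<and> p \<le> 2 * N})" using N by (subst ln_le_cancel_iff) auto
  also have "\<dots> = ln 3 + real (card {p. prime p \<and> p \<le> 2 * N}) * ln (2 * real N)"
    using N by (simp add: ln_mult ln_realpow algebra_simps)
  also have "ln ((4::real) ^ N) = 2 * real N * ln 2"
  proof -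
    have "(4::real) ^ N = 2 ^ (2 * N)" by (simp add: power_mult)
    then show ?thesis by (simp add: ln_realpow)
  qed
  finally show ?thesis by simp
qed

section \<open>Asymptotics\<close>

text \<open>From e < 2.72 and 2.72^69 <= 2^100. Two decimals suffice: 2.92 * 0.69 = 2.0148 exceeds
  2, which provides enough primes.\<close>

lemma ln_2_ge: "ln 2 \<ge> (69 / 100 :: real)"
proof -
  have "exp (69 :: real) = exp 1 ^ 69" by (simp flip: exp_of_nat_mult)
  also have "\<dots> \<le> (272 / 100) ^ 69" using e_less_272 by (intro power_mono) auto
  also have "\<dots> \<le> (2 :: real) ^ 100" by (simp add: power_divide divide_le_eq)
  finally have "ln (exp (69 :: real)) \<le> ln (2 ^ 100)" by (subst ln_le_cancel_iff) auto
  moreover have "ln ((2 :: real) ^ 100) = real 100 * ln 2" by (rule ln_realpow)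
  ultimately have "69 \<le> real 100 * ln 2" by (simp only: ln_exp)
  then show ?thesis by simp
qed

text \<open>Here and below x stands for n, and + 1 after the expressions for k and m covers rounding
  up to an integer.\<close>

lemma eventually_m_less_k:
  "eventually (\<lambda>x::real. 2 * ln x / ln (ln x) + 1 < (ln x)\<^sup>2 / (ln (ln x))\<^sup>2) at_top"
  by real_asymp

text \<open>Leading terms, with l = log x and t = log log x: 2.002 l^3 / t^2 against (2 l / t)^2 l /
  2 = 2 l^3 / t^2. The excess 0.002 pays for the lower-order terms; the Mahler term stays
  bounded.\<close>

lemma eventually_siegel_condition:
  "eventually (\<lambda>x::real. ((ln x)\<^sup>2 / (ln (ln x))\<^sup>2 - (2 * ln x / ln (ln x) + 1)) * (2002 / 1000 * ln x) \<ge>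
     (2 * ln x / ln (ln x) + 1) * ln 8 +
     ((2 * ln x / ln (ln x) + 1) * (2 * ln x / ln (ln x) + 1 + 1) / 2) * (ln x + ln ((ln x)\<^sup>2 / (ln (ln x))\<^sup>2 + 1)) +
     (2 * ln x / ln (ln x) + 1) * ((ln x)\<^sup>2 / (ln (ln x))\<^sup>2 + 1) * (34 / 100 * (ln (ln x) / ln x) ^ 3)) at_top"
  by real_asymp

text \<open>The denominator is asymptotic to 2 t, so the count is about 2.92 * 0.69 / 2 = 1.0074
  times l^2 / t^2, just above the k primes required; the l^2 / t^3 discarded small ones are
  negligible.\<close>

lemma eventually_prime_count:
  "eventually (\<lambda>x::real. (2 * (146 / 100 * (ln x)\<^sup>2 / ln (ln x) - 1) * (69 / 100) - ln 3) / ln (292 / 100 * (ln x)\<^sup>2 / ln (ln x))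
     - (ln x)\<^sup>2 / (ln (ln x)) ^ 3 \<ge> (ln x)\<^sup>2 / (ln (ln x))\<^sup>2 + 1) at_top"
  by real_asymp

text \<open>Leading terms: (1 + 2.002 + 2.92 * 0.34) l = 3.9948 l against 4 l, since log (l^2 / t^3)
  is asymptotic to 2 t. This comparison limits the constant 0.34.\<close>

lemma eventually_prime_power_bound:
  "eventually (\<lambda>x::real. ln x + ln ((ln x)\<^sup>2 / (ln (ln x))\<^sup>2 + 1) + 2002 / 1000 * ln x +
     292 / 100 * (ln x)\<^sup>2 / ln (ln x) * ((ln x)\<^sup>2 / (ln (ln x))\<^sup>2 + 1) * (34 / 100 * (ln (ln x) / ln x) ^ 3) <
     2 * ln x / ln (ln x) * ln ((ln x)\<^sup>2 / (ln (ln x)) ^ 3)) at_top"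
  by real_asymp

lemma eventually_large:
  "eventually (\<lambda>x::real. ln (ln x) > 1 \<and> 146 / 100 * (ln x)\<^sup>2 / ln (ln x) > 2 \<and> (ln x)\<^sup>2 / (ln (ln x)) ^ 3 > 1) at_top"
  by (intro eventually_conj) real_asymp+

text \<open>Squared comparison of the final constants: 10/6282 bounds 1 / (200 pi) from above and
  1156/180000 is 0.34^2 / 18. The leading coefficients are 0.00636... and 0.00642...\<close>

lemma eventually_constant_comparison:
  "eventually (\<lambda>x::real. 4 * (x - 1) ^ 2 * x * (10 / 6282) \<le> (x - 4) * ((x - 4) ^ 2 - 1) * (1156 / 180000)) at_top"
  by real_asymp

lemma filterlim_target: "filterlim (\<lambda>n. sqrt (real n / (200 * pi)) * (ln (ln (real n)) / ln (real n)) ^ 3) at_top sequentially"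
  by real_asymp

text \<open>Here \<open>l = log n\<close> and \<open>t = log log n\<close>.  The auxiliary polynomial has degree less than \<open>n k\<close> with \<open>k \<approx> l\<^sup>2 / t\<^sup>2\<close>, order
  \<open>m \<approx> 2 l / t\<close> at each \<open>b\<^sub>i\<close> and coefficients bounded by \<open>n\<^bsup>2.002\<^esup>\<close>; the primes are taken between \<open>l\<^sup>2 / t\<^sup>3\<close> and
  \<open>2.92 l\<^sup>2 / t\<close>.  These values maximise the resulting constant, of which \<open>0.34\<close> is a rounded value.\<close>

lemma (in alternating_unit) ln_mahler_ge:
  defines "l \<equiv> ln (real n)" and "t \<equiv> ln (ln (real n))"
  assumes large: "t > 1 \<and> 146 / 100 * l\<^sup>2 / t > 2 \<and> l\<^sup>2 / t ^ 3 > 1"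
    and mk: "2 * l / t + 1 < l\<^sup>2 / t\<^sup>2"
    and siegel: "(l\<^sup>2 / t\<^sup>2 - (2 * l / t + 1)) * (2002 / 1000 * l) \<ge>
       (2 * l / t + 1) * ln 8 + ((2 * l / t + 1) * (2 * l / t + 1 + 1) / 2) * (l + ln (l\<^sup>2 / t\<^sup>2 + 1)) +
       (2 * l / t + 1) * (l\<^sup>2 / t\<^sup>2 + 1) * (34 / 100 * (t / l) ^ 3)"
    and primes: "(2 * (146 / 100 * l\<^sup>2 / t - 1) * (69 / 100) - ln 3) / ln (292 / 100 * l\<^sup>2 / t) - l\<^sup>2 / t ^ 3
       \<ge> l\<^sup>2 / t\<^sup>2 + 1"
    and contra: "l + ln (l\<^sup>2 / t\<^sup>2 + 1) + 2002 / 1000 * l +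
       292 / 100 * l\<^sup>2 / t * (l\<^sup>2 / t\<^sup>2 + 1) * (34 / 100 * (t / l) ^ 3) < 2 * l / t * ln (l\<^sup>2 / t ^ 3)"
  shows "ln mahler \<ge> 34 / 100 * (t / l) ^ 3"
proof (rule ccontr)
  define L where "L = ln mahler"
  define c where "c = 34 / 100 * (t / l) ^ 3"
  assume "\<not> ?thesis"
  then have Lc: "L \<le> c" by (simp add: L_def c_def)
  have L0: "L \<ge> 0" using ln_mahler_nonneg by (simp add: L_def)
  have t1: "t > 1" using large by blast
  have l0: "l > 0" using n5 by (simp add: l_def)
  have l1: "l > 1"
  proof -
    have "ln l > 0" using t1 by (simp add: t_def l_def)
    then show ?thesis using l0 by (metis ln_gt_zero_imp_gt_one)
  qed
  define kr where "kr = l\<^sup>2 / t\<^sup>2"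
  define mr where "mr = 2 * l / t"
  define xr where "xr = 146 / 100 * l\<^sup>2 / t"
  \<comment> \<open>Primes up to \<open>yr\<close> are few compared with k, yet for all others log p
    is at least log yr, which is already asymptotic to 2 t, as at the top of the range.\<close>
  define yr where "yr = l\<^sup>2 / t ^ 3"
  define k where "k = nat \<lceil>kr\<rceil>"
  define m where "m = nat \<lceil>mr\<rceil>"
  define N where "N = nat \<lfloor>xr\<rfloor>"
  have pos: "kr > 0" "mr > 0" "xr > 2" "yr > 1"
    using l1 t1 large by (auto simp: kr_def mr_def xr_def yr_def)
  have k: "kr \<le> real k" "real k \<le> kr + 1" using pos unfolding k_def by linarith+
  have m: "mr \<le> real m" "real m \<le> mr + 1" using pos unfolding m_def by linarith+
  have N: "xr - 1 \<le> real N" "real N \<le> xr" "N \<ge> 1" using pos unfolding N_def by linarith+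
  have k0: "real k > 0" using pos k by linarith
  have lnk: "ln (real (n * k)) \<le> l + ln (kr + 1)" "ln (real (n * k)) \<ge> 0"
  proof -
    have "ln (real (n * k)) = l + ln (real k)" using n5 k0 by (simp add: ln_mult l_def)
    also have "ln (real k) \<le> ln (kr + 1)" using k0 k pos by simp
    finally show "ln (real (n * k)) \<le> l + ln (kr + 1)" by simp
    have "n * k \<ge> 1" using n5 k0 by simp
    then have "real 1 \<le> real (n * k)" by (simp only: of_nat_le_iff)
    then show "ln (real (n * k)) \<ge> 0" by (intro ln_ge_zero) (simp only: of_nat_1)
  qed
  define Q where "Q = {p. prime p \<and> p \<le> 2 * N}"
  define S0 where "S0 = {p \<in> Q. real p > yr}"
  have finQ: "finite Q" unfolding Q_def by (rule finite_subset[of _ "{..2 * N}"]) auto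
  have "card S0 \<ge> k"
  proof -
    define d where "d = ln (292 / 100 * l\<^sup>2 / t)"
    define num where "num = 2 * (xr - 1) * (69 / 100) - ln 3"
    have dx: "d = ln (2 * xr)" by (simp add: d_def xr_def)
    have d0: "d > 0" unfolding dx using pos by simp
    have "num \<le> 2 * real N * ln 2 - ln 3"
    proof -
      have "2 * (xr - 1) * (69 / 100) \<le> 2 * real N * ln 2" using N pos ln_2_ge by (intro mult_mono) auto
      then show ?thesis by (simp add: num_def)
    qed
    also have "\<dots> \<le> real (card Q) * ln (2 * real N)" unfolding Q_def by (rule chebyshev_lower[OF N(3)])
    also have "\<dots> \<le> real (card Q) * d" unfolding dx using N by (intro mult_left_mono) auto
    finally have "num / d \<le> real (card Q)" using d0 by (simp add: divide_le_eq)
    moreover have "kr + 1 \<le> num / d - yr" using primes by (simp add: kr_def num_def d_def yr_def xr_def)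
    moreover have "card (Q - S0) \<le> card {1..nat \<lfloor>yr\<rfloor>}"
    proof (rule card_mono)
      show "Q - S0 \<subseteq> {1..nat \<lfloor>yr\<rfloor>}"
      proof
        fix p assume "p \<in> Q - S0"
        then have "prime p" "real p \<le> yr" by (auto simp: Q_def S0_def)
        then show "p \<in> {1..nat \<lfloor>yr\<rfloor>}" using prime_ge_1_nat[of p] by (simp add: le_nat_floor)
      qed
    qed simp
    then have "real (card (Q - S0)) \<le> yr" using pos by simp linarith
    moreover have "card Q = card S0 + card (Q - S0)"
    proof -
      have "S0 \<subseteq> Q" by (auto simp: S0_def)
      then show ?thesis using card_Diff_subset[of S0 Q] card_mono[OF finQ] finite_subset[OF _ finQ] by force
    qed
    ultimately have "real k \<le> real (card S0)" using k by linarith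
    then show ?thesis by simp
  qed
  then obtain S where S: "S \<subseteq> S0" "card S = k" "finite S" by (rule obtain_subset_with_card_n)
  have prime_S: "prime p" "real p \<le> 2 * xr" "real p > yr" if "p \<in> S" for p
  proof -
    have p: "p \<in> S0" using that S by blast
    then show "prime p" "real p > yr" by (auto simp: S0_def Q_def)
    have "p \<le> 2 * N" using p by (auto simp: S0_def Q_def)
    then have "real p \<le> real (2 * N)" by (simp only: of_nat_le_iff)
    then show "real p \<le> 2 * xr" using N by simp
  qed
  define T where "T = 2002 / 1000 * l"
  have T0: "T \<ge> 0" using l0 by (simp add: T_def)
  have "\<exists>p\<in>S. real m * ln (real p) \<le> ln (real (n * k)) + T + real p * real k * ln mahler"
  proof (rule dobrowolski_height[OF S(3,2)])
    show "m < k"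
    proof -
      have "real m < real k" using mk m k by (simp add: kr_def mr_def)
      then show ?thesis by simp
    qed
    have "real m * ln 8 + real m * (real m + 1) / 2 * ln (real (n * k)) + real m * real k * L \<le>
        (mr + 1) * ln 8 + (mr + 1) * (mr + 1 + 1) / 2 * (l + ln (kr + 1)) + (mr + 1) * (kr + 1) * c"
    proof (intro add_mono mult_mono divide_right_mono)
    qed (use m k lnk Lc L0 pos l0 in auto)
    also have "\<dots> \<le> (kr - (mr + 1)) * T" using siegel by (simp only: kr_def mr_def T_def c_def)
    also have "\<dots> \<le> (real k - real m) * T" using m k T0 by (intro mult_right_mono) auto
    finally show "(real k - real m) * T \<ge>
      real m * ln 8 + real m * (real m + 1) / 2 * ln (real (n * k)) + real m * real k * ln mahler"
      by (simp add: L_def)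
  qed (use prime_S T0 in auto)
  then obtain p where p: "p \<in> S" "real m * ln (real p) \<le> ln (real (n * k)) + T + real p * real k * L"
    unfolding L_def by blast
  have "mr * ln yr \<le> real m * ln (real p)"
    using m pos prime_S(3)[OF p(1)] by (intro mult_mono) auto
  also have "\<dots> \<le> ln (real (n * k)) + T + real p * real k * L" by (rule p(2))
  also have "\<dots> \<le> (l + ln (kr + 1)) + T + 2 * xr * (kr + 1) * c"
    using prime_S(2)[OF p(1)] lnk k k0 Lc L0 pos by (intro add_mono mult_mono) auto
  also have "\<dots> < mr * ln yr"
  proof -
    have "2 * xr = 292 / 100 * l\<^sup>2 / t" by (simp add: xr_def)
    then show ?thesis using contra by (simp only: kr_def mr_def yr_def T_def c_def)
  qed
  finally show False by simp
qed

lemma eventually_height_bound: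
  "\<forall>\<^sub>F n in sequentially. \<forall>\<beta> b a. alternating_unit n \<beta> b \<longrightarrow>
     rat_adjoin {alternating.monomial n b a} = rat_adjoin (b ` {1..n}) \<longrightarrow>
     weil_height (alternating.monomial n b a) \<ge>
       sqrt (real n / (200 * pi)) * (ln (ln (real n)) / ln (real n)) ^ 3"
proof -
  note ev = eventually_compose_filterlim[OF _ filterlim_real_sequentially]
  show ?thesis
    using ev[OF eventually_large] ev[OF eventually_m_less_k] ev[OF eventually_siegel_condition]
      ev[OF eventually_prime_count] ev[OF eventually_prime_power_bound] ev[OF eventually_constant_comparison]
      eventually_ge_at_top[of 6]
  proof eventually_elim
    case (elim n)
    show ?case
    proof (intro allI impI)
      fix \<beta> b a
      assume au: "alternating_unit n \<beta> b"
        and gen: "rat_adjoin {alternating.monomial n b a} = rat_adjoin (b ` {1..n})"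
      interpret alternating_unit n \<beta> b by (rule au)
      define c where "c = 34 / 100 * (ln (ln (real n)) / ln (real n)) ^ 3"
      define s where "s = real n - 4"
      have L: "ln mahler \<ge> c" unfolding c_def by (rule ln_mahler_ge[OF elim(1-5)])
      have n1: "real n - 1 > 0" using elim(7) by simp
      have s0: "s * (s\<^sup>2 - 1) / 18 \<ge> 0"
      proof -
        have "s\<^sup>2 \<ge> 2\<^sup>2" using elim(7) by (intro power_mono) (auto simp: s_def)
        then show ?thesis using elim(7) by (auto simp: s_def)
      qed
      have "1 / (200 * pi) \<le> 10 / 6282" using pi_approx(1) by (simp add: divide_simps)
      then have "real n / (200 * pi) \<le> real n * (10 / 6282)"
        using mult_left_mono[of "1 / (200 * pi)" "10 / 6282" "real n"] by simp
      then have "(2 * (real n - 1))\<^sup>2 * (real n / (200 * pi)) \<le> (2 * (real n - 1))\<^sup>2 * (real n * (10 / 6282))"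
        by (rule mult_left_mono) simp
      also have "\<dots> = 4 * (real n - 1) ^ 2 * real n * (10 / 6282)"
        by (simp only: power_mult_distrib) simp
      also have "\<dots> \<le> s * (s\<^sup>2 - 1) * (1156 / 180000)" using elim(6) by (simp add: s_def)
      also have "\<dots> = s * (s\<^sup>2 - 1) / 18 * (34 / 100)\<^sup>2" by (simp add: power2_eq_square)
      finally have "sqrt ((2 * (real n - 1))\<^sup>2 * (real n / (200 * pi))) \<le> sqrt (s * (s\<^sup>2 - 1) / 18 * (34 / 100)\<^sup>2)"
        by (rule real_sqrt_le_mono)
      then have "2 * (real n - 1) * sqrt (real n / (200 * pi)) \<le> sqrt (s * (s\<^sup>2 - 1) / 18) * (34 / 100)"
        using n1 by (simp only: real_sqrt_mult real_sqrt_abs) simp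
      then have "sqrt (real n / (200 * pi)) * (2 * (real n - 1)) \<le> sqrt (s * (s\<^sup>2 - 1) / 18) * (34 / 100)"
        by (subst mult.commute)
      moreover have "2 * (real n - 1) > 0" using n1 by simp
      ultimately have key: "sqrt (real n / (200 * pi)) \<le> sqrt (s * (s\<^sup>2 - 1) / 18) * (34 / 100) / (2 * (real n - 1))"
        by (simp only: pos_le_divide_eq)
      have q: "(ln (ln (real n)) / ln (real n)) ^ 3 \<ge> 0"
      proof -
        have "ln (ln (real n)) \<ge> 0" using elim(1) by linarith
        moreover have "ln (real n) \<ge> 0" using n5 by simp
        ultimately show ?thesis by (intro zero_le_power divide_nonneg_nonneg)
      qed
      have "sqrt (real n / (200 * pi)) * (ln (ln (real n)) / ln (real n)) ^ 3 \<le>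
          sqrt (s * (s\<^sup>2 - 1) / 18) * (34 / 100) / (2 * (real n - 1)) * (ln (ln (real n)) / ln (real n)) ^ 3"
        using key q by (rule mult_right_mono)
      also have "\<dots> = sqrt (s * (s\<^sup>2 - 1) / 18) / 2 * c / (real n - 1)"
      proof -
        have "r * (34 / 100) / (2 * d) * w = r / 2 * (34 / 100 * w) / d" for r d w :: real by simp
        then show ?thesis unfolding c_def .
      qed
      also have "\<dots> \<le> sqrt (s * (s\<^sup>2 - 1) / 18) / 2 * ln mahler / (real n - 1)"
        using L n1 s0 by (intro divide_right_mono mult_left_mono) auto
      also have "\<dots> \<le> weil_height (monomial a)"
        unfolding s_def using gen by (intro weil_height_monomial_ge[OF elim(7)]) (simp add: K_def)
      finally show "sqrt (real n / (200 * pi)) * (ln (ln (real n)) / ln (real n)) ^ 3 \<le> weil_height (monomial a)" .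
    qed
  qed
qed

theorem theorem1p4:
  shows
    "(\<forall>n (\<beta>::complex) (b :: nat \<Rightarrow> complex) (a :: nat \<Rightarrow> int) \<alpha>.
        n \<ge> 5 \<longrightarrow> alternating_conjugates n \<beta> b \<longrightarrow> \<alpha> = (\<Prod>i=1..n. b i powi a i) \<longrightarrow>
          (rat_adjoin {\<alpha>} = rat_adjoin (b ` {1..n}) \<longleftrightarrow>
             card {(i, j). i \<in> {1..n} \<and> j \<in> {1..n} \<and> i < j \<and> a i = a j} \<le> 1) \<and>
          (card {(i, j). i \<in> {1..n} \<and> j \<in> {1..n} \<and> i < j \<and> a i = a j} \<le> 1 \<longleftrightarrow>
             card (a ` {1..n}) \<ge> n - 1))
   \<and> (\<exists>g :: nat \<Rightarrow> real. g \<longlonglongrightarrow> 0 \<and>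
        (\<forall>n (\<beta>::complex) (b :: nat \<Rightarrow> complex) (a :: nat \<Rightarrow> int) \<alpha>.
          n \<ge> 5 \<longrightarrow> alternating_conjugates n \<beta> b \<longrightarrow> \<alpha> = (\<Prod>i=1..n. b i powi a i) \<longrightarrow>
          rat_adjoin {\<alpha>} = rat_adjoin (b ` {1..n}) \<longrightarrow> algebraic_unit \<beta> \<longrightarrow>
            weil_height \<alpha> \<ge>
              (1 + g n) * sqrt (real n / (200 * pi)) * (ln (ln (real n)) / ln (real n)) ^ 3))
   \<and> (\<forall>C :: real. \<forall>\<^sub>F n in sequentially.
        \<forall>(\<beta>::complex) (b :: nat \<Rightarrow> complex) (a :: nat \<Rightarrow> int) \<alpha>.
          n \<ge> 5 \<longrightarrow> alternating_conjugates n \<beta> b \<longrightarrow> \<alpha> = (\<Prod>i=1..n. b i powi a i) \<longrightarrow>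
          rat_adjoin {\<alpha>} = rat_adjoin (b ` {1..n}) \<longrightarrow> algebraic_unit \<beta> \<longrightarrow>
            weil_height \<alpha> \<ge> C)"
proof -
  define target where "target n = sqrt (real n / (200 * pi)) * (ln (ln (real n)) / ln (real n)) ^ 3" for n :: nat
  have part1: "(rat_adjoin {\<alpha>} = rat_adjoin (b ` {1..n}) \<longleftrightarrow>
             card {(i, j). i \<in> {1..n} \<and> j \<in> {1..n} \<and> i < j \<and> a i = a j} \<le> 1) \<and>
          (card {(i, j). i \<in> {1..n} \<and> j \<in> {1..n} \<and> i < j \<and> a i = a j} \<le> 1 \<longleftrightarrow>
             card (a ` {1..n}) \<ge> n - 1)"
    if h: "n \<ge> 5" "alternating_conjugates n \<beta> b" "\<alpha> = (\<Prod>i=1..n. b i powi a i)" for n \<beta> b and a :: "nat \<Rightarrow> int" and \<alpha>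
  proof -
    interpret alternating n \<beta> b using h by unfold_locales
    have "\<alpha> = monomial a" using h(3) by (simp add: monomial_def)
    then show ?thesis
      unfolding equal_pairs_def[symmetric] using generator_iff_equal_pairs[of a] card_equal_pairs_le_1_iff[of n a]
      by (simp add: K_def)
  qed
  obtain n0 where n0: "\<And>n \<beta> b a. n \<ge> n0 \<Longrightarrow> alternating_unit n \<beta> b \<Longrightarrow>
     rat_adjoin {alternating.monomial n b a} = rat_adjoin (b ` {1..n}) \<Longrightarrow>
     weil_height (alternating.monomial n b a) \<ge> target n"
    using eventually_height_bound unfolding eventually_sequentially target_def by blast
  have bound: "weil_height \<alpha> \<ge> 0" "n \<ge> n0 \<Longrightarrow> weil_height \<alpha> \<ge> target n"
    if h: "n \<ge> 5" "alternating_conjugates n \<beta> b" "\<alpha> = (\<Prod>i=1..n. b i powi a i)"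
      "rat_adjoin {\<alpha>} = rat_adjoin (b ` {1..n})" "algebraic_unit \<beta>" for n \<beta> b and a :: "nat \<Rightarrow> int" and \<alpha>
  proof -
    interpret alternating_unit n \<beta> b using h by unfold_locales
    have \<alpha>: "\<alpha> = monomial a" using h(3) by (simp add: monomial_def)
    show "weil_height \<alpha> \<ge> 0" unfolding \<alpha> by (rule weil_height_monomial_nonneg)
    show "n \<ge> n0 \<Longrightarrow> weil_height \<alpha> \<ge> target n"
      unfolding \<alpha> by (rule n0[OF _ alternating_unit_axioms h(4)[unfolded \<alpha>]])
  qed
  \<comment> \<open>For n < n0 the factor 1 + g n is 0, and the claim reduces to the height being
    nonnegative.\<close>
  define g where "g n = (if n \<ge> n0 then 0 else -1 :: real)" for n
  have "\<forall>\<^sub>F n in sequentially. g n = 0"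
    using eventually_ge_at_top[of n0] by eventually_elim (simp add: g_def)
  then have g0: "g \<longlonglongrightarrow> 0" by (rule tendsto_eventually)
  have part2: "weil_height \<alpha> \<ge> (1 + g n) * sqrt (real n / (200 * pi)) * (ln (ln (real n)) / ln (real n)) ^ 3"
    if h: "n \<ge> 5" "alternating_conjugates n \<beta> b" "\<alpha> = (\<Prod>i=1..n. b i powi a i)"
      "rat_adjoin {\<alpha>} = rat_adjoin (b ` {1..n})" "algebraic_unit \<beta>" for n \<beta> b and a :: "nat \<Rightarrow> int" and \<alpha>
    using bound[OF h] by (cases "n \<ge> n0") (simp_all add: g_def target_def)
  have part3: "\<forall>\<^sub>F n in sequentially. \<forall>\<beta> b (a :: nat \<Rightarrow> int) \<alpha>.
          n \<ge> 5 \<longrightarrow> alternating_conjugates n \<beta> b \<longrightarrow> \<alpha> = (\<Prod>i=1..n. b i powi a i) \<longrightarrow>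
          rat_adjoin {\<alpha>} = rat_adjoin (b ` {1..n}) \<longrightarrow> algebraic_unit \<beta> \<longrightarrow> weil_height \<alpha> \<ge> C" for C
  proof -
    have "\<forall>\<^sub>F n in sequentially. target n \<ge> C"
      using filterlim_target unfolding filterlim_at_top target_def by blast
    then show ?thesis
      using eventually_ge_at_top[of n0]
    proof eventually_elim
      case (elim n)
      show ?case
      proof (intro allI impI)
        fix \<beta> b and a :: "nat \<Rightarrow> int" and \<alpha>
        assume h: "n \<ge> 5" "alternating_conjugates n \<beta> b" "\<alpha> = (\<Prod>i=1..n. b i powi a i)"
          "rat_adjoin {\<alpha>} = rat_adjoin (b ` {1..n})" "algebraic_unit \<beta>"
        show "weil_height \<alpha> \<ge> C" using elim(1) bound(2)[OF h elim(2)] by (rule order_trans)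
      qed
    qed
  qed
  show ?thesis using part1 g0 part2 part3 by blast
qed

end
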